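(* Let $\mathbb{S}$ be a partial Horn theory over an $S$-sorted signature $\Sigma$. Let $(\Omega,E)$ be an $\mathbb{S}$-relative algebraic theory with forgetful functor $U:\mathrm{Alg}(\Omega,E)\to\mathbb{S}\text{-}\mathrm{PMod}$. Then, for every replete full subcategory $\mathscr{E}\subseteq\mathrm{Alg}(\Omega,E)$, the following are equivalent: (i) $\mathscr{E}$ is definable by $\mathbb{S}$-relative judgments, i.e., there exists a set $E'$ of $\mathbb{S}$-relative judgments satisfying $\mathscr{E}=\mathrm{Alg}(\Omega,E\cup E')$. (ii) $\mathscr{E}\subseteq\mathrm{Alg}(\Omega,E)$ is closed under products, $\Sigma$-closed subobjects, $U$-retracts, and filtered colimits.
   Context: Partial Horn logic. For a set $S$ of sorts, an $S$-sorted signature $\Sigma$ consists of a set of function symbols, each with an arity $f:s_1\times\dots\times s_n\to s$, and a set of relation symbols, each with an arity $R:s_1\times\dots\times s_n$ ($n\ge 0$, $s_i,s\in S$). Each sort has a fixed countably infinite set of variables, disjoint for distinct sorts. Terms are built from variables and function symbols respecting sorts. Horn formulas are built from $R(\tau_1,\dots,\tau_n)$, $\tau=\tau'$ (terms of the same type) and $\top$ by binary conjunction $\wedge$. A context $\vec x$ is a finite tuple of distinct variables; all terms $\vec x.\tau$ and formulas $\vec x.\phi$ are considered in a context containing all their variables. A Horn sequent $\phi\vdash_{\vec x}\psi$ is a pair of Horn formulas in the same context. A partial Horn theory over $\Sigma$ is a set of Horn sequents over $\Sigma$. A partial $\Sigma$-structure $M$ has a set $M_s$ for each sort, a partial map $[\![f]\!]_M:M_{s_1}\times\dots\times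 M_{s_n}\rightharpoonup M_s$ for each $f$, and a subset $[\![R]\!]_M\subseteq M_{s_1}\times\dots\times M_{s_n}$ for each $R$. Terms are interpreted as partial maps ($f(\tau_1,\dots,\tau_n)$ is defined at $\vec m$ iff all $\tau_i$ are defined at $\vec m$ and $[\![f]\!]_M$ is defined at the resulting tuple); $[\![\vec x.\phi]\!]_M\subseteq\prod_iM_{s_i}$ is defined by: $R(\vec\tau)$ holds at $\vec m$ iff all $\tau_i$ are defined there and the tuple of values is in $[\![R]\!]_M$; $\tau=\tau'$ holds iff both are defined and equal; $\top$ always holds; $\wedge$ is intersection. $\phi\vdash_{\vec x}\psi$ is valid in $M$ if $[\![\vec x.\phi]\!]_M\subseteq[\![\vec x.\psi]\!]_M$. A partial $\mathbb{S}$-model is a partial structure in which all sequents of $\mathbb{S}$ are valid. A $\Sigma$-homomorphism $h:M\to N$ is a family of total maps $h_s:M_s\to N_s$ such that if $[\![f]\!]_M(\vec m)$ is defined then $[\![f]\!]_N(h\vec m)$ is defined and equals $h([\![f]\!]_M(\vec m))$, and $\vec m\in[\![R]\!]_M$ implies $h\vec m\in[\![R]\!]_N$. $\mathbb{S}\text{-}\mathrm{PMod}$ is the category of partial $\mathbb{S}$-models and $\Sigma$-homomorphisms. Relative algebraic theories. An $\mathbb{S}$-relative signature $\Omega$ is a set with, for each $\omega\in\Omega$, a Horn formula-in-context $\mathrm{ar}(\omega)=\vec x.\phi$ over $\Sigma$ and a sort $\mathrm{type}(\omega)\in S$. $\Sigma+\Omega$ is $\Sigma$ with each $\omega$ added as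 a function symbol $s_1\times\dots\times s_n\to\mathrm{type}(\omega)$, where $s_1,\dots,s_n$ are the sorts of the context of $\mathrm{ar}(\omega)$. An $\mathbb{S}$-relative judgment is a Horn sequent $\phi\vdash_{\vec x}\psi$ over $\Sigma+\Omega$ with $\phi$ over $\Sigma$. An $\mathbb{S}$-relative algebraic theory is a pair $(\Omega,E)$ of an $\mathbb{S}$-relative signature and a set $E$ of $\mathbb{S}$-relative judgments. An $\Omega$-algebra $\mathbb{A}$ is a partial $\mathbb{S}$-model $A$ with, for each $\omega\in\Omega$, a map $[\![\omega]\!]_{\mathbb{A}}:[\![\mathrm{ar}(\omega)]\!]_A\to A_{\mathrm{type}(\omega)}$; it is regarded as a partial $(\Sigma+\Omega)$-structure in which $\omega$ is a partial operation with domain exactly $[\![\mathrm{ar}(\omega)]\!]_A$. $\mathrm{Alg}(\Omega,E)$ is the category of $\Omega$-algebras in which all judgments of $E$ are valid, with $(\Sigma+\Omega)$-homomorphisms. Closure conditions. A monomorphism in $\mathbb{S}\text{-}\mathrm{PMod}$ is the same as a sortwise injective homomorphism; a monomorphism $m:A\to B$ is $\Sigma$-closed if for all tuples $\vec a$ of $A$: whenever $[\![f]\!]_B(m\vec a)$ is defined for a function symbol $f\in\Sigma$, $[\![f]\!]_A(\vec a)$ is defined, and whenever $m\vec a\in[\![R]\!]_B$ for a relation symbol $R\in\Sigma$, $\vec a\in[\![R]\!]_A$. A $\Sigma$-closed subobject in $\mathrm{Alg}(\Omega,E)$ is one given by a morphism whose underlying morphism in $\mathbb{S}\text{-}\mathrm{PMod}$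 is a $\Sigma$-closed monomorphism. For a functor $U$, a morphism $p:X\to Y$ is a $U$-retraction if $Up$ has a section (a morphism $s$ with $(Up)s=\mathrm{id}$), and then $Y$ is a $U$-retract of $X$. Closed under $\Sigma$-closed subobjects (resp. $U$-retracts) means: a $\Sigma$-closed subobject (resp. $U$-retract) of an object of $\mathscr{E}$ lies in $\mathscr{E}$. *)

theory Defs
  imports Complex_Main "HOL-Library.Equipollence" "HOL-Library.FuncSet"
begin

section \<open>Universes of small sets\<close>

text \<open>
  HOL has no proper class of all sets, so the categories below are formed relative to a family
  \<open>V\<close> of "small" subsets of an arbitrary type: carriers of models and algebras, and index sets
  and index categories of products and colimits, belong to \<open>V\<close>. The closure properties demanded of
  \<open>V\<close> depend on an infinite small set \<open>K\<close>, which will bound the size of the signatures: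
  \<open>V\<close> is closed under small unions and under products indexed by \<open>K\<close>.
  The small subsets of a Grothendieck universe (uncountable) satisfy this for every infinite small
  \<open>K\<close>. So does the family \<open>UNIV\<close> of all subsets of a type whose cardinality \<open>\<mu>\<close> satisfies
  \<open>\<mu>\<^sup>\<kappa> = \<mu>\<close>, where \<open>\<kappa>\<close> is the cardinality of \<open>K\<close>.
\<close>

definition small_universe :: "'u set \<Rightarrow> 'u set set \<Rightarrow> bool" where
  "small_universe K V \<longleftrightarrow>
     infinite K \<and> K \<in> V \<and>
     (\<forall>X\<in>V. \<forall>Y. Y \<lesssim> X \<longrightarrow> Y \<in> V) \<and>
     (\<forall>I\<in>V. \<forall>X. (\<forall>i\<in>I. X i \<in> V) \<longrightarrow> (\<Union>i\<in>I. X i) \<in> V) \<and>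
     (\<forall>X. (\<forall>k\<in>K. X k \<in> V) \<longrightarrow> (\<exists>Y\<in>V. (\<Pi>\<^sub>E k\<in>K. X k) \<lesssim> Y))"

section \<open>Categories\<close>

text \<open>
  Hom-sets need not be disjoint, so composition carries the three objects as arguments:
  \<open>Comp C X Y Z g f\<close> is the composite of \<open>f : X \<rightarrow> Y\<close> and \<open>g : Y \<rightarrow> Z\<close>.
\<close>

record ('o, 'a) category =
  Ob :: "'o set"
  Hom :: "'o \<Rightarrow> 'o \<Rightarrow> 'a set"
  Id :: "'o \<Rightarrow> 'a"
  Comp :: "'o \<Rightarrow> 'o \<Rightarrow> 'o \<Rightarrow> 'a \<Rightarrow> 'a \<Rightarrow> 'a"

definition is_category :: "('o, 'a) category \<Rightarrow> bool" where
  "is_category C \<longleftrightarrow>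
     (\<forall>X\<in>Ob C. Id C X \<in> Hom C X X) \<and>
     (\<forall>X\<in>Ob C. \<forall>Y\<in>Ob C. \<forall>Z\<in>Ob C. \<forall>f\<in>Hom C X Y. \<forall>g\<in>Hom C Y Z.
        Comp C X Y Z g f \<in> Hom C X Z) \<and>
     (\<forall>X\<in>Ob C. \<forall>Y\<in>Ob C. \<forall>f\<in>Hom C X Y.
        Comp C X X Y f (Id C X) = f \<and> Comp C X Y Y (Id C Y) f = f) \<and>
     (\<forall>W\<in>Ob C. \<forall>X\<in>Ob C. \<forall>Y\<in>Ob C. \<forall>Z\<in>Ob C.
        \<forall>f\<in>Hom C W X. \<forall>g\<in>Hom C X Y. \<forall>h\<in>Hom C Y Z.
        Comp C W Y Z h (Comp C W X Y g f) = Comp C W X Z (Comp C X Y Z h g) f)"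

record ('o, 'a, 'p, 'b) cfunctor =
  fob :: "'o \<Rightarrow> 'p"
  farr :: "'o \<Rightarrow> 'o \<Rightarrow> 'a \<Rightarrow> 'b"

definition is_functor ::
  "('o, 'a) category \<Rightarrow> ('p, 'b) category \<Rightarrow> ('o, 'a, 'p, 'b) cfunctor \<Rightarrow> bool" where
  "is_functor C D F \<longleftrightarrow>
     (\<forall>X\<in>Ob C. fob F X \<in> Ob D) \<and>
     (\<forall>X\<in>Ob C. \<forall>Y\<in>Ob C. \<forall>f\<in>Hom C X Y. farr F X Y f \<in> Hom D (fob F X) (fob F Y)) \<and>
     (\<forall>X\<in>Ob C. farr F X X (Id C X) = Id D (fob F X)) \<and>
     (\<forall>X\<in>Ob C. \<forall>Y\<in>Ob C. \<forall>Z\<in>Ob C. \<forall>f\<in>Hom C X Y. \<forall>g\<in>Hom C Y Z.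
        farr F X Z (Comp C X Y Z g f) =
        Comp D (fob F X) (fob F Y) (fob F Z) (farr F Y Z g) (farr F X Y f))"

definition isomorphic :: "('o, 'a) category \<Rightarrow> 'o \<Rightarrow> 'o \<Rightarrow> bool" where
  "isomorphic C X Y \<longleftrightarrow>
     (\<exists>f\<in>Hom C X Y. \<exists>g\<in>Hom C Y X. Comp C X Y X g f = Id C X \<and> Comp C Y X Y f g = Id C Y)"

text \<open>A full subcategory is represented by its set of objects.\<close>

definition replete_full_subcategory :: "('o, 'a) category \<Rightarrow> 'o set \<Rightarrow> bool" where
  "replete_full_subcategory C \<E> \<longleftrightarrow>
     \<E> \<subseteq> Ob C \<and> (\<forall>X\<in>\<E>. \<forall>Y\<in>Ob C. isomorphic C X Y \<longrightarrow> Y \<in> \<E>)"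

definition is_product ::
  "('o, 'a) category \<Rightarrow> 'i set \<Rightarrow> ('i \<Rightarrow> 'o) \<Rightarrow> 'o \<Rightarrow> ('i \<Rightarrow> 'a) \<Rightarrow> bool" where
  "is_product C I X P p \<longleftrightarrow>
     P \<in> Ob C \<and> (\<forall>i\<in>I. p i \<in> Hom C P (X i)) \<and>
     (\<forall>Q\<in>Ob C. \<forall>q. (\<forall>i\<in>I. q i \<in> Hom C Q (X i)) \<longrightarrow>
        (\<exists>!u. u \<in> Hom C Q P \<and> (\<forall>i\<in>I. Comp C Q P (X i) (p i) u = q i)))"

definition is_cocone ::
  "('j, 'b) category \<Rightarrow> ('o, 'a) category \<Rightarrow> ('j, 'b, 'o, 'a) cfunctor \<Rightarrow>
   'o \<Rightarrow> ('j \<Rightarrow> 'a) \<Rightarrow> bool" where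
  "is_cocone J C D L c \<longleftrightarrow>
     L \<in> Ob C \<and> (\<forall>i\<in>Ob J. c i \<in> Hom C (fob D i) L) \<and>
     (\<forall>i\<in>Ob J. \<forall>j\<in>Ob J. \<forall>f\<in>Hom J i j.
        Comp C (fob D i) (fob D j) L (c j) (farr D i j f) = c i)"

definition is_colimit ::
  "('j, 'b) category \<Rightarrow> ('o, 'a) category \<Rightarrow> ('j, 'b, 'o, 'a) cfunctor \<Rightarrow>
   'o \<Rightarrow> ('j \<Rightarrow> 'a) \<Rightarrow> bool" where
  "is_colimit J C D L c \<longleftrightarrow>
     is_cocone J C D L c \<and>
     (\<forall>X d. is_cocone J C D X d \<longrightarrow>
        (\<exists>!u. u \<in> Hom C L X \<and> (\<forall>i\<in>Ob J. Comp C (fob D i) L X u (c i) = d i)))"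

definition small_category :: "'u set set \<Rightarrow> ('u, 'u) category \<Rightarrow> bool" where
  "small_category V J \<longleftrightarrow>
     is_category J \<and> Ob J \<in> V \<and> (\<forall>i\<in>Ob J. \<forall>j\<in>Ob J. Hom J i j \<in> V)"

definition filtered :: "('o, 'a) category \<Rightarrow> bool" where
  "filtered J \<longleftrightarrow>
     Ob J \<noteq> {} \<and>
     (\<forall>i\<in>Ob J. \<forall>j\<in>Ob J. \<exists>k\<in>Ob J. Hom J i k \<noteq> {} \<and> Hom J j k \<noteq> {}) \<and>
     (\<forall>i\<in>Ob J. \<forall>j\<in>Ob J. \<forall>f\<in>Hom J i j. \<forall>g\<in>Hom J i j.
        \<exists>k\<in>Ob J. \<exists>h\<in>Hom J j k. Comp J i j k h f = Comp J i j k h g)"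

definition closed_under_products ::
  "'u set set \<Rightarrow> ('o, 'a) category \<Rightarrow> 'o set \<Rightarrow> bool" where
  "closed_under_products V C \<E> \<longleftrightarrow>
     (\<forall>I\<in>V. \<forall>(X :: 'u \<Rightarrow> 'o) P p.
        (\<forall>i\<in>I. X i \<in> \<E>) \<and> is_product C I X P p \<longrightarrow> P \<in> \<E>)"

definition closed_under_filtered_colimits ::
  "'u set set \<Rightarrow> ('o, 'a) category \<Rightarrow> 'o set \<Rightarrow> bool" where
  "closed_under_filtered_colimits V C \<E> \<longleftrightarrow>
     (\<forall>(J :: ('u, 'u) category) D L c.
        small_category V J \<and> filtered J \<and> is_functor J C D \<and>
        (\<forall>i\<in>Ob J. fob D i \<in> \<E>) \<and> is_colimit J C D L c \<longrightarrow> L \<in> \<E>)"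

definition is_U_retraction ::
  "('o, 'a) category \<Rightarrow> ('p, 'b) category \<Rightarrow> ('o, 'a, 'p, 'b) cfunctor \<Rightarrow>
   'o \<Rightarrow> 'o \<Rightarrow> 'a \<Rightarrow> bool" where
  "is_U_retraction C D U X Y p \<longleftrightarrow>
     p \<in> Hom C X Y \<and>
     (\<exists>s\<in>Hom D (fob U Y) (fob U X).
        Comp D (fob U Y) (fob U X) (fob U Y) (farr U X Y p) s = Id D (fob U Y))"

definition closed_under_U_retracts ::
  "('o, 'a) category \<Rightarrow> ('p, 'b) category \<Rightarrow> ('o, 'a, 'p, 'b) cfunctor \<Rightarrow>
   'o set \<Rightarrow> bool" where
  "closed_under_U_retracts C D U \<E> \<longleftrightarrow>
     (\<forall>X\<in>\<E>. \<forall>Y\<in>Ob C. \<forall>p. is_U_retraction C D U X Y p \<longrightarrow> Y \<in> \<E>)"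

section \<open>Partial Horn logic\<close>

record ('s, 'f, 'r) hsig =
  Sorts :: "'s set"
  Funs :: "'f set"
  Rels :: "'r set"
  fdom :: "'f \<Rightarrow> 's list"
  fcod :: "'f \<Rightarrow> 's"
  rdom :: "'r \<Rightarrow> 's list"

definition wf_sig :: "('s, 'f, 'r) hsig \<Rightarrow> bool" where
  "wf_sig \<Sigma> \<longleftrightarrow>
     (\<forall>f\<in>Funs \<Sigma>. set (fdom \<Sigma> f) \<subseteq> Sorts \<Sigma> \<and> fcod \<Sigma> f \<in> Sorts \<Sigma>) \<and>
     (\<forall>R\<in>Rels \<Sigma>. set (rdom \<Sigma> R) \<subseteq> Sorts \<Sigma>)"

text \<open>The pair \<open>(s, n)\<close> is the \<open>n\<close>-th variable of sort \<open>s\<close>.\<close>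

type_synonym 's var = "'s \<times> nat"

datatype ('s, 'f) tm = Var "'s var" | Fn 'f "('s, 'f) tm list"

datatype ('s, 'f, 'r) horn =
    HRel 'r "('s, 'f) tm list"
  | HEq "('s, 'f) tm" "('s, 'f) tm"
  | HTrue
  | HAnd "('s, 'f, 'r) horn" "('s, 'f, 'r) horn"

definition wf_ctx :: "('s, 'f, 'r) hsig \<Rightarrow> 's var list \<Rightarrow> bool" where
  "wf_ctx \<Sigma> xs \<longleftrightarrow> distinct xs \<and> fst ` set xs \<subseteq> Sorts \<Sigma>"

inductive has_sort :: "('s, 'f, 'r) hsig \<Rightarrow> 's var list \<Rightarrow> ('s, 'f) tm \<Rightarrow> 's \<Rightarrow> bool"
  for \<Sigma> xs where
    "x \<in> set xs \<Longrightarrow> has_sort \<Sigma> xs (Var x) (fst x)"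
  | "f \<in> Funs \<Sigma> \<Longrightarrow> list_all2 (has_sort \<Sigma> xs) ts (fdom \<Sigma> f) \<Longrightarrow>
     has_sort \<Sigma> xs (Fn f ts) (fcod \<Sigma> f)"

primrec wf_horn :: "('s, 'f, 'r) hsig \<Rightarrow> 's var list \<Rightarrow> ('s, 'f, 'r) horn \<Rightarrow> bool" where
  "wf_horn \<Sigma> xs (HRel R ts) \<longleftrightarrow> R \<in> Rels \<Sigma> \<and> list_all2 (has_sort \<Sigma> xs) ts (rdom \<Sigma> R)"
| "wf_horn \<Sigma> xs (HEq t u) \<longleftrightarrow> (\<exists>s. has_sort \<Sigma> xs t s \<and> has_sort \<Sigma> xs u s)"
| "wf_horn \<Sigma> xs HTrue \<longleftrightarrow> True"
| "wf_horn \<Sigma> xs (HAnd \<phi> \<psi>) \<longleftrightarrow> wf_horn \<Sigma> xs \<phi> \<and> wf_horn \<Sigma> xs \<psi>"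

text \<open>The triple \<open>(xs, \<phi>, \<psi>)\<close> is the sequent \<open>\<phi> \<turnstile> \<psi>\<close> in the context \<open>xs\<close>.\<close>

type_synonym ('s, 'f, 'r) sequent = "'s var list \<times> ('s, 'f, 'r) horn \<times> ('s, 'f, 'r) horn"

fun wf_sequent :: "('s, 'f, 'r) hsig \<Rightarrow> ('s, 'f, 'r) sequent \<Rightarrow> bool" where
  "wf_sequent \<Sigma> (xs, \<phi>, \<psi>) \<longleftrightarrow> wf_ctx \<Sigma> xs \<and> wf_horn \<Sigma> xs \<phi> \<and> wf_horn \<Sigma> xs \<psi>"

definition partial_horn_theory ::
  "('s, 'f, 'r) hsig \<Rightarrow> ('s, 'f, 'r) sequent set \<Rightarrow> bool" where
  "partial_horn_theory \<Sigma> T \<longleftrightarrow> wf_sig \<Sigma> \<and> (\<forall>\<sigma>\<in>T. wf_sequent \<Sigma> \<sigma>)"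

record ('s, 'f, 'r, 'u) pstruct =
  car :: "'s \<Rightarrow> 'u set"
  opn :: "'f \<Rightarrow> 'u list \<rightharpoonup> 'u"
  rel :: "'r \<Rightarrow> 'u list set"

definition tuples :: "('s, 'f, 'r, 'u) pstruct \<Rightarrow> 's list \<Rightarrow> 'u list set" where
  "tuples M ss = {as. list_all2 (\<lambda>a s. a \<in> car M s) as ss}"

text \<open>
  Data outside the signature is normalized (empty), so that a structure is determined by its
  carriers, operations and relations.
\<close>

definition partial_structure ::
  "('s, 'f, 'r) hsig \<Rightarrow> ('s, 'f, 'r, 'u) pstruct \<Rightarrow> bool" where
  "partial_structure \<Sigma> M \<longleftrightarrow>
     (\<forall>f\<in>Funs \<Sigma>. dom (opn M f) \<subseteq> tuples M (fdom \<Sigma> f) \<and> ran (opn M f) \<subseteq> car M (fcod \<Sigma> f)) \<and>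
     (\<forall>R\<in>Rels \<Sigma>. rel M R \<subseteq> tuples M (rdom \<Sigma> R)) \<and>
     (\<forall>s. s \<notin> Sorts \<Sigma> \<longrightarrow> car M s = {}) \<and>
     (\<forall>f. f \<notin> Funs \<Sigma> \<longrightarrow> opn M f = Map.empty) \<and>
     (\<forall>R. R \<notin> Rels \<Sigma> \<longrightarrow> rel M R = {})"

text \<open>
  The value of a term under a partial assignment, \<open>None\<close> meaning undefined;
  \<open>those\<close> yields the list of values if all entries are defined, and \<open>None\<close> otherwise.
\<close>

primrec tm_val ::
  "('s, 'f, 'r, 'u) pstruct \<Rightarrow> ('s var \<rightharpoonup> 'u) \<Rightarrow> ('s, 'f) tm \<Rightarrow> 'u option" where
  "tm_val M \<rho> (Var x) = \<rho> x"
| "tm_val M \<rho> (Fn f ts) = Option.bind (those (map (tm_val M \<rho>) ts)) (opn M f)"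

primrec holds ::
  "('s, 'f, 'r, 'u) pstruct \<Rightarrow> ('s var \<rightharpoonup> 'u) \<Rightarrow> ('s, 'f, 'r) horn \<Rightarrow> bool" where
  "holds M \<rho> (HRel R ts) \<longleftrightarrow> (\<exists>as. those (map (tm_val M \<rho>) ts) = Some as \<and> as \<in> rel M R)"
| "holds M \<rho> (HEq t u) \<longleftrightarrow> (\<exists>a. tm_val M \<rho> t = Some a \<and> tm_val M \<rho> u = Some a)"
| "holds M \<rho> HTrue \<longleftrightarrow> True"
| "holds M \<rho> (HAnd \<phi> \<psi>) \<longleftrightarrow> holds M \<rho> \<phi> \<and> holds M \<rho> \<psi>"

definition interp ::
  "('s, 'f, 'r, 'u) pstruct \<Rightarrow> 's var list \<Rightarrow> ('s, 'f, 'r) horn \<Rightarrow> 'u list set" where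
  "interp M xs \<phi> = {ms \<in> tuples M (map fst xs). holds M (map_of (zip xs ms)) \<phi>}"

fun valid_in :: "('s, 'f, 'r, 'u) pstruct \<Rightarrow> ('s, 'f, 'r) sequent \<Rightarrow> bool" where
  "valid_in M (xs, \<phi>, \<psi>) \<longleftrightarrow> interp M xs \<phi> \<subseteq> interp M xs \<psi>"

definition partial_model ::
  "('s, 'f, 'r) hsig \<Rightarrow> ('s, 'f, 'r) sequent set \<Rightarrow> ('s, 'f, 'r, 'u) pstruct \<Rightarrow> bool" where
  "partial_model \<Sigma> T M \<longleftrightarrow> partial_structure \<Sigma> M \<and> (\<forall>\<sigma>\<in>T. valid_in M \<sigma>)"

text \<open>
  The components \<open>h s\<close> are extensional functions (fixed value off the carrier), so that equality of
  homomorphisms is equality in HOL.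
\<close>

definition homs ::
  "('s, 'f, 'r) hsig \<Rightarrow> ('s, 'f, 'r, 'u) pstruct \<Rightarrow> ('s, 'f, 'r, 'u) pstruct \<Rightarrow>
   ('s \<Rightarrow> 'u \<Rightarrow> 'u) set" where
  "homs \<Sigma> M N =
     {h. (\<forall>s. h s \<in> car M s \<rightarrow>\<^sub>E car N s) \<and>
         (\<forall>f\<in>Funs \<Sigma>. \<forall>as b. opn M f as = Some b \<longrightarrow>
            opn N f (map2 h (fdom \<Sigma> f) as) = Some (h (fcod \<Sigma> f) b)) \<and>
         (\<forall>R\<in>Rels \<Sigma>. \<forall>as\<in>rel M R. map2 h (rdom \<Sigma> R) as \<in> rel N R)}"

definition id_hom :: "('s, 'f, 'r, 'u) pstruct \<Rightarrow> 's \<Rightarrow> 'u \<Rightarrow> 'u" where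
  "id_hom M = (\<lambda>s. restrict id (car M s))"

definition comp_hom ::
  "('s, 'f, 'r, 'u) pstruct \<Rightarrow> ('s \<Rightarrow> 'u \<Rightarrow> 'u) \<Rightarrow> ('s \<Rightarrow> 'u \<Rightarrow> 'u) \<Rightarrow> 's \<Rightarrow> 'u \<Rightarrow> 'u" where
  "comp_hom M g h = (\<lambda>s. compose (car M s) (g s) (h s))"

definition PMod ::
  "'u set set \<Rightarrow> ('s, 'f, 'r) hsig \<Rightarrow> ('s, 'f, 'r) sequent set \<Rightarrow>
   (('s, 'f, 'r, 'u) pstruct, 's \<Rightarrow> 'u \<Rightarrow> 'u) category" where
  "PMod V \<Sigma> T =
     \<lparr> Ob = {M. partial_model \<Sigma> T M \<and> (\<forall>s. car M s \<in> V)},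
       Hom = homs \<Sigma>,
       Id = id_hom,
       Comp = (\<lambda>X Y Z. comp_hom X) \<rparr>"

text \<open>Monomorphisms of partial models are the sortwise injective homomorphisms.\<close>

definition closed_mono ::
  "('s, 'f, 'r) hsig \<Rightarrow> ('s, 'f, 'r, 'u) pstruct \<Rightarrow> ('s, 'f, 'r, 'u) pstruct \<Rightarrow>
   ('s \<Rightarrow> 'u \<Rightarrow> 'u) \<Rightarrow> bool" where
  "closed_mono \<Sigma> M N m \<longleftrightarrow>
     m \<in> homs \<Sigma> M N \<and> (\<forall>s\<in>Sorts \<Sigma>. inj_on (m s) (car M s)) \<and>
     (\<forall>f\<in>Funs \<Sigma>. \<forall>as\<in>tuples M (fdom \<Sigma> f).
        opn N f (map2 m (fdom \<Sigma> f) as) \<noteq> None \<longrightarrow> opn M f as \<noteq> None) \<and>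
     (\<forall>R\<in>Rels \<Sigma>. \<forall>as\<in>tuples M (rdom \<Sigma> R).
        map2 m (rdom \<Sigma> R) as \<in> rel N R \<longrightarrow> as \<in> rel M R)"

section \<open>Relative algebraic theories\<close>

text \<open>\<open>arity \<Omega> w\<close> is a formula in context, given as a pair \<open>(xs, \<phi>)\<close>.\<close>

record ('s, 'f, 'r, 'w) rsig =
  Ops :: "'w set"
  arity :: "'w \<Rightarrow> 's var list \<times> ('s, 'f, 'r) horn"
  otype :: "'w \<Rightarrow> 's"

definition relative_signature ::
  "('s, 'f, 'r) hsig \<Rightarrow> ('s, 'f, 'r, 'w) rsig \<Rightarrow> bool" where
  "relative_signature \<Sigma> \<Omega> \<longleftrightarrow>
     (\<forall>w\<in>Ops \<Omega>. wf_ctx \<Sigma> (fst (arity \<Omega> w)) \<and>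
        wf_horn \<Sigma> (fst (arity \<Omega> w)) (snd (arity \<Omega> w)) \<and> otype \<Omega> w \<in> Sorts \<Sigma>)"

definition sig_plus ::
  "('s, 'f, 'r) hsig \<Rightarrow> ('s, 'f, 'r, 'w) rsig \<Rightarrow> ('s, 'f + 'w, 'r) hsig" where
  "sig_plus \<Sigma> \<Omega> =
     \<lparr> Sorts = Sorts \<Sigma>,
       Funs = Funs \<Sigma> <+> Ops \<Omega>,
       Rels = Rels \<Sigma>,
       fdom = case_sum (fdom \<Sigma>) (\<lambda>w. map fst (fst (arity \<Omega> w))),
       fcod = case_sum (fcod \<Sigma>) (otype \<Omega>),
       rdom = rdom \<Sigma> \<rparr>"

fun relative_judgment ::
  "('s, 'f, 'r) hsig \<Rightarrow> ('s, 'f, 'r, 'w) rsig \<Rightarrow> ('s, 'f + 'w, 'r) sequent \<Rightarrow> bool" where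
  "relative_judgment \<Sigma> \<Omega> (xs, \<phi>, \<psi>) \<longleftrightarrow>
     wf_sequent (sig_plus \<Sigma> \<Omega>) (xs, \<phi>, \<psi>) \<and>
     (\<exists>\<phi>'. wf_horn \<Sigma> xs \<phi>' \<and> \<phi> = map_horn id Inl id \<phi>')"

definition relative_algebraic_theory ::
  "('s, 'f, 'r) hsig \<Rightarrow> ('s, 'f, 'r, 'w) rsig \<Rightarrow> ('s, 'f + 'w, 'r) sequent set \<Rightarrow> bool" where
  "relative_algebraic_theory \<Sigma> \<Omega> E \<longleftrightarrow>
     relative_signature \<Sigma> \<Omega> \<and> (\<forall>\<sigma>\<in>E. relative_judgment \<Sigma> \<Omega> \<sigma>)"

record ('s, 'f, 'r, 'w, 'u) algebra =
  und :: "('s, 'f, 'r, 'u) pstruct"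
  aop :: "'w \<Rightarrow> 'u list \<rightharpoonup> 'u"

definition omega_algebra ::
  "('s, 'f, 'r) hsig \<Rightarrow> ('s, 'f, 'r) sequent set \<Rightarrow> ('s, 'f, 'r, 'w) rsig \<Rightarrow>
   ('s, 'f, 'r, 'w, 'u) algebra \<Rightarrow> bool" where
  "omega_algebra \<Sigma> T \<Omega> A \<longleftrightarrow>
     partial_model \<Sigma> T (und A) \<and>
     (\<forall>w\<in>Ops \<Omega>. dom (aop A w) = interp (und A) (fst (arity \<Omega> w)) (snd (arity \<Omega> w)) \<and>
        ran (aop A w) \<subseteq> car (und A) (otype \<Omega> w)) \<and>
     (\<forall>w. w \<notin> Ops \<Omega> \<longrightarrow> aop A w = Map.empty)"

definition as_struct ::
  "('s, 'f, 'r, 'w, 'u) algebra \<Rightarrow> ('s, 'f + 'w, 'r, 'u) pstruct" where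
  "as_struct A =
     \<lparr> car = car (und A), opn = case_sum (opn (und A)) (aop A), rel = rel (und A) \<rparr>"

definition Alg ::
  "'u set set \<Rightarrow> ('s, 'f, 'r) hsig \<Rightarrow> ('s, 'f, 'r) sequent set \<Rightarrow> ('s, 'f, 'r, 'w) rsig \<Rightarrow>
   ('s, 'f + 'w, 'r) sequent set \<Rightarrow>
   (('s, 'f, 'r, 'w, 'u) algebra, 's \<Rightarrow> 'u \<Rightarrow> 'u) category" where
  "Alg V \<Sigma> T \<Omega> E =
     \<lparr> Ob = {A. omega_algebra \<Sigma> T \<Omega> A \<and> (\<forall>s. car (und A) s \<in> V) \<and>
                (\<forall>\<sigma>\<in>E. valid_in (as_struct A) \<sigma>)},
       Hom = (\<lambda>A B. homs (sig_plus \<Sigma> \<Omega>) (as_struct A) (as_struct B)),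
       Id = (\<lambda>A. id_hom (und A)),
       Comp = (\<lambda>A B C. comp_hom (und A)) \<rparr>"

definition forgetful ::
  "(('s, 'f, 'r, 'w, 'u) algebra, 's \<Rightarrow> 'u \<Rightarrow> 'u,
    ('s, 'f, 'r, 'u) pstruct, 's \<Rightarrow> 'u \<Rightarrow> 'u) cfunctor" where
  "forgetful = \<lparr> fob = und, farr = (\<lambda>A B h. h) \<rparr>"

definition closed_under_closed_subobjects ::
  "('s, 'f, 'r) hsig \<Rightarrow> (('s, 'f, 'r, 'w, 'u) algebra, 's \<Rightarrow> 'u \<Rightarrow> 'u) category \<Rightarrow>
   ('s, 'f, 'r, 'w, 'u) algebra set \<Rightarrow> bool" where
  "closed_under_closed_subobjects \<Sigma> C \<E> \<longleftrightarrow>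
     (\<forall>B\<in>\<E>. \<forall>A\<in>Ob C. \<forall>m\<in>Hom C A B.
        closed_mono \<Sigma> (fob forgetful A) (fob forgetful B) (farr forgetful A B m) \<longrightarrow> A \<in> \<E>)"

definition definable_by_judgments ::
  "'u set set \<Rightarrow> ('s, 'f, 'r) hsig \<Rightarrow> ('s, 'f, 'r) sequent set \<Rightarrow> ('s, 'f, 'r, 'w) rsig \<Rightarrow>
   ('s, 'f + 'w, 'r) sequent set \<Rightarrow> ('s, 'f, 'r, 'w, 'u) algebra set \<Rightarrow> bool" where
  "definable_by_judgments V \<Sigma> T \<Omega> E \<E> \<longleftrightarrow>
     (\<exists>E'. (\<forall>\<sigma>\<in>E'. relative_judgment \<Sigma> \<Omega> \<sigma>) \<and> \<E> = Ob (Alg V \<Sigma> T \<Omega> (E \<union> E')))"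

end

theory Submission
  imports Defs
begin

text \<open>
  Algebras are partial models of a Horn theory over the enlarged signature. Since the premise of a
  judgment is a formula over \<open>\<Sigma>\<close>, its truth is transported along the section of a \<open>U\<close>-retraction,
  and the conclusion comes back along the retraction; for the other closure properties the point
  is that products and \<open>\<Sigma>\<close>-closed subobjects reflect Horn formulas, and that a Horn formula true
  in a filtered colimit is already true at some stage.

  Conversely, let \<open>\<E>\<close> be closed and let \<open>A\<close> satisfy every judgment valid in \<open>\<E>\<close>. For a Horn formula
  \<open>\<phi>\<close> over \<open>\<Sigma>\<close> choose, for each atomic formula that \<open>\<phi>\<close> does not entail in \<open>\<E>\<close>, a
  counterexample in \<open>\<E>\<close>. The subalgebra of their product generated by the chosen tuples lies in \<open>\<E>\<close>
  and satisfies exactly the consequences of \<open>\<phi>\<close>, so it maps to every algebra of \<open>\<E>\<close>, and to \<open>A\<close>, as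
  soon as a tuple satisfying \<open>\<phi>\<close> is given there. Take these generic algebras for the finite parts
  of the diagram of \<open>A\<close>; their filtered colimit lies in \<open>\<E>\<close>, and \<open>A\<close> is a \<open>U\<close>-retract of it.
\<close>

section \<open>Cardinality\<close>

text \<open>Two obstacles shape the proof. The first is size: \<open>V\<close> need not have room
  for the set-theoretic product of a small family, so that product is formed only for families of
  size at most \<open>K\<close>; otherwise one works with the part generated by a finite context.
  There are at most \<open>K\<close> terms in such a context, which bounds both the carriers of a
  generic algebra and the number of counterexamples needed to build it. The second is that the
  premise of a judgment may mention only \<Sigma>. A part of the diagram of \<open>A\<close> used as
  a premise therefore records no operation of \<Omega>, and naming the elements of \<open>A\<close>
  gives a section that preserves \<Sigma> alone; this is why a U-retract appears instead of an
  isomorphism. Premises are also finite, so only finite parts of the diagram become formulas, and a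
  filtered colimit has to glue them together. The generic algebras map to \<open>A\<close> although
  \<open>A\<close> is not yet known to lie in \<E>: what holds of the generators follows from the
  premise throughout \<E>, hence is a judgment valid in \<E>, hence valid in
  \<open>A\<close>.\<close>

lemma infinite_UN_lepoll:
  assumes "infinite Y" "I \<lesssim> Y" "\<And>i. i \<in> I \<Longrightarrow> A i \<lesssim> Y"
  shows "(\<Union>i\<in>I. A i) \<lesssim> Y"
  using card_of_UNION_ordLeq_infinite[of Y I A] assms
  unfolding lepoll_def card_of_ordLeq by blast

lemma infinite_Times_lepoll:
  assumes "infinite Y" "A \<lesssim> Y" "B \<lesssim> Y"
  shows "A \<times> B \<lesssim> Y"
proof -
  have "Y \<times> Y \<lesssim> Y"
    by (simp add: assms(1) eqpoll_iff_card_of_ordIso eqpoll_imp_lepoll card_of_Times_same_infinite)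
  then show ?thesis
    using times_lepoll_mono[OF assms(2,3)] lepoll_trans by blast
qed

lemma infinite_Un_lepoll:
  assumes "infinite Y" "A \<lesssim> Y" "B \<lesssim> Y"
  shows "A \<union> B \<lesssim> Y"
proof -
  have "(UNIV :: bool set) \<lesssim> Y"
    using assms(1) by (intro finite_lepoll_infinite) simp_all
  then have "(\<Union>b. if b then A else B) \<lesssim> Y"
    by (rule infinite_UN_lepoll[OF assms(1)]) (simp add: assms(2,3))
  then show ?thesis unfolding Un_eq_UN .
qed

lemma image_lepoll_trans: "A \<lesssim> Y \<Longrightarrow> f ` A \<lesssim> Y"
  by (rule lepoll_trans[OF image_lepoll])

lemma subset_lepoll_trans: "A \<subseteq> B \<Longrightarrow> B \<lesssim> Y \<Longrightarrow> A \<lesssim> Y"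
  by (rule lepoll_trans[OF subset_imp_lepoll])

lemma infinite_lists_lepoll:
  assumes "infinite Y" "A \<lesssim> Y"
  shows "lists A \<lesssim> Y"
proof -
  have "{xs \<in> lists A. length xs = n} \<lesssim> Y" for n
  proof (induction n)
    case 0
    have "{xs \<in> lists A. length xs = 0} \<subseteq> {[]}" by auto
    moreover have "{[]} \<lesssim> Y"
      using assms(1) finite_lepoll_infinite by blast
    ultimately show ?case by (rule subset_lepoll_trans)
  next
    case (Suc n)
    have "{xs \<in> lists A. length xs = Suc n} \<subseteq>
      (\<lambda>(x, xs). x # xs) ` (A \<times> {xs \<in> lists A. length xs = n})"
      by (force simp: length_Suc_conv image_iff)
    then show ?case
      by (rule subset_lepoll_trans)
        (intro image_lepoll_trans infinite_Times_lepoll assms Suc)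
  qed
  then have "(\<Union>n. {xs \<in> lists A. length xs = n}) \<lesssim> Y"
    using assms(1) by (intro infinite_UN_lepoll) (auto simp: infinite_le_lepoll)
  moreover have "(\<Union>n. {xs \<in> lists A. length xs = n}) = lists A" by auto
  ultimately show ?thesis by simp
qed

lemma infinite_finite_subsets_lepoll:
  assumes "infinite Y" "A \<lesssim> Y"
  shows "{p. finite p \<and> p \<subseteq> A} \<lesssim> Y"
proof -
  have "{p. finite p \<and> p \<subseteq> A} \<subseteq> set ` lists A"
    using finite_list by (fastforce simp: lists_eq_set image_iff)
  then show ?thesis
    by (rule subset_lepoll_trans) (intro image_lepoll_trans infinite_lists_lepoll assms)
qed

text \<open>The bound concerns only symbols in \<open>Funs \<Sigma>\<close>, since the type of
  symbols may be arbitrarily large. Terms are exhausted by countably many stages \<open>D n\<close>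
  (depth below \<open>n\<close>), and each stage is built from the previous one by finite lists and
  finite unions, which an infinite \<open>Y\<close> absorbs.\<close>

lemma terms_lepoll:
  assumes Y: "infinite Y" and F: "Funs \<Sigma> \<lesssim> Y"
  shows "{t. \<exists>s. has_sort \<Sigma> xs t s} \<lesssim> Y"
proof -
  define D where "D n = ((\<lambda>A. Var ` set xs \<union> (\<lambda>(f, ts). Fn f ts) ` (Funs \<Sigma> \<times> lists A)) ^^ n) {}" for n
  have D_Suc: "D (Suc n) = Var ` set xs \<union> (\<lambda>(f, ts). Fn f ts) ` (Funs \<Sigma> \<times> lists (D n))" for n
    by (simp add: D_def)
  have small: "D n \<lesssim> Y" for n
  proof (induction n)
    case 0
    show ?case by (simp add: D_def)
  next
    case (Suc n)
    have "set xs \<lesssim> Y"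
      using Y finite_lepoll_infinite by blast
    then show ?case unfolding D_Suc
      by (intro infinite_Un_lepoll image_lepoll_trans infinite_Times_lepoll infinite_lists_lepoll Y F Suc)
  qed
  have mono: "D n \<subseteq> D (Suc n)" for n
  proof (induction n)
    case 0
    show ?case by (simp add: D_def)
  next
    case (Suc n)
    then have "lists (D n) \<subseteq> lists (D (Suc n))" by (rule lists_mono)
    then show ?case unfolding D_Suc[of "Suc n"] by (subst D_Suc) blast
  qed
  have mono': "m \<le> n \<Longrightarrow> D m \<subseteq> D n" for m n
    by (rule lift_Suc_mono_le[of D, OF mono])
  have "\<exists>n. t \<in> D n" if "has_sort \<Sigma> xs t s" for t s
    using that
  proof (induction rule: has_sort.induct)
    case (1 x)
    then have "Var x \<in> D (Suc 0)" by (auto simp: D_Suc)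
    then show ?case by blast
  next
    case (2 f ts)
    \<comment> \<open>A function symbol has finitely many arguments and the stages increase, so the
      largest of their stages contains them all.\<close>
    from 2(2) have "\<exists>n. set ts \<subseteq> D n"
    proof (induction rule: list_all2_induct)
      case Nil
      then show ?case by simp
    next
      case (Cons t ts s ss)
      then obtain m n where "t \<in> D m" "set ts \<subseteq> D n" by blast
      then have "set (t # ts) \<subseteq> D (max m n)"
        using mono'[of m "max m n"] mono'[of n "max m n"] by auto
      then show ?case by blast
    qed
    then obtain n where "set ts \<subseteq> D n" by blast
    then have "Fn f ts \<in> D (Suc n)" using 2(1) by (auto simp: D_Suc)
    then show ?case by blast
  qed
  then have "{t. \<exists>s. has_sort \<Sigma> xs t s} \<subseteq> (\<Union>n. D n)" by blast
  then show ?thesis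
    by (rule subset_lepoll_trans)
      (intro infinite_UN_lepoll Y small, use Y in \<open>simp add: infinite_le_lepoll\<close>)
qed

section \<open>Closure properties of a small universe\<close>

lemma small_universe_lepoll: "small_universe K V \<Longrightarrow> X \<in> V \<Longrightarrow> Y \<lesssim> X \<Longrightarrow> Y \<in> V"
  unfolding small_universe_def by blast

lemma small_universe_infinite: "small_universe K V \<Longrightarrow> infinite K"
  unfolding small_universe_def by blast

lemma small_universe_mem: "small_universe K V \<Longrightarrow> K \<in> V"
  unfolding small_universe_def by blast

lemma small_universe_UN:
  "small_universe K V \<Longrightarrow> I \<in> V \<Longrightarrow> (\<And>i. i \<in> I \<Longrightarrow> X i \<in> V) \<Longrightarrow> (\<Union>i\<in>I. X i) \<in> V"
  unfolding small_universe_def by blast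

text \<open>The index set may have any type, for instance sorts; an injection into \<open>K\<close>
  replaces it by a small set of elements of the universe.\<close>

lemma small_universe_UN_lepoll:
  assumes V: "small_universe K V" and I: "I \<lesssim> K" and X: "\<And>i. i \<in> I \<Longrightarrow> X i \<in> V"
  shows "(\<Union>i\<in>I. X i) \<in> V"
proof -
  obtain e where e: "inj_on e I" "e ` I \<subseteq> K" using I by (auto simp: lepoll_def)
  have "e ` I \<in> V"
    using small_universe_lepoll[OF V small_universe_mem[OF V]] subset_imp_lepoll[OF e(2)] by blast
  then have "(\<Union>k\<in>e ` I. X (inv_into I e k)) \<in> V"
    by (rule small_universe_UN[OF V]) (use e X in auto)
  then show ?thesis using e(1) by simp
qed

lemma small_universe_Un:
  assumes V: "small_universe K V" and "A \<in> V" "B \<in> V"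
  shows "A \<union> B \<in> V"
proof -
  have "(UNIV :: bool set) \<lesssim> K"
    using small_universe_infinite[OF V] by (intro finite_lepoll_infinite) simp_all
  then have "(\<Union>b. if b then A else B) \<in> V"
    by (rule small_universe_UN_lepoll[OF V]) (simp add: assms(2,3))
  then show ?thesis unfolding Un_eq_UN .
qed

lemma small_universe_infinite_superset:
  assumes V: "small_universe K V" and "A \<in> V"
  obtains Y where "Y \<in> V" "infinite Y" "A \<subseteq> Y" "K \<subseteq> Y"
proof (rule that)
  show "A \<union> K \<in> V" by (rule small_universe_Un[OF V \<open>A \<in> V\<close> small_universe_mem[OF V]])
qed (use small_universe_infinite[OF V] in auto)

text \<open>The closure axiom speaks of products over exactly \<open>K\<close>, so a family over a
  smaller index set is first transported into \<open>K\<close> and padded there.\<close>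

lemma small_universe_PiE:
  assumes V: "small_universe K V" and I: "I \<lesssim> K" and X: "\<And>i. i \<in> I \<Longrightarrow> X i \<in> V"
  shows "\<exists>Y\<in>V. (\<Pi>\<^sub>E i\<in>I. X i) \<lesssim> Y"
proof -
  obtain e where e: "inj_on e I" "e ` I \<subseteq> K" using I by (auto simp: lepoll_def)
  \<comment> \<open>Singleton factors outside the image of \<open>I\<close> leave the size of the
    product unchanged; \<open>{k}\<close> itself is small because \<open>K\<close> is.\<close>
  define X' where "X' k = (if k \<in> e ` I then X (inv_into I e k) else {k})" for k
  have "{k} \<in> V" if "k \<in> K" for k
    by (rule small_universe_lepoll[OF V small_universe_mem[OF V] subset_imp_lepoll]) (use that in simp)
  then have "\<forall>k\<in>K. X' k \<in> V"
    using e X by (auto simp: X'_def)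
  then obtain Y where Y: "Y \<in> V" "(\<Pi>\<^sub>E k\<in>K. X' k) \<lesssim> Y"
    using V unfolding small_universe_def by blast
  define F where "F g = (\<lambda>k\<in>K. if k \<in> e ` I then g (inv_into I e k) else k)" for g
  have "F ` (\<Pi>\<^sub>E i\<in>I. X i) \<subseteq> (\<Pi>\<^sub>E k\<in>K. X' k)"
    using e by (auto simp: F_def X'_def PiE_iff)
  moreover have "inj_on F (\<Pi>\<^sub>E i\<in>I. X i)"
  proof (rule inj_onI)
    fix g h assume gh: "g \<in> (\<Pi>\<^sub>E i\<in>I. X i)" "h \<in> (\<Pi>\<^sub>E i\<in>I. X i)" "F g = F h"
    show "g = h"
    proof (rule PiE_ext[OF gh(1,2)])
      fix i assume "i \<in> I"
      then have "F g (e i) = g i" "F h (e i) = h i" using e by (auto simp: F_def)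
      then show "g i = h i" using gh(3) by simp
    qed
  qed
  ultimately have "(\<Pi>\<^sub>E i\<in>I. X i) \<lesssim> (\<Pi>\<^sub>E k\<in>K. X' k)" by (auto simp: lepoll_def)
  then show ?thesis using Y lepoll_trans by blast
qed

text \<open>Vectors indexed by \<open>I\<close> are not elements of the universe type, so carriers
  made of vectors have to be coded. One injection per sort suffices, and it only has to cover the
  vectors in \<open>R s\<close>.\<close>

lemma small_universe_PiE_inj:
  assumes V: "small_universe K V" and I: "I \<lesssim> K"
    and X: "\<And>s i. i \<in> I \<Longrightarrow> X s i \<in> V" and R: "\<And>s. R s \<subseteq> (\<Pi>\<^sub>E i\<in>I. X s i)"
  obtains e where "\<And>s. inj_on (e s) (R s)" "\<And>s. e s ` R s \<in> V"
proof -
  have "\<exists>e. inj_on e (R s) \<and> e ` R s \<in> V" for s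
  proof -
    obtain Y where Y: "Y \<in> V" "(\<Pi>\<^sub>E i\<in>I. X s i) \<lesssim> Y"
      using small_universe_PiE[where X = "X s", OF V I X] by blast
    then obtain e where "inj_on e (R s)" "e ` R s \<subseteq> Y"
      using subset_lepoll_trans[OF R Y(2)] unfolding lepoll_def by blast
    then show ?thesis using small_universe_lepoll[OF V Y(1) subset_imp_lepoll] by blast
  qed
  then show thesis using that by metis
qed

section \<open>Homomorphisms and the interpretation of Horn formulas\<close>

lemma those_eq_Some_iff: "those (map f ts) = Some as \<longleftrightarrow> list_all2 (\<lambda>t a. f t = Some a) ts as"
  by (induction ts arbitrary: as) (auto simp: list_all2_Cons1 split: option.splits)

lemma mem_tuples: "as \<in> tuples M ss \<longleftrightarrow> list_all2 (\<lambda>a s. a \<in> car M s) as ss"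
  by (simp add: tuples_def)

abbreviation tm_vals ::
  "('s, 'f, 'r, 'u) pstruct \<Rightarrow> ('s var \<rightharpoonup> 'u) \<Rightarrow> ('s, 'f) tm list \<Rightarrow> 'u list \<Rightarrow> bool" where
  "tm_vals M \<rho> \<equiv> list_all2 (\<lambda>t a. tm_val M \<rho> t = Some a)"

lemma tm_val_Fn_eq_Some:
  "tm_val M \<rho> (Fn f ts) = Some a \<longleftrightarrow>
   (\<exists>as. tm_vals M \<rho> ts as \<and> opn M f as = Some a)"
  by (auto simp: those_eq_Some_iff bind_eq_Some_conv)

lemma holds_HRel_iff:
  "holds M \<rho> (HRel R ts) \<longleftrightarrow>
   (\<exists>as. tm_vals M \<rho> ts as \<and> as \<in> rel M R)"
  by (simp add: those_eq_Some_iff)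

declare tm_val.simps(2) [simp del] holds.simps(1) [simp del]

text \<open>
  In contrast to \<open>homs\<close>, source and target may have different element types and the
  components are arbitrary off the carriers.
\<close>

definition hhom ::
  "('s, 'f, 'r) hsig \<Rightarrow> ('s, 'f, 'r, 'a) pstruct \<Rightarrow> ('s, 'f, 'r, 'b) pstruct \<Rightarrow>
   ('s \<Rightarrow> 'a \<Rightarrow> 'b) \<Rightarrow> bool" where
  "hhom \<Sigma> M N h \<longleftrightarrow>
     (\<forall>s. \<forall>x\<in>car M s. h s x \<in> car N s) \<and>
     (\<forall>f\<in>Funs \<Sigma>. \<forall>as b. opn M f as = Some b \<longrightarrow>
        opn N f (map2 h (fdom \<Sigma> f) as) = Some (h (fcod \<Sigma> f) b)) \<and>
     (\<forall>R\<in>Rels \<Sigma>. \<forall>as\<in>rel M R. map2 h (rdom \<Sigma> R) as \<in> rel N R)"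

lemma hhom_car: "hhom \<Sigma> M N h \<Longrightarrow> x \<in> car M s \<Longrightarrow> h s x \<in> car N s"
  and hhom_opn: "hhom \<Sigma> M N h \<Longrightarrow> f \<in> Funs \<Sigma> \<Longrightarrow> opn M f as = Some b \<Longrightarrow>
        opn N f (map2 h (fdom \<Sigma> f) as) = Some (h (fcod \<Sigma> f) b)"
  and hhom_rel: "hhom \<Sigma> M N h \<Longrightarrow> R \<in> Rels \<Sigma> \<Longrightarrow> as \<in> rel M R \<Longrightarrow>
        map2 h (rdom \<Sigma> R) as \<in> rel N R"
  unfolding hhom_def by blast+

lemma homs_iff: "h \<in> homs \<Sigma> M N \<longleftrightarrow> hhom \<Sigma> M N h \<and> (\<forall>s. h s \<in> extensional (car M s))"
  unfolding homs_def hhom_def PiE_def Pi_def by blast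

lemma homs_hhom: "h \<in> homs \<Sigma> M N \<Longrightarrow> hhom \<Sigma> M N h"
  by (simp add: homs_iff)

text \<open>Normalization off the carriers: it turns an \<open>hhom\<close> into an element of
  \<open>homs\<close>, where two maps are equal as soon as they agree on carriers.\<close>

definition restr_hom :: "('s, 'f, 'r, 'a) pstruct \<Rightarrow> ('s \<Rightarrow> 'a \<Rightarrow> 'b) \<Rightarrow> 's \<Rightarrow> 'a \<Rightarrow> 'b" where
  "restr_hom M h = (\<lambda>s. restrict (h s) (car M s))"

lemma restr_hom_apply [simp]: "x \<in> car M s \<Longrightarrow> restr_hom M h s x = h s x"
  by (simp add: restr_hom_def)

lemma homs_ext:
  assumes "h \<in> homs \<Sigma> M N" "h' \<in> homs \<Sigma> M N'" "\<And>s x. x \<in> car M s \<Longrightarrow> h s x = h' s x"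
  shows "h = h'"
proof (rule ext)
  fix s
  show "h s = h' s"
    by (rule extensionalityI[of _ "car M s"]) (use assms in \<open>auto simp: homs_iff\<close>)
qed

lemma partial_structure_opn:
  "partial_structure \<Sigma> M \<Longrightarrow> opn M f as = Some b \<Longrightarrow>
   f \<in> Funs \<Sigma> \<and> as \<in> tuples M (fdom \<Sigma> f) \<and> b \<in> car M (fcod \<Sigma> f)"
  unfolding partial_structure_def by (metis domI in_mono option.distinct(1) ranI)

lemma partial_structure_rel:
  "partial_structure \<Sigma> M \<Longrightarrow> as \<in> rel M R \<Longrightarrow> R \<in> Rels \<Sigma> \<and> as \<in> tuples M (rdom \<Sigma> R)"
  unfolding partial_structure_def by (metis empty_iff in_mono)

lemma partial_structure_car: "partial_structure \<Sigma> M \<Longrightarrow> x \<in> car M s \<Longrightarrow> s \<in> Sorts \<Sigma>"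
  unfolding partial_structure_def by (metis empty_iff)

lemma map2_cong_tuples:
  "as \<in> tuples M ss \<Longrightarrow> (\<And>s x. x \<in> car M s \<Longrightarrow> h s x = h' s x) \<Longrightarrow> map2 h ss as = map2 h' ss as"
  unfolding mem_tuples by (induction rule: list_all2_induct) auto

lemma map2_tuples:
  "as \<in> tuples M ss \<Longrightarrow> (\<And>s x. x \<in> car M s \<Longrightarrow> h s x \<in> car N s) \<Longrightarrow> map2 h ss as \<in> tuples N ss"
  unfolding mem_tuples by (induction rule: list_all2_induct) auto

lemma map2_map2_tuples:
  "as \<in> tuples M ss \<Longrightarrow> map2 g ss (map2 h ss as) = map2 (\<lambda>s x. g s (h s x)) ss as"
  unfolding mem_tuples by (induction rule: list_all2_induct) auto

lemma map2_ident_tuples: "as \<in> tuples M ss \<Longrightarrow> map2 (\<lambda>s x. x) ss as = as"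
  unfolding mem_tuples by (induction rule: list_all2_induct) auto

lemma hhomI:
  assumes M: "partial_structure \<Sigma> M"
    and "\<And>s x. x \<in> car M s \<Longrightarrow> h s x \<in> car N s"
    and "\<And>f as b. f \<in> Funs \<Sigma> \<Longrightarrow> opn M f as = Some b \<Longrightarrow> as \<in> tuples M (fdom \<Sigma> f) \<Longrightarrow>
      b \<in> car M (fcod \<Sigma> f) \<Longrightarrow> opn N f (map2 h (fdom \<Sigma> f) as) = Some (h (fcod \<Sigma> f) b)"
    and "\<And>R as. R \<in> Rels \<Sigma> \<Longrightarrow> as \<in> rel M R \<Longrightarrow> as \<in> tuples M (rdom \<Sigma> R) \<Longrightarrow>
      map2 h (rdom \<Sigma> R) as \<in> rel N R"
  shows "hhom \<Sigma> M N h"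
  unfolding hhom_def using assms(2-4) partial_structure_opn[OF M] partial_structure_rel[OF M] by blast

lemma hhom_cong:
  assumes M: "partial_structure \<Sigma> M" and h: "hhom \<Sigma> M N h"
    and eq: "\<And>s x. x \<in> car M s \<Longrightarrow> h' s x = h s x"
  shows "hhom \<Sigma> M N h'"
proof (rule hhomI[OF M])
  fix f as b assume f: "f \<in> Funs \<Sigma>" and ab: "opn M f as = Some b"
    and as: "as \<in> tuples M (fdom \<Sigma> f)" and b: "b \<in> car M (fcod \<Sigma> f)"
  have "map2 h' (fdom \<Sigma> f) as = map2 h (fdom \<Sigma> f) as"
    by (rule map2_cong_tuples[OF as]) (rule eq)
  then show "opn N f (map2 h' (fdom \<Sigma> f) as) = Some (h' (fcod \<Sigma> f) b)"
    using hhom_opn[OF h f ab] eq[OF b] by argo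
next
  fix R as assume R: "R \<in> Rels \<Sigma>" and ar: "as \<in> rel M R" and as: "as \<in> tuples M (rdom \<Sigma> R)"
  have "map2 h' (rdom \<Sigma> R) as = map2 h (rdom \<Sigma> R) as"
    by (rule map2_cong_tuples[OF as]) (rule eq)
  then show "map2 h' (rdom \<Sigma> R) as \<in> rel N R"
    using hhom_rel[OF h R ar] by argo
qed (use h eq in \<open>simp add: hhom_car\<close>)

lemma restr_hom_homs:
  assumes "partial_structure \<Sigma> M" "hhom \<Sigma> M N h"
  shows "restr_hom M h \<in> homs \<Sigma> M N"
  using hhom_cong[OF assms, of "restr_hom M h"] by (simp add: homs_iff) (simp add: restr_hom_def)

lemma hhom_comp:
  assumes M: "partial_structure \<Sigma> M" and h: "hhom \<Sigma> M N h" and g: "hhom \<Sigma> N P g"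
  shows "hhom \<Sigma> M P (\<lambda>s x. g s (h s x))"
proof (rule hhomI[OF M])
  fix f as b assume f: "f \<in> Funs \<Sigma>" and ab: "opn M f as = Some b" and as: "as \<in> tuples M (fdom \<Sigma> f)"
  show "opn P f (map2 (\<lambda>s x. g s (h s x)) (fdom \<Sigma> f) as) = Some (g (fcod \<Sigma> f) (h (fcod \<Sigma> f) b))"
    using hhom_opn[OF g f hhom_opn[OF h f ab]] unfolding map2_map2_tuples[OF as] .
next
  fix R as assume R: "R \<in> Rels \<Sigma>" and ar: "as \<in> rel M R" and as: "as \<in> tuples M (rdom \<Sigma> R)"
  show "map2 (\<lambda>s x. g s (h s x)) (rdom \<Sigma> R) as \<in> rel P R"
    using hhom_rel[OF g R hhom_rel[OF h R ar]] unfolding map2_map2_tuples[OF as] .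
qed (use h g hhom_car in metis)

lemma hhom_id: "partial_structure \<Sigma> M \<Longrightarrow> hhom \<Sigma> M M (\<lambda>s x. x)"
  by (rule hhomI) (simp_all only: map2_ident_tuples)

lemma id_hom_homs: "partial_structure \<Sigma> M \<Longrightarrow> id_hom M \<in> homs \<Sigma> M M"
  using restr_hom_homs[OF _ hhom_id, of \<Sigma> M] by (simp add: restr_hom_def id_hom_def id_def)

lemma comp_hom_apply [simp]: "x \<in> car M s \<Longrightarrow> comp_hom M g h s x = g s (h s x)"
  by (simp add: comp_hom_def compose_def)

lemma id_hom_apply [simp]: "x \<in> car M s \<Longrightarrow> id_hom M s x = x"
  by (simp add: id_hom_def)

lemma comp_hom_homs:
  assumes "partial_structure \<Sigma> M" "h \<in> homs \<Sigma> M N" "g \<in> homs \<Sigma> N P"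
  shows "comp_hom M g h \<in> homs \<Sigma> M P"
proof -
  have "comp_hom M g h = restr_hom M (\<lambda>s x. g s (h s x))"
    by (simp add: comp_hom_def restr_hom_def compose_def)
  then show ?thesis
    using restr_hom_homs[OF assms(1) hhom_comp[OF assms(1) homs_hhom[OF assms(2)] homs_hhom[OF assms(3)]]]
    by simp
qed

text \<open>Tuples of a distinct context \<open>xs\<close> are represented by valuations with domain \<open>set xs\<close>.\<close>

definition vals :: "('s, 'f, 'r, 'a) pstruct \<Rightarrow> 's var list \<Rightarrow> ('s var \<rightharpoonup> 'a) set" where
  "vals M xs = {\<rho>. dom \<rho> = set xs \<and> (\<forall>x a. \<rho> x = Some a \<longrightarrow> a \<in> car M (fst x))}"

definition vmap :: "('s \<Rightarrow> 'a \<Rightarrow> 'b) \<Rightarrow> ('s var \<rightharpoonup> 'a) \<Rightarrow> ('s var \<rightharpoonup> 'b)" where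
  "vmap h \<rho> = (\<lambda>x. map_option (h (fst x)) (\<rho> x))"

lemma valsD: "\<rho> \<in> vals M xs \<Longrightarrow> x \<in> set xs \<Longrightarrow> \<exists>a. \<rho> x = Some a \<and> a \<in> car M (fst x)"
  unfolding vals_def by blast

lemma vmap_vals:
  "\<rho> \<in> vals M xs \<Longrightarrow> (\<And>s x. x \<in> car M s \<Longrightarrow> h s x \<in> car N s) \<Longrightarrow> vmap h \<rho> \<in> vals N xs"
  by (auto simp: vals_def vmap_def dom_def)

lemma vmap_cong:
  assumes "\<rho> \<in> vals M xs" "\<And>s x. x \<in> car M s \<Longrightarrow> h s x = h' s x"
  shows "vmap h \<rho> = vmap h' \<rho>"
proof
  fix x show "vmap h \<rho> x = vmap h' \<rho> x"
    using assms by (cases x, cases "\<rho> x") (auto simp: vmap_def vals_def)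
qed

lemma vmap_vmap: "vmap g (vmap h \<rho>) = vmap (\<lambda>s x. g s (h s x)) \<rho>"
  by (simp add: vmap_def option.map_comp comp_def)

lemma vmap_ident: "vmap (\<lambda>s x. x) \<rho> = \<rho>"
  by (simp add: vmap_def option.map_ident)

lemma map_of_zip_vals:
  assumes "ms \<in> tuples M (map fst xs)"
  shows "map_of (zip xs ms) \<in> vals M xs"
proof -
  have "list_all2 (\<lambda>x m. m \<in> car M (fst x)) xs ms"
    using assms by (auto simp: mem_tuples list_all2_conv_all_nth)
  then show ?thesis
  proof (induction rule: list_all2_induct)
    case Nil
    then show ?case by (simp add: vals_def)
  next
    case (Cons x xs m ms)
    then show ?case unfolding vals_def by (cases x) (auto simp: dom_def split: if_splits)
  qed
qed

lemma map_of_zip_vmap: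
  "length ms = length xs \<Longrightarrow> map_of (zip xs (map2 h (map fst xs) ms)) = vmap h (map_of (zip xs ms))"
  by (induction rule: list_induct2) (auto simp: vmap_def fun_eq_iff)

lemma vals_tuple:
  assumes "distinct xs" "\<rho> \<in> vals M xs"
  defines "ms \<equiv> map (the \<circ> \<rho>) xs"
  shows "ms \<in> tuples M (map fst xs)" "map_of (zip xs ms) = \<rho>"
proof -
  show "ms \<in> tuples M (map fst xs)"
    using valsD[OF assms(2) nth_mem] unfolding mem_tuples ms_def list_all2_conv_all_nth
    by fastforce
  show "map_of (zip xs ms) = \<rho>"
  proof
    fix x show "map_of (zip xs ms) x = \<rho> x"
    proof (cases "x \<in> set xs")
      case True
      then show ?thesis
        using valsD[OF assms(2) True] by (auto simp: ms_def map_of_zip_map)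
    next
      case False
      then have "\<rho> x = None" using assms(2) unfolding vals_def by blast
      then show ?thesis using False by (simp add: ms_def map_of_zip_map)
    qed
  qed
qed

text \<open>Distinctness makes tuples and valuations correspond: with a repeated variable, a tuple
  with different entries at its two places could not be read back from its valuation.\<close>

lemma valid_in_iff_vals:
  assumes "distinct xs"
  shows "valid_in M (xs, \<phi>, \<psi>) \<longleftrightarrow> (\<forall>\<rho>\<in>vals M xs. holds M \<rho> \<phi> \<longrightarrow> holds M \<rho> \<psi>)"
  (is "?l \<longleftrightarrow> ?r")
proof
  assume l: ?l
  show ?r
  proof (intro ballI impI)
    fix \<rho> assume \<rho>: "\<rho> \<in> vals M xs" "holds M \<rho> \<phi>"
    then have "map (the \<circ> \<rho>) xs \<in> interp M xs \<phi>"
      using vals_tuple[OF assms \<rho>(1)] by (simp add: interp_def)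
    then have "map (the \<circ> \<rho>) xs \<in> interp M xs \<psi>" using l by auto
    then show "holds M \<rho> \<psi>"
      using vals_tuple[OF assms \<rho>(1)] by (simp add: interp_def)
  qed
next
  assume ?r
  then show ?l using map_of_zip_vals by (auto simp: interp_def)
qed

lemma tm_val_car:
  assumes M: "partial_structure \<Sigma> M" and \<rho>: "\<rho> \<in> vals M xs"
    and t: "has_sort \<Sigma> xs t s" and a: "tm_val M \<rho> t = Some a"
  shows "a \<in> car M s"
  using t
proof cases
  case (1 x)
  then show ?thesis using valsD[OF \<rho>] a by fastforce
next
  case (2 f ts)
  then show ?thesis using a partial_structure_opn[OF M] by (auto simp: tm_val_Fn_eq_Some)
qed

lemma tm_vals_tuples:
  assumes M: "partial_structure \<Sigma> M" and \<rho>: "\<rho> \<in> vals M xs"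
    and "list_all2 (has_sort \<Sigma> xs) ts ss" "tm_vals M \<rho> ts as"
  shows "as \<in> tuples M ss"
  using assms(3,4) tm_val_car[OF M \<rho>] unfolding mem_tuples list_all2_conv_all_nth by metis

lemma list_all2_tm_val_map2:
  assumes "list_all2 (\<lambda>t s. \<forall>a. tm_val M \<rho> t = Some a \<longrightarrow> tm_val N \<rho>' t = Some (h s a)) ts ss"
    and "tm_vals M \<rho> ts as"
  shows "tm_vals N \<rho>' ts (map2 h ss as)"
  using assms unfolding list_all2_conv_all_nth by auto

text \<open>Definedness only moves forward: the target may define more terms than the source. Going
  backwards takes joint closedness or a later stage of a filtered diagram.\<close>

lemma hhom_tm_val:
  assumes h: "hhom \<Sigma> M N h" and \<rho>: "\<rho> \<in> vals M xs"
    and t: "has_sort \<Sigma> xs t s" and a: "tm_val M \<rho> t = Some a"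
  shows "tm_val N (vmap h \<rho>) t = Some (h s a)"
  using t a
proof (induction arbitrary: a)
  case (1 x)
  then show ?case by (simp add: vmap_def)
next
  case (2 f ts)
  from 2(3) obtain as where as: "tm_vals M \<rho> ts as" "opn M f as = Some a"
    by (auto simp: tm_val_Fn_eq_Some)
  have "list_all2 (\<lambda>t s. \<forall>a. tm_val M \<rho> t = Some a \<longrightarrow> tm_val N (vmap h \<rho>) t = Some (h s a)) ts (fdom \<Sigma> f)"
    using 2(2) by (auto elim: list_all2_mono)
  from list_all2_tm_val_map2[OF this as(1)] hhom_opn[OF h 2(1) as(2)]
  show ?case by (auto simp: tm_val_Fn_eq_Some)
qed

lemma hhom_tm_vals:
  assumes h: "hhom \<Sigma> M N h" and \<rho>: "\<rho> \<in> vals M xs"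
    and ts: "list_all2 (has_sort \<Sigma> xs) ts ss" and as: "tm_vals M \<rho> ts as"
  shows "tm_vals N (vmap h \<rho>) ts (map2 h ss as)"
  by (rule list_all2_tm_val_map2[OF _ as])
    (use ts hhom_tm_val[OF h \<rho>] in \<open>auto elim: list_all2_mono\<close>)

lemma hhom_holds:
  assumes h: "hhom \<Sigma> M N h" and \<rho>: "\<rho> \<in> vals M xs"
  shows "wf_horn \<Sigma> xs \<phi> \<Longrightarrow> holds M \<rho> \<phi> \<Longrightarrow> holds N (vmap h \<rho>) \<phi>"
proof (induction \<phi>)
  case (HRel R ts)
  then obtain as where "tm_vals M \<rho> ts as" "as \<in> rel M R"
    by (auto simp: holds_HRel_iff)
  then show ?case
    using HRel(1) hhom_tm_vals[OF h \<rho>] hhom_rel[OF h] by (fastforce simp: holds_HRel_iff)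
next
  case (HEq t u)
  then show ?case using hhom_tm_val[OF h \<rho>] by fastforce
qed auto

section \<open>Jointly closed families\<close>

text \<open>
  The main examples are the projections from a product and, with a single index, a closed
  monomorphism.
\<close>

definition jointly_closed ::
  "('s, 'f, 'r) hsig \<Rightarrow> ('s, 'f, 'r, 'a) pstruct \<Rightarrow> 'i set \<Rightarrow> ('i \<Rightarrow> ('s, 'f, 'r, 'b) pstruct) \<Rightarrow>
   ('i \<Rightarrow> 's \<Rightarrow> 'a \<Rightarrow> 'b) \<Rightarrow> bool" where
  "jointly_closed \<Sigma> N I X q \<longleftrightarrow>
     partial_structure \<Sigma> N \<and>
     (\<forall>i\<in>I. hhom \<Sigma> N (X i) (q i)) \<and>
     (\<forall>s. \<forall>x\<in>car N s. \<forall>y\<in>car N s. (\<forall>i\<in>I. q i s x = q i s y) \<longrightarrow> x = y) \<and>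
     (\<forall>f\<in>Funs \<Sigma>. \<forall>as\<in>tuples N (fdom \<Sigma> f).
        (\<forall>i\<in>I. opn (X i) f (map2 (q i) (fdom \<Sigma> f) as) \<noteq> None) \<longrightarrow> opn N f as \<noteq> None) \<and>
     (\<forall>R\<in>Rels \<Sigma>. \<forall>as\<in>tuples N (rdom \<Sigma> R).
        (\<forall>i\<in>I. map2 (q i) (rdom \<Sigma> R) as \<in> rel (X i) R) \<longrightarrow> as \<in> rel N R)"

lemma
  assumes "jointly_closed \<Sigma> N I X q"
  shows jointly_closed_struct: "partial_structure \<Sigma> N"
    and jointly_closed_hhom: "i \<in> I \<Longrightarrow> hhom \<Sigma> N (X i) (q i)"
    and jointly_closed_inj: "x \<in> car N s \<Longrightarrow> y \<in> car N s \<Longrightarrow> (\<And>i. i \<in> I \<Longrightarrow> q i s x = q i s y) \<Longrightarrow> x = y"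
    and jointly_closed_opn: "f \<in> Funs \<Sigma> \<Longrightarrow> as \<in> tuples N (fdom \<Sigma> f) \<Longrightarrow>
        (\<And>i. i \<in> I \<Longrightarrow> opn (X i) f (map2 (q i) (fdom \<Sigma> f) as) \<noteq> None) \<Longrightarrow> opn N f as \<noteq> None"
    and jointly_closed_rel: "R \<in> Rels \<Sigma> \<Longrightarrow> as \<in> tuples N (rdom \<Sigma> R) \<Longrightarrow>
        (\<And>i. i \<in> I \<Longrightarrow> map2 (q i) (rdom \<Sigma> R) as \<in> rel (X i) R) \<Longrightarrow> as \<in> rel N R"
  using assms unfolding jointly_closed_def by blast+

lemma list_all2_in_setD: "list_all2 P xs ys \<Longrightarrow> x \<in> set xs \<Longrightarrow> \<exists>y\<in>set ys. P x y"
  by (induction rule: list_all2_induct) auto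

lemma list_all2_ex_Some:
  "list_all2 P ts ss \<Longrightarrow> (\<And>t s. P t s \<Longrightarrow> t \<in> set ts \<Longrightarrow> \<exists>a. g t = Some a) \<Longrightarrow>
    \<exists>as. list_all2 (\<lambda>t a. g t = Some a) ts as"
proof (induction rule: list_all2_induct)
  case Nil
  show ?case by (rule exI[of _ "[]"]) simp
next
  case (Cons t ts s ss)
  obtain a where "g t = Some a" using Cons(4)[OF Cons(1)] by auto
  moreover obtain as where "list_all2 (\<lambda>t a. g t = Some a) ts as" using Cons(3,4) by (meson list.set_intros(2))
  ultimately show ?case by (meson list_all2_Cons)
qed

lemma list_all2_Some_functional:
  "list_all2 (\<lambda>t a. g t = Some a) ts as \<Longrightarrow> list_all2 (\<lambda>t a. g t = Some a) ts bs \<Longrightarrow> as = bs"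
  by (simp flip: those_eq_Some_iff)

text \<open>Induction on the term. The arguments have values in \<open>N\<close> by induction, and
  since evaluation is functional, their images are the argument values in each \<open>X i\<close>.
  So the operation is defined at the image tuple in every component, which is what joint closedness
  asks for.\<close>

lemma jointly_closed_tm_val:
  assumes N: "jointly_closed \<Sigma> N I X q" and \<rho>: "\<rho> \<in> vals N xs"
    and t: "has_sort \<Sigma> xs t s" and "\<And>i. i \<in> I \<Longrightarrow> \<exists>a. tm_val (X i) (vmap (q i) \<rho>) t = Some a"
  shows "\<exists>a. tm_val N \<rho> t = Some a"
  using t assms(4)
proof (induction)
  case (1 x)
  then show ?case using valsD[OF \<rho>, of x] by auto
next
  case (2 f ts)
  note hom = jointly_closed_hhom[OF N] and st = jointly_closed_struct[OF N]
  have sorted: "list_all2 (has_sort \<Sigma> xs) ts (fdom \<Sigma> f)"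
    using 2(2) by (auto elim: list_all2_mono)
  have "\<exists>a. tm_val (X i) (vmap (q i) \<rho>) t = Some a" if "i \<in> I" "t \<in> set ts" for i t
    using 2(3)[OF that(1)] list_all2_in_setD[OF _ that(2)] unfolding tm_val_Fn_eq_Some by blast
  then obtain as where as: "tm_vals N \<rho> ts as"
    using list_all2_ex_Some[OF 2(2), of "tm_val N \<rho>"] by blast
  have "opn N f as \<noteq> None"
  proof (rule jointly_closed_opn[OF N 2(1) tm_vals_tuples[OF st \<rho> sorted as]])
    fix i assume i: "i \<in> I"
    obtain bs where "tm_vals (X i) (vmap (q i) \<rho>) ts bs" "opn (X i) f bs \<noteq> None"
      using 2(3)[OF i] by (auto simp: tm_val_Fn_eq_Some)
    moreover have "tm_vals (X i) (vmap (q i) \<rho>) ts (map2 (q i) (fdom \<Sigma> f) as)"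
      by (rule hhom_tm_vals[OF hom[OF i] \<rho> sorted as])
    ultimately show "opn (X i) f (map2 (q i) (fdom \<Sigma> f) as) \<noteq> None"
      using list_all2_Some_functional by metis
  qed
  then show ?case using as by (auto simp: tm_val_Fn_eq_Some)
qed

lemma jointly_closed_holds:
  assumes N: "jointly_closed \<Sigma> N I X q" and \<rho>: "\<rho> \<in> vals N xs"
  shows "wf_horn \<Sigma> xs \<phi> \<Longrightarrow> (\<And>i. i \<in> I \<Longrightarrow> holds (X i) (vmap (q i) \<rho>) \<phi>) \<Longrightarrow> holds N \<rho> \<phi>"
proof (induction \<phi>)
  note hom = jointly_closed_hhom[OF N] and st = jointly_closed_struct[OF N]
  case (HRel R ts)
  from HRel(1) have R: "R \<in> Rels \<Sigma>" and sorted: "list_all2 (has_sort \<Sigma> xs) ts (rdom \<Sigma> R)" by auto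
  have "\<exists>a. tm_val (X i) (vmap (q i) \<rho>) t = Some a" if "i \<in> I" "t \<in> set ts" for i t
    using HRel(2)[OF that(1)] list_all2_in_setD[OF _ that(2)] unfolding holds_HRel_iff by blast
  then obtain as where as: "tm_vals N \<rho> ts as"
    using list_all2_ex_Some[OF sorted, of "tm_val N \<rho>"] jointly_closed_tm_val[OF N \<rho>] by blast
  have "as \<in> rel N R"
  proof (rule jointly_closed_rel[OF N R tm_vals_tuples[OF st \<rho> sorted as]])
    fix i assume i: "i \<in> I"
    obtain bs where "tm_vals (X i) (vmap (q i) \<rho>) ts bs" "bs \<in> rel (X i) R"
      using HRel(2)[OF i] by (auto simp: holds_HRel_iff)
    moreover have "tm_vals (X i) (vmap (q i) \<rho>) ts (map2 (q i) (rdom \<Sigma> R) as)"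
      by (rule hhom_tm_vals[OF hom[OF i] \<rho> sorted as])
    ultimately show "map2 (q i) (rdom \<Sigma> R) as \<in> rel (X i) R"
      using list_all2_Some_functional by metis
  qed
  then show ?case using as by (auto simp: holds_HRel_iff)
next
  note hom = jointly_closed_hhom[OF N] and st = jointly_closed_struct[OF N]
  case (HEq t u)
  from HEq(1) obtain s where s: "has_sort \<Sigma> xs t s" "has_sort \<Sigma> xs u s" by auto
  obtain a where a: "tm_val N \<rho> t = Some a"
    using jointly_closed_tm_val[OF N \<rho> s(1)] HEq(2) unfolding holds.simps by blast
  obtain b where b: "tm_val N \<rho> u = Some b"
    using jointly_closed_tm_val[OF N \<rho> s(2)] HEq(2) unfolding holds.simps by blast
  have "a = b"
  proof (rule jointly_closed_inj[OF N tm_val_car[OF st \<rho> s(1) a] tm_val_car[OF st \<rho> s(2) b]])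
    fix i assume i: "i \<in> I"
    show "q i s a = q i s b"
      using HEq(2)[OF i] hhom_tm_val[OF hom[OF i] \<rho> s(1) a] hhom_tm_val[OF hom[OF i] \<rho> s(2) b] by auto
  qed
  then show ?case using a b by auto
qed auto

text \<open>The premise is pushed forward along every \<open>q i\<close>, the sequent is applied in
  each \<open>X i\<close>, and the conclusion is reflected by the family as a whole.\<close>

lemma jointly_closed_valid:
  assumes N: "jointly_closed \<Sigma> N I X q" and wf: "wf_sequent \<Sigma> \<sigma>"
    and valid: "\<And>i. i \<in> I \<Longrightarrow> valid_in (X i) \<sigma>"
  shows "valid_in N \<sigma>"
proof -
  obtain xs \<phi> \<psi> where \<sigma>: "\<sigma> = (xs, \<phi>, \<psi>)" by (cases \<sigma>)
  then have d: "distinct xs" and w: "wf_horn \<Sigma> xs \<phi>" "wf_horn \<Sigma> xs \<psi>"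
    using wf by (auto simp: wf_ctx_def)
  show ?thesis unfolding \<sigma> valid_in_iff_vals[OF d]
  proof (intro ballI impI)
    fix \<rho> assume \<rho>: "\<rho> \<in> vals N xs" "holds N \<rho> \<phi>"
    show "holds N \<rho> \<psi>"
    proof (rule jointly_closed_holds[OF N \<rho>(1) w(2)])
      fix i assume i: "i \<in> I"
      note hom = jointly_closed_hhom[OF N i]
      have "vmap (q i) \<rho> \<in> vals (X i) xs" by (rule vmap_vals[OF \<rho>(1) hhom_car[OF hom]])
      then show "holds (X i) (vmap (q i) \<rho>) \<psi>"
        using valid[OF i] hhom_holds[OF hom \<rho>(1) w(1) \<rho>(2)] unfolding \<sigma> valid_in_iff_vals[OF d] by blast
    qed
  qed
qed

lemma jointly_closed_model:
  assumes "jointly_closed \<Sigma> N I X q" "\<And>\<sigma>. \<sigma> \<in> T \<Longrightarrow> wf_sequent \<Sigma> \<sigma>"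
    and "\<And>i. i \<in> I \<Longrightarrow> partial_model \<Sigma> T (X i)"
  shows "partial_model \<Sigma> T N"
  using assms jointly_closed_valid[OF assms(1)] jointly_closed_struct[OF assms(1)]
  unfolding partial_model_def by blast

text \<open>The universal property in the form used for products: because the family reflects
  definedness, equality and relations, checking a sortwise map into \<open>N\<close> reduces to
  checking its composites with the \<open>q i\<close>.\<close>

lemma jointly_closed_lift:
  assumes N: "jointly_closed \<Sigma> N I X q" and M: "partial_structure \<Sigma> M"
    and g: "\<And>i. i \<in> I \<Longrightarrow> hhom \<Sigma> M (X i) (g i)"
    and u: "\<And>s x. x \<in> car M s \<Longrightarrow> u s x \<in> car N s"
    and qu: "\<And>i s x. i \<in> I \<Longrightarrow> x \<in> car M s \<Longrightarrow> q i s (u s x) = g i s x"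
  shows "hhom \<Sigma> M N u"
proof (rule hhomI[OF M])
  have *: "map2 (q i) ss (map2 u ss as) = map2 (g i) ss as" if "as \<in> tuples M ss" "i \<in> I" for i as ss
  proof -
    have "map2 (q i) ss (map2 u ss as) = map2 (\<lambda>s x. q i s (u s x)) ss as"
      by (rule map2_map2_tuples[OF that(1)])
    also have "\<dots> = map2 (g i) ss as"
      by (rule map2_cong_tuples[OF that(1)]) (rule qu[OF that(2)])
    finally show ?thesis .
  qed
  {
    fix f as b assume f: "f \<in> Funs \<Sigma>" and ab: "opn M f as = Some b"
      and as: "as \<in> tuples M (fdom \<Sigma> f)" and b: "b \<in> car M (fcod \<Sigma> f)"
    have as': "map2 u (fdom \<Sigma> f) as \<in> tuples N (fdom \<Sigma> f)"
      by (rule map2_tuples[OF as u])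
    have X: "opn (X i) f (map2 (q i) (fdom \<Sigma> f) (map2 u (fdom \<Sigma> f) as)) = Some (g i (fcod \<Sigma> f) b)"
      if "i \<in> I" for i
      unfolding *[OF as that] by (rule hhom_opn[OF g[OF that] f ab])
    then have "opn N f (map2 u (fdom \<Sigma> f) as) \<noteq> None"
      by (intro jointly_closed_opn[OF N f as']) blast
    then obtain c where c: "opn N f (map2 u (fdom \<Sigma> f) as) = Some c" by blast
    then have cN: "c \<in> car N (fcod \<Sigma> f)"
      using partial_structure_opn[OF jointly_closed_struct[OF N]] by blast
    have "c = u (fcod \<Sigma> f) b"
    proof (rule jointly_closed_inj[OF N cN u[OF b]])
      fix i assume i: "i \<in> I"
      show "q i (fcod \<Sigma> f) c = q i (fcod \<Sigma> f) (u (fcod \<Sigma> f) b)"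
        using hhom_opn[OF jointly_closed_hhom[OF N i] f c] X[OF i] qu[OF i b] by simp
    qed
    then show "opn N f (map2 u (fdom \<Sigma> f) as) = Some (u (fcod \<Sigma> f) b)" using c by simp
  next
    fix R as assume R: "R \<in> Rels \<Sigma>" and ar: "as \<in> rel M R" and as: "as \<in> tuples M (rdom \<Sigma> R)"
    show "map2 u (rdom \<Sigma> R) as \<in> rel N R"
    proof (rule jointly_closed_rel[OF N R map2_tuples[OF as u]])
      fix i assume i: "i \<in> I"
      show "map2 (q i) (rdom \<Sigma> R) (map2 u (rdom \<Sigma> R) as) \<in> rel (X i) R"
        unfolding *[OF as i] by (rule hhom_rel[OF g[OF i] R ar])
    qed
  }
qed (rule u)

text \<open>A substructure of the set-theoretic product, with vectors coded by \<open>e\<close> so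
  that the product itself is never a structure of its own. Operations and relations hold
  componentwise, which forces joint closedness; \<open>closed\<close> says that results of
  operations defined in every component stay among the chosen vectors. Kernel pairs, products and
  generated substructures are all obtained from it.\<close>

lemma initial_structure:
  fixes e :: "'s \<Rightarrow> ('i \<Rightarrow> 'a) \<Rightarrow> 'b"
  assumes E: "\<And>s. E s \<subseteq> (\<Pi>\<^sub>E i\<in>I. car (X i) s)"
    and sorts: "\<And>s. s \<notin> Sorts \<Sigma> \<Longrightarrow> E s = {}"
    and e: "\<And>s. inj_on (e s) (E s)"
    and closed: "\<And>f as. f \<in> Funs \<Sigma> \<Longrightarrow> list_all2 (\<lambda>a s. a \<in> E s) as (fdom \<Sigma> f) \<Longrightarrow>
       (\<And>i. i \<in> I \<Longrightarrow> opn (X i) f (map (\<lambda>a. a i) as) \<noteq> None) \<Longrightarrow>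
       (\<lambda>i\<in>I. the (opn (X i) f (map (\<lambda>a. a i) as))) \<in> E (fcod \<Sigma> f)"
  obtains N q where "jointly_closed \<Sigma> N I X q" "\<And>s. car N s = e s ` E s"
    "\<And>s a i. a \<in> E s \<Longrightarrow> i \<in> I \<Longrightarrow> q i s (e s a) = a i"
proof -
  \<comment> \<open>\<open>d\<close> decodes an element into its vector, and the projection
    \<open>q i\<close> reads off coordinate \<open>i\<close>.\<close>
  define d where "d s n = inv_into (E s) (e s) n" for s n
  define q where "q i s n = d s n i" for i s n
  define val where "val f as = (\<lambda>i\<in>I. the (opn (X i) f (map2 (q i) (fdom \<Sigma> f) as)))" for f as
  define car' where "car' s = e s ` E s" for s
  define tup where "tup as ss = list_all2 (\<lambda>a s. a \<in> car' s) as ss" for as ss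
  define N where "N = \<lparr> car = car',
     opn = (\<lambda>f as. if f \<in> Funs \<Sigma> \<and> tup as (fdom \<Sigma> f) \<and>
        (\<forall>i\<in>I. opn (X i) f (map2 (q i) (fdom \<Sigma> f) as) \<noteq> None) then Some (e (fcod \<Sigma> f) (val f as)) else None),
     rel = (\<lambda>R. {as. R \<in> Rels \<Sigma> \<and> tup as (rdom \<Sigma> R) \<and> (\<forall>i\<in>I. map2 (q i) (rdom \<Sigma> R) as \<in> rel (X i) R)}) \<rparr>"
  have tuples: "as \<in> tuples N ss \<longleftrightarrow> tup as ss" for as ss
    by (simp add: mem_tuples N_def tup_def)
  have de: "d s (e s a) = a" if "a \<in> E s" for s a
    using e that by (simp add: d_def)
  have dE: "d s n \<in> E s" if "n \<in> car' s" for s n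
    using that unfolding d_def car'_def by (rule inv_into_into)
  have D: "list_all2 (\<lambda>a s. a \<in> E s) (map2 d ss as) ss" if "tup as ss" for as ss
    using that unfolding tup_def by (induction rule: list_all2_induct) (auto simp: dE)
  have Dq: "map2 (q i) ss as = map (\<lambda>a. a i) (map2 d ss as)" for i ss as
    by (simp add: q_def split_def)
  have val: "val f as \<in> E (fcod \<Sigma> f)"
    if "f \<in> Funs \<Sigma>" "tup as (fdom \<Sigma> f)" "\<And>i. i \<in> I \<Longrightarrow> opn (X i) f (map2 (q i) (fdom \<Sigma> f) as) \<noteq> None" for f as
    unfolding val_def Dq by (rule closed[OF that(1) D[OF that(2)]]) (use that(3) in \<open>unfold Dq, blast\<close>)
  have opn: "opn N f as = (if f \<in> Funs \<Sigma> \<and> tup as (fdom \<Sigma> f) \<and>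
        (\<forall>i\<in>I. opn (X i) f (map2 (q i) (fdom \<Sigma> f) as) \<noteq> None) then Some (e (fcod \<Sigma> f) (val f as)) else None)" for f as
    by (simp add: N_def)
  have opnD: "f \<in> Funs \<Sigma>" "tup as (fdom \<Sigma> f)" "b = e (fcod \<Sigma> f) (val f as)" "val f as \<in> E (fcod \<Sigma> f)"
      "\<And>i. i \<in> I \<Longrightarrow> opn (X i) f (map2 (q i) (fdom \<Sigma> f) as) = Some (val f as i)"
    if "opn N f as = Some b" for f as b
  proof -
    from that have *: "f \<in> Funs \<Sigma> \<and> tup as (fdom \<Sigma> f) \<and>
        (\<forall>i\<in>I. opn (X i) f (map2 (q i) (fdom \<Sigma> f) as) \<noteq> None)"
      unfolding opn by (metis option.distinct(1))
    then show "f \<in> Funs \<Sigma>" "tup as (fdom \<Sigma> f)" "val f as \<in> E (fcod \<Sigma> f)" using val by blast+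
    show "b = e (fcod \<Sigma> f) (val f as)" using that * unfolding opn by simp
    show "opn (X i) f (map2 (q i) (fdom \<Sigma> f) as) = Some (val f as i)" if "i \<in> I" for i
      using * that by (simp add: val_def)
  qed
  have rel: "as \<in> rel N R \<longleftrightarrow> R \<in> Rels \<Sigma> \<and> tup as (rdom \<Sigma> R) \<and> (\<forall>i\<in>I. map2 (q i) (rdom \<Sigma> R) as \<in> rel (X i) R)" for R as
    by (simp add: N_def)
  have car: "car N s = e s ` E s" for s
    by (simp add: N_def car'_def)
  have st: "partial_structure \<Sigma> N"
    unfolding partial_structure_def
  proof (intro conjI ballI allI impI subsetI)
    show "as \<in> tuples N (fdom \<Sigma> f)" if "as \<in> dom (opn N f)" for f as
      using that opnD(2) tuples by blast
    show "b \<in> car N (fcod \<Sigma> f)" if "b \<in> ran (opn N f)" for f b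
      using that opnD(3,4) unfolding car ran_def by blast
    show "opn N f = Map.empty" if "f \<notin> Funs \<Sigma>" for f
      using that by (auto simp: opn fun_eq_iff)
  qed (auto simp: rel tuples car sorts)
  have hom: "hhom \<Sigma> N (X i) (q i)" if i: "i \<in> I" for i
    unfolding hhom_def
  proof (intro conjI ballI allI impI)
    show "q i s x \<in> car (X i) s" if "x \<in> car N s" for s x
    proof -
      obtain a where "a \<in> E s" "x = e s a" using \<open>x \<in> _\<close> unfolding car by blast
      then show ?thesis using PiE_mem[OF subsetD[OF E] i] by (simp add: q_def de)
    qed
    show "opn (X i) f (map2 (q i) (fdom \<Sigma> f) as) = Some (q i (fcod \<Sigma> f) b)" if "opn N f as = Some b" for f as b
      using opnD[OF that] i by (simp add: q_def de)
  qed (use i rel in blast)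
  have "jointly_closed \<Sigma> N I X q"
    unfolding jointly_closed_def
  proof (intro conjI ballI allI impI)
    show "x = y" if "x \<in> car N s" "y \<in> car N s" "\<forall>i\<in>I. q i s x = q i s y" for s x y
    proof -
      obtain a b where ab: "a \<in> E s" "b \<in> E s" "x = e s a" "y = e s b" using \<open>x \<in> _\<close> \<open>y \<in> _\<close> unfolding car by blast
      then have "\<And>i. i \<in> I \<Longrightarrow> a i = b i" using that(3) by (simp add: q_def de)
      then have "a = b" by (rule PiE_ext[OF subsetD[OF E ab(1)] subsetD[OF E ab(2)]])
      then show ?thesis using ab by simp
    qed
    show "opn N f as \<noteq> None" if "f \<in> Funs \<Sigma>" "as \<in> tuples N (fdom \<Sigma> f)"
      "\<forall>i\<in>I. opn (X i) f (map2 (q i) (fdom \<Sigma> f) as) \<noteq> None" for f as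
      using that unfolding opn tuples by simp
    show "as \<in> rel N R" if "R \<in> Rels \<Sigma>" "as \<in> tuples N (rdom \<Sigma> R)"
      "\<forall>i\<in>I. map2 (q i) (rdom \<Sigma> R) as \<in> rel (X i) R" for R as
      using that unfolding rel tuples by blast
  qed (use st hom in blast)+
  then show thesis using that car by (simp add: q_def de)
qed

section \<open>Structures generated by a valuation\<close>

lemma has_sort_Sorts: "wf_sig \<Sigma> \<Longrightarrow> fst ` set xs \<subseteq> Sorts \<Sigma> \<Longrightarrow> has_sort \<Sigma> xs t s \<Longrightarrow> s \<in> Sorts \<Sigma>"
  by (cases rule: has_sort.cases) (auto simp: wf_sig_def)

definition generated ::
  "('s, 'f, 'r) hsig \<Rightarrow> 's var list \<Rightarrow> ('s, 'f, 'r, 'a) pstruct \<Rightarrow> ('s var \<rightharpoonup> 'a) \<Rightarrow> bool" where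
  "generated \<Sigma> xs N \<rho> \<longleftrightarrow> \<rho> \<in> vals N xs \<and>
     (\<forall>s. \<forall>x\<in>car N s. \<exists>t. has_sort \<Sigma> xs t s \<and> tm_val N \<rho> t = Some x)"

text \<open>The elements are the vectors of values of those terms that are defined in every
  component. There are at most \<open>K\<close> such terms, so the carriers can be coded inside
  \<open>K\<close> whatever the size of the product of the \<open>X i\<close>.\<close>

lemma generated_substructure:
  fixes X :: "'i \<Rightarrow> ('s, 'f, 'r, 'a) pstruct" and K :: "'b set"
  assumes X: "\<And>i. i \<in> I \<Longrightarrow> partial_structure \<Sigma> (X i)"
    and \<rho>: "\<And>i. i \<in> I \<Longrightarrow> \<rho> i \<in> vals (X i) xs"
    and K: "infinite K" "Funs \<Sigma> \<lesssim> K" and wf: "wf_sig \<Sigma>" and xs: "wf_ctx \<Sigma> xs"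
  obtains N q \<rho>' where "jointly_closed \<Sigma> N I X q" "\<And>s. car N s \<subseteq> K" "generated \<Sigma> xs N \<rho>'"
    "\<And>i. i \<in> I \<Longrightarrow> vmap (q i) \<rho>' = \<rho> i"
proof -
  \<comment> \<open>\<open>vec t\<close> is the value that \<open>t\<close> would have in the
    product; it is meaningful for the terms singled out by \<open>good\<close>.\<close>
  define vec where "vec t = (\<lambda>i\<in>I. the (tm_val (X i) (\<rho> i) t))" for t
  define good where "good t s \<longleftrightarrow> has_sort \<Sigma> xs t s \<and> (\<forall>i\<in>I. tm_val (X i) (\<rho> i) t \<noteq> None)" for t s
  define E where "E s = vec ` {t. good t s}" for s
  have goodD: "tm_val (X i) (\<rho> i) t = Some (vec t i)" if "good t s" "i \<in> I" for t s i
    using that by (auto simp: good_def vec_def)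
  have "\<exists>e. inj_on e (E s) \<and> e ` E s \<subseteq> K" for s
  proof -
    have "{t. good t s} \<subseteq> {t. \<exists>s. has_sort \<Sigma> xs t s}" by (auto simp: good_def)
    then have "E s \<lesssim> K" unfolding E_def
      by (intro image_lepoll_trans subset_lepoll_trans[OF _ terms_lepoll[OF K]])
    then show ?thesis by (simp add: lepoll_def)
  qed
  then obtain e where e: "\<And>s. inj_on (e s) (E s)" "\<And>s. e s ` E s \<subseteq> K" by metis
  have EX: "E s \<subseteq> (\<Pi>\<^sub>E i\<in>I. car (X i) s)" for s
  proof
    fix a assume "a \<in> E s"
    then obtain t where t: "good t s" "a = vec t" by (auto simp: E_def)
    then have "vec t i \<in> car (X i) s" if "i \<in> I" for i
      using tm_val_car[OF X[OF that] \<rho>[OF that]] goodD[OF t(1) that] by (auto simp: good_def)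
    then show "a \<in> (\<Pi>\<^sub>E i\<in>I. car (X i) s)" unfolding t(2) by (auto simp: vec_def)
  qed
  have ES: "E s = {}" if "s \<notin> Sorts \<Sigma>" for s
    using that has_sort_Sorts[OF wf] xs by (auto simp: E_def good_def wf_ctx_def)
  have closed: "(\<lambda>i\<in>I. the (opn (X i) f (map (\<lambda>a. a i) as))) \<in> E (fcod \<Sigma> f)"
    if f: "f \<in> Funs \<Sigma>" and as: "list_all2 (\<lambda>a s. a \<in> E s) as (fdom \<Sigma> f)"
      and def: "\<And>i. i \<in> I \<Longrightarrow> opn (X i) f (map (\<lambda>a. a i) as) \<noteq> None" for f as
  proof -
    \<comment> \<open>Choose terms naming the argument vectors; then \<open>Fn f ts\<close> names
      the result of applying \<open>f\<close> componentwise.\<close>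
    from as have "\<exists>ts. list_all2 good ts (fdom \<Sigma> f) \<and> as = map vec ts"
    proof (induction rule: list_all2_induct)
      case Nil
      show ?case by (rule exI[of _ "[]"]) simp
    next
      case (Cons a as s ss)
      then obtain t ts where "good t s" "a = vec t" "list_all2 good ts ss" "as = map vec ts"
        by (auto simp: E_def)
      then show ?case by (intro exI[of _ "t # ts"]) simp
    qed
    then obtain ts where ts: "list_all2 good ts (fdom \<Sigma> f)" "as = map vec ts" by blast
    have v: "tm_val (X i) (\<rho> i) (Fn f ts) = opn (X i) f (map (\<lambda>a. a i) as)" if i: "i \<in> I" for i
    proof -
      have "tm_vals (X i) (\<rho> i) ts (map (\<lambda>a. a i) as)"
        using ts(1) goodD[OF _ i] unfolding ts(2) list_all2_conv_all_nth by auto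
      then show ?thesis by (simp add: tm_val.simps(2) flip: those_eq_Some_iff)
    qed
    have "list_all2 (has_sort \<Sigma> xs) ts (fdom \<Sigma> f)"
      using ts(1) by (rule list_all2_mono) (simp add: good_def)
    then have "has_sort \<Sigma> xs (Fn f ts) (fcod \<Sigma> f)" by (rule has_sort.intros(2)[OF f])
    then have "good (Fn f ts) (fcod \<Sigma> f)" using def v by (simp add: good_def)
    moreover have "vec (Fn f ts) = (\<lambda>i\<in>I. the (opn (X i) f (map (\<lambda>a. a i) as)))"
      unfolding vec_def by (rule restrict_ext) (simp add: v)
    ultimately show ?thesis unfolding E_def by (metis (mono_tags) imageI mem_Collect_eq)
  qed
  obtain N q where N: "jointly_closed \<Sigma> N I X q" "\<And>s. car N s = e s ` E s"
    "\<And>s a i. a \<in> E s \<Longrightarrow> i \<in> I \<Longrightarrow> q i s (e s a) = a i"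
    by (rule initial_structure[of E I X \<Sigma> e, OF EX ES e(1)]) (assumption, erule (1) closed, blast, blast)
  define \<rho>' where "\<rho>' x = (if x \<in> set xs then Some (e (fst x) (vec (Var x))) else None)" for x
  have vE: "vec (Var x) \<in> E (fst x)" if "x \<in> set xs" for x
    using that valsD[OF \<rho>] has_sort.intros(1)[OF that] unfolding E_def good_def by fastforce
  have \<rho>'N: "\<rho>' \<in> vals N xs"
    using vE by (auto simp: vals_def \<rho>'_def N(2) split: if_splits)
  have q\<rho>': "vmap (q i) \<rho>' = \<rho> i" if i: "i \<in> I" for i
  proof
    fix x show "vmap (q i) \<rho>' x = \<rho> i x"
    proof (cases "x \<in> set xs")
      case True
      then show ?thesis
        using N(3)[OF vE[OF True] i] valsD[OF \<rho>[OF i] True] i by (auto simp: vmap_def \<rho>'_def vec_def)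
    next
      case False
      then have "\<rho> i x = None" using \<rho>[OF i] unfolding vals_def by blast
      then show ?thesis using False by (simp add: vmap_def \<rho>'_def)
    qed
  qed
  have "\<exists>t. has_sort \<Sigma> xs t s \<and> tm_val N \<rho>' t = Some x" if x: "x \<in> car N s" for s x
  proof -
    obtain t where t: "good t s" "x = e s (vec t)" using x unfolding N(2) E_def by blast
    then have ts: "has_sort \<Sigma> xs t s" and tE: "vec t \<in> E s" by (auto simp: good_def E_def)
    \<comment> \<open>A term defined in every component is defined in \<open>N\<close>, and joint
      injectivity identifies its value there with the code of \<open>vec t\<close>. So the term that
      names an element really evaluates to it.\<close>
    have v: "tm_val (X i) (vmap (q i) \<rho>') t = Some (vec t i)" if "i \<in> I" for i
      using goodD[OF t(1) that] q\<rho>'[OF that] by simp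
    then obtain y where y: "tm_val N \<rho>' t = Some y"
      using jointly_closed_tm_val[OF N(1) \<rho>'N ts] by blast
    have yc: "y \<in> car N s" by (rule tm_val_car[OF jointly_closed_struct[OF N(1)] \<rho>'N ts y])
    have "y = x"
    proof (rule jointly_closed_inj[OF N(1) yc x])
      fix i assume i: "i \<in> I"
      show "q i s y = q i s x"
        using hhom_tm_val[OF jointly_closed_hhom[OF N(1) i] \<rho>'N ts y] v[OF i] N(3)[OF tE i] t(2) by simp
    qed
    then show ?thesis using y ts by blast
  qed
  then have "generated \<Sigma> xs N \<rho>'" using \<rho>'N by (simp add: generated_def)
  then show thesis using that N e(2) q\<rho>' by metis
qed

text \<open>Each element is the value of a term in the generators, and a homomorphism sends it to
  the value of that term at the images of the generators.\<close>

lemma generated_hom_unique: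
  assumes R: "generated \<Sigma> xs R \<rho>" and h: "h \<in> homs \<Sigma> R C" "h' \<in> homs \<Sigma> R C"
    and eq: "vmap h \<rho> = vmap h' \<rho>"
  shows "h = h'"
proof (rule homs_ext[OF h])
  fix s x assume "x \<in> car R s"
  then obtain t where t: "has_sort \<Sigma> xs t s" "tm_val R \<rho> t = Some x" and \<rho>: "\<rho> \<in> vals R xs"
    using R by (auto simp: generated_def)
  show "h s x = h' s x"
    using hhom_tm_val[OF homs_hhom[OF h(1)] \<rho> t] hhom_tm_val[OF homs_hhom[OF h(2)] \<rho> t] eq by simp
qed

text \<open>An element is sent to the value in \<open>C\<close> of a term naming it. Everything
  rests on \<open>transfer\<close> for atomic formulas: equations give definedness and independence
  of the name, relational atoms give preservation of relations.\<close>

lemma generated_hom_exists: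
  assumes R: "generated \<Sigma> xs R \<rho>" "partial_structure \<Sigma> R"
    and C: "\<sigma> \<in> vals C xs" "partial_structure \<Sigma> C"
    and transfer: "\<And>\<psi>. wf_horn \<Sigma> xs \<psi> \<Longrightarrow> holds R \<rho> \<psi> \<Longrightarrow> holds C \<sigma> \<psi>"
  shows "\<exists>h\<in>homs \<Sigma> R C. vmap h \<rho> = \<sigma>"
proof -
  have \<rho>: "\<rho> \<in> vals R xs" using R(1) by (simp add: generated_def)
  obtain tt where tt: "\<And>s x. x \<in> car R s \<Longrightarrow> has_sort \<Sigma> xs (tt s x) s \<and> tm_val R \<rho> (tt s x) = Some x"
    using R(1) unfolding generated_def by metis
  define h where "h s x = the (tm_val C \<sigma> (tt s x))" for s x
  have h: "tm_val C \<sigma> t = Some (h s x)" if t: "has_sort \<Sigma> xs t s" "tm_val R \<rho> t = Some x" for s x t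
  proof -
    have x: "x \<in> car R s" by (rule tm_val_car[OF R(2) \<rho> t])
    \<comment> \<open>Comparing \<open>t\<close> with the chosen name \<open>tt s x\<close> yields
      at once that \<open>t\<close> is defined in \<open>C\<close> and that its value does not
      depend on the name.\<close>
    have "holds C \<sigma> (HEq t (tt s x))"
      by (rule transfer) (use tt[OF x] t in auto)
    then show ?thesis by (auto simp: h_def)
  qed
  have car: "h s x \<in> car C s" if "x \<in> car R s" for s x
    using tm_val_car[OF C(2) C(1)] h tt[OF that] by blast
  have l: "list_all2 (has_sort \<Sigma> xs) (map2 tt ss as) ss \<and>
      tm_vals R \<rho> (map2 tt ss as) as \<and>
      tm_vals C \<sigma> (map2 tt ss as) (map2 h ss as)"
    if "as \<in> tuples R ss" for ss as
    using that unfolding mem_tuples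
    by (induction rule: list_all2_induct) (simp_all add: tt h)
  have "hhom \<Sigma> R C h"
  proof (rule hhomI[OF R(2)])
    fix f as b assume f: "f \<in> Funs \<Sigma>" and ab: "opn R f as = Some b" and "as \<in> tuples R (fdom \<Sigma> f)"
    note l = l[OF this(3)]
    let ?ts = "map2 tt (fdom \<Sigma> f) as"
    have 1: "has_sort \<Sigma> xs (Fn f ?ts) (fcod \<Sigma> f)" by (rule has_sort.intros(2)[OF f]) (use l in blast)
    have 2: "tm_val R \<rho> (Fn f ?ts) = Some b" using l ab unfolding tm_val_Fn_eq_Some by blast
    from h[OF 1 2] obtain bs where "tm_vals C \<sigma> ?ts bs"
       "opn C f bs = Some (h (fcod \<Sigma> f) b)" unfolding tm_val_Fn_eq_Some by blast
    then show "opn C f (map2 h (fdom \<Sigma> f) as) = Some (h (fcod \<Sigma> f) b)"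
      using l list_all2_Some_functional by metis
  next
    fix Q as assume Q: "Q \<in> Rels \<Sigma>" and aq: "as \<in> rel R Q" and "as \<in> tuples R (rdom \<Sigma> Q)"
    note l = l[OF this(3)]
    let ?ts = "map2 tt (rdom \<Sigma> Q) as"
    have "holds C \<sigma> (HRel Q ?ts)"
      by (rule transfer) (use l aq Q in \<open>auto simp: holds_HRel_iff\<close>)
    then show "map2 h (rdom \<Sigma> Q) as \<in> rel C Q"
      using l list_all2_Some_functional unfolding holds_HRel_iff by metis
  qed (rule car)
  then have "restr_hom R h \<in> homs \<Sigma> R C" by (rule restr_hom_homs[OF R(2)])
  moreover have "vmap (restr_hom R h) \<rho> = \<sigma>"
  proof
    fix x show "vmap (restr_hom R h) \<rho> x = \<sigma> x"
    proof (cases "x \<in> set xs")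
      case True
      then obtain a where a: "\<rho> x = Some a" "a \<in> car R (fst x)" using valsD[OF \<rho>] by blast
      then have "\<sigma> x = Some (h (fst x) a)"
        using h[OF has_sort.intros(1)[OF True]] by simp
      then show ?thesis using a by (simp add: vmap_def)
    next
      case False
      then have "\<rho> x = None" "\<sigma> x = None" using \<rho> C(1) unfolding vals_def by blast+
      then show ?thesis by (simp add: vmap_def)
    qed
  qed
  ultimately show ?thesis by blast
qed

section \<open>Relative algebras as partial models\<close>

definition lift_tm :: "('s, 'f) tm \<Rightarrow> ('s, 'f + 'w) tm" where
  "lift_tm = map_tm id Inl"

definition lift_horn :: "('s, 'f, 'r) horn \<Rightarrow> ('s, 'f + 'w, 'r) horn" where
  "lift_horn = map_horn id Inl id"

lemma lift_tm_simps [simp]: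
  "lift_tm (Var x) = Var x"
  "lift_tm (Fn f ts) = Fn (Inl f) (map lift_tm ts)"
  by (cases x) (simp_all add: lift_tm_def id_def)

lemma lift_horn_simps [simp]:
  "lift_horn (HRel R ts) = HRel R (map lift_tm ts)"
  "lift_horn (HEq t u) = HEq (lift_tm t) (lift_tm u)"
  "lift_horn HTrue = HTrue"
  "lift_horn (HAnd \<phi> \<psi>) = HAnd (lift_horn \<phi>) (lift_horn \<psi>)"
  by (simp_all add: lift_horn_def lift_tm_def id_def)

text \<open>In partial Horn logic an equation asserts that both sides are defined, so self-equality
  of a term expresses its definedness.\<close>

definition defd :: "('s, 'f, 'r, 'w) rsig \<Rightarrow> 'w \<Rightarrow> ('s, 'f + 'w, 'r) horn" where
  "defd \<Omega> w = (let t = Fn (Inr w) (map Var (fst (arity \<Omega> w))) in HEq t t)"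

text \<open>
  An algebra is a partial model of the following theory: the requirement that \<open>w\<close> is defined exactly
  where its arity holds amounts to two Horn sequents.
\<close>

definition plus_theory ::
  "('s, 'f, 'r) sequent set \<Rightarrow> ('s, 'f, 'r, 'w) rsig \<Rightarrow> ('s, 'f + 'w, 'r) sequent set \<Rightarrow>
   ('s, 'f + 'w, 'r) sequent set" where
  "plus_theory T \<Omega> E =
     (\<lambda>(xs, \<phi>, \<psi>). (xs, lift_horn \<phi>, lift_horn \<psi>)) ` T \<union> E \<union>
     (\<lambda>w. (fst (arity \<Omega> w), lift_horn (snd (arity \<Omega> w)), defd \<Omega> w)) ` Ops \<Omega> \<union>
     (\<lambda>w. (fst (arity \<Omega> w), defd \<Omega> w, lift_horn (snd (arity \<Omega> w)))) ` Ops \<Omega>"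

lemma as_struct_simps [simp]:
  "car (as_struct A) = car (und A)" "rel (as_struct A) = rel (und A)"
  "opn (as_struct A) (Inl f) = opn (und A) f" "opn (as_struct A) (Inr w) = aop A w"
  by (simp_all add: as_struct_def)

lemma tuples_as_struct [simp]: "tuples (as_struct A) ss = tuples (und A) ss"
  by (simp add: tuples_def)

lemma sig_plus_simps [simp]:
  "Sorts (sig_plus \<Sigma> \<Omega>) = Sorts \<Sigma>" "Funs (sig_plus \<Sigma> \<Omega>) = Funs \<Sigma> <+> Ops \<Omega>"
  "Rels (sig_plus \<Sigma> \<Omega>) = Rels \<Sigma>" "rdom (sig_plus \<Sigma> \<Omega>) = rdom \<Sigma>"
  "fdom (sig_plus \<Sigma> \<Omega>) (Inl f) = fdom \<Sigma> f" "fcod (sig_plus \<Sigma> \<Omega>) (Inl f) = fcod \<Sigma> f"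
  "fdom (sig_plus \<Sigma> \<Omega>) (Inr w) = map fst (fst (arity \<Omega> w))" "fcod (sig_plus \<Sigma> \<Omega>) (Inr w) = otype \<Omega> w"
  by (simp_all add: sig_plus_def)

lemma has_sort_lift: "has_sort \<Sigma> xs t s \<Longrightarrow> has_sort (sig_plus \<Sigma> \<Omega>) xs (lift_tm t) s"
proof (induction rule: has_sort.induct)
  case (1 x)
  then show ?case by (simp add: has_sort.intros(1))
next
  case (2 f ts)
  have "list_all2 (has_sort (sig_plus \<Sigma> \<Omega>) xs) (map lift_tm ts) (fdom \<Sigma> f)"
    using 2(2) by (simp add: list_all2_conv_all_nth)
  then have "has_sort (sig_plus \<Sigma> \<Omega>) xs (Fn (Inl f) (map lift_tm ts)) (fcod (sig_plus \<Sigma> \<Omega>) (Inl f))"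
    using 2(1) by (intro has_sort.intros(2)) auto
  then show ?case by simp
qed

lemma wf_horn_lift: "wf_horn \<Sigma> xs \<phi> \<Longrightarrow> wf_horn (sig_plus \<Sigma> \<Omega>) xs (lift_horn \<phi>)"
proof (induction \<phi>)
  case (HRel R ts)
  then have "list_all2 (has_sort (sig_plus \<Sigma> \<Omega>) xs) (map lift_tm ts) (rdom \<Sigma> R)"
    by (auto simp: list_all2_conv_all_nth has_sort_lift)
  then show ?case using HRel by simp
next
  case (HEq t u)
  then show ?case using has_sort_lift by fastforce
qed auto

lemma tm_val_lift: "tm_val (as_struct A) \<rho> (lift_tm t) = tm_val (und A) \<rho> t"
proof (induction t)
  case (Fn f ts)
  then have "map (tm_val (as_struct A) \<rho> \<circ> lift_tm) ts = map (tm_val (und A) \<rho>) ts" by simp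
  then show ?case by (simp add: tm_val.simps(2) del: map_eq_conv)
qed simp

lemma holds_lift: "holds (as_struct A) \<rho> (lift_horn \<phi>) \<longleftrightarrow> holds (und A) \<rho> \<phi>"
proof (induction \<phi>)
  case (HRel R ts)
  have "map (tm_val (as_struct A) \<rho> \<circ> lift_tm) ts = map (tm_val (und A) \<rho>) ts" 
    by (simp add: tm_val_lift)
  then show ?case by (simp add: holds.simps(1) del: map_eq_conv)
qed (simp_all add: tm_val_lift)

lemma interp_lift: "interp (as_struct A) xs (lift_horn \<phi>) = interp (und A) xs \<phi>"
  by (simp add: interp_def holds_lift)

lemma those_map_of_zip:
  "distinct xs \<Longrightarrow> length ms = length xs \<Longrightarrow> those (map (map_of (zip xs ms)) xs) = Some ms"
  unfolding those_eq_Some_iff list_all2_conv_all_nth by (metis map_of_zip_nth)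

lemma tm_val_aop:
  assumes "distinct xs" "length ms = length xs"
  shows "tm_val (as_struct A) (map_of (zip xs ms)) (Fn (Inr w) (map Var xs)) = aop A w ms"
proof -
  have "map (tm_val (as_struct A) (map_of (zip xs ms))) (map Var xs) = map (map_of (zip xs ms)) xs"
    by simp
  then show ?thesis using those_map_of_zip[OF assms] by (simp add: tm_val.simps(2) comp_def)
qed

lemma interp_defd:
  assumes "distinct (fst (arity \<Omega> w))"
  shows "interp (as_struct A) (fst (arity \<Omega> w)) (defd \<Omega> w) =
    {ms \<in> tuples (und A) (map fst (fst (arity \<Omega> w))). aop A w ms \<noteq> None}"
proof -
  have "length ms = length (fst (arity \<Omega> w))" if "ms \<in> tuples (und A) (map fst (fst (arity \<Omega> w)))" for ms
    using that by (auto simp: mem_tuples dest: list_all2_lengthD)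
  then show ?thesis
    using tm_val_aop[OF assms, of _ A w] by (auto simp: interp_def defd_def Let_def)
qed

lemma wf_sig_plus: "wf_sig \<Sigma> \<Longrightarrow> relative_signature \<Sigma> \<Omega> \<Longrightarrow> wf_sig (sig_plus \<Sigma> \<Omega>)"
  unfolding wf_sig_def relative_signature_def wf_ctx_def by fastforce

lemma wf_horn_defd:
  assumes "w \<in> Ops \<Omega>"
  shows "wf_horn (sig_plus \<Sigma> \<Omega>) (fst (arity \<Omega> w)) (defd \<Omega> w)"
proof -
  let ?xs = "fst (arity \<Omega> w)"
  have "list_all2 (has_sort (sig_plus \<Sigma> \<Omega>) ?xs) (map Var ?xs) (map fst ?xs)"
    by (auto simp: list_all2_conv_all_nth intro!: has_sort.intros)
  then have "has_sort (sig_plus \<Sigma> \<Omega>) ?xs (Fn (Inr w) (map Var ?xs)) (fcod (sig_plus \<Sigma> \<Omega>) (Inr w))"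
    using assms by (intro has_sort.intros(2)) auto
  then show ?thesis unfolding defd_def Let_def wf_horn.simps by blast
qed

lemma plus_theory_wf:
  assumes "partial_horn_theory \<Sigma> T" "relative_algebraic_theory \<Sigma> \<Omega> E" "\<sigma> \<in> plus_theory T \<Omega> E"
  shows "wf_sequent (sig_plus \<Sigma> \<Omega>) \<sigma>"
proof -
  have ctx: "wf_ctx (sig_plus \<Sigma> \<Omega>) xs \<longleftrightarrow> wf_ctx \<Sigma> xs" for xs by (simp add: wf_ctx_def)
  from assms(3) consider (1) xs \<phi> \<psi> where "(xs, \<phi>, \<psi>) \<in> T" "\<sigma> = (xs, lift_horn \<phi>, lift_horn \<psi>)"
    | (2) "\<sigma> \<in> E" | (3) w where "w \<in> Ops \<Omega>" "\<sigma> = (fst (arity \<Omega> w), lift_horn (snd (arity \<Omega> w)), defd \<Omega> w)"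
    | (4) w where "w \<in> Ops \<Omega>" "\<sigma> = (fst (arity \<Omega> w), defd \<Omega> w, lift_horn (snd (arity \<Omega> w)))"
    unfolding plus_theory_def by auto
  then show ?thesis
  proof cases
    case 1
    then have "wf_sequent \<Sigma> (xs, \<phi>, \<psi>)" using assms(1) by (auto simp: partial_horn_theory_def)
    then show ?thesis using 1 by (simp add: ctx wf_horn_lift)
  next
    case 2
    then have "relative_judgment \<Sigma> \<Omega> \<sigma>" using assms(2) by (simp add: relative_algebraic_theory_def)
    then show ?thesis by (cases \<sigma>) simp
  qed (use assms(2) in \<open>auto simp: ctx wf_horn_lift wf_horn_defd relative_algebraic_theory_def relative_signature_def\<close>)
qed

lemma partial_structure_as_struct:
  "partial_structure (sig_plus \<Sigma> \<Omega>) (as_struct A) \<longleftrightarrow> partial_structure \<Sigma> (und A) \<and>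
     (\<forall>w\<in>Ops \<Omega>. dom (aop A w) \<subseteq> tuples (und A) (map fst (fst (arity \<Omega> w))) \<and>
        ran (aop A w) \<subseteq> car (und A) (otype \<Omega> w)) \<and>
     (\<forall>w. w \<notin> Ops \<Omega> \<longrightarrow> aop A w = Map.empty)"
proof -
  have all: "(\<forall>f\<in>Funs \<Sigma> <+> Ops \<Omega>. P f) \<longleftrightarrow> (\<forall>f\<in>Funs \<Sigma>. P (Inl f)) \<and> (\<forall>w\<in>Ops \<Omega>. P (Inr w))"
    "(\<forall>f. f \<notin> Funs \<Sigma> <+> Ops \<Omega> \<longrightarrow> P f) \<longleftrightarrow>
      (\<forall>f. f \<notin> Funs \<Sigma> \<longrightarrow> P (Inl f)) \<and> (\<forall>w. w \<notin> Ops \<Omega> \<longrightarrow> P (Inr w))" for P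
    by (auto elim!: PlusE) (metis old.sum.exhaust InlI InrI)
  show ?thesis unfolding partial_structure_def sig_plus_simps all by (simp add: sig_plus_simps) blast
qed

text \<open>This brings algebras under the theory of partial models: a construction that preserves
  Horn sequents automatically preserves the prescribed domains of the operations in
  \<Omega>.\<close>

lemma Alg_Ob_iff:
  assumes \<Sigma>: "partial_horn_theory \<Sigma> T" and \<Omega>: "relative_signature \<Sigma> \<Omega>"
  shows "A \<in> Ob (Alg V \<Sigma> T \<Omega> E) \<longleftrightarrow>
    partial_model (sig_plus \<Sigma> \<Omega>) (plus_theory T \<Omega> E) (as_struct A) \<and> (\<forall>s. car (und A) s \<in> V)"
proof -
  have T: "(\<forall>\<sigma>\<in>(\<lambda>(xs, \<phi>, \<psi>). (xs, lift_horn \<phi>, lift_horn \<psi>)) ` T. valid_in (as_struct A) \<sigma>) \<longleftrightarrow>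
      (\<forall>\<sigma>\<in>T. valid_in (und A) \<sigma>)"
    by (auto simp: interp_lift)
  \<comment> \<open>Sequents only see tuples of the right sorts. That \<open>aop A w\<close> is
    undefined elsewhere comes from the structure being well-sorted, hence the third
    conjunct.\<close>
  have ar: "valid_in (as_struct A) (fst (arity \<Omega> w), lift_horn (snd (arity \<Omega> w)), defd \<Omega> w) \<and>
      valid_in (as_struct A) (fst (arity \<Omega> w), defd \<Omega> w, lift_horn (snd (arity \<Omega> w))) \<and>
      dom (aop A w) \<subseteq> tuples (und A) (map fst (fst (arity \<Omega> w))) \<longleftrightarrow>
      dom (aop A w) = interp (und A) (fst (arity \<Omega> w)) (snd (arity \<Omega> w))" if "w \<in> Ops \<Omega>" for w
  proof -
    have d: "distinct (fst (arity \<Omega> w))" using \<Omega> that by (simp add: relative_signature_def wf_ctx_def)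
    have s: "interp (und A) (fst (arity \<Omega> w)) (snd (arity \<Omega> w)) \<subseteq> tuples (und A) (map fst (fst (arity \<Omega> w)))"
      by (auto simp: interp_def)
    show ?thesis unfolding valid_in.simps interp_lift interp_defd[OF d] using s by blast
  qed
  show ?thesis
    unfolding Alg_def omega_algebra_def partial_model_def partial_structure_as_struct plus_theory_def ball_Un T
    using ar by (simp only: category.simps mem_Collect_eq ball_simps) blast
qed

definition alg_of :: "('s, 'f + 'w, 'r, 'u) pstruct \<Rightarrow> ('s, 'f, 'r, 'w, 'u) algebra" where
  "alg_of N = \<lparr> und = \<lparr> car = car N, opn = (\<lambda>f. opn N (Inl f)), rel = rel N \<rparr>, aop = (\<lambda>w. opn N (Inr w)) \<rparr>"

lemma as_struct_alg_of [simp]: "as_struct (alg_of N) = N"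
  by (simp add: as_struct_def alg_of_def sum.case_eq_if fun_eq_iff split: sum.splits)

lemma car_alg_of [simp]: "car (und (alg_of N)) = car N"
  by (simp add: alg_of_def)

lemma hhom_und:
  assumes "hhom (sig_plus \<Sigma> \<Omega>) (as_struct A) (as_struct B) h"
  shows "hhom \<Sigma> (und A) (und B) h"
  unfolding hhom_def
proof (intro conjI allI ballI impI)
  fix f as b assume "f \<in> Funs \<Sigma>" "opn (und A) f as = Some b"
  then show "opn (und B) f (map2 h (fdom \<Sigma> f) as) = Some (h (fcod \<Sigma> f) b)"
    using hhom_opn[OF assms, of "Inl f" as b] by auto
next
  fix R as assume "R \<in> Rels \<Sigma>" "as \<in> rel (und A) R"
  then show "map2 h (rdom \<Sigma> R) as \<in> rel (und B) R"
    using hhom_rel[OF assms, of R as] by auto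
qed (use hhom_car[OF assms] in auto)

lemma Alg_simps:
  "Hom (Alg V \<Sigma> T \<Omega> E) A B = homs (sig_plus \<Sigma> \<Omega>) (as_struct A) (as_struct B)"
  "Id (Alg V \<Sigma> T \<Omega> E) A = id_hom (as_struct A)"
  "Comp (Alg V \<Sigma> T \<Omega> E) A B C g f = comp_hom (as_struct A) g f"
  by (simp_all add: Alg_def id_hom_def comp_hom_def)

lemma closed_mono_jointly_closed:
  assumes M: "partial_structure \<Sigma> M" and m: "closed_mono \<Sigma> M N m"
  shows "jointly_closed \<Sigma> M {()} (\<lambda>_. N) (\<lambda>_. m)"
proof -
  have "x = y" if "x \<in> car M s" "y \<in> car M s" "m s x = m s y" for s x y
    using m that partial_structure_car[OF M that(1)] unfolding closed_mono_def inj_on_def by blast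
  then show ?thesis
    using M m homs_hhom[of m \<Sigma> M N] unfolding jointly_closed_def closed_mono_def by blast
qed

section \<open>Judgments are preserved\<close>

locale relative_theory =
  fixes K :: "'u set" and V :: "'u set set"
    and \<Sigma> :: "('s, 'f, 'r) hsig" and T :: "('s, 'f, 'r) sequent set"
    and \<Omega> :: "('s, 'f, 'r, 'w) rsig" and E :: "('s, 'f + 'w, 'r) sequent set"
  assumes V: "small_universe K V"
    and Sorts_small: "Sorts \<Sigma> \<lesssim> K" and Funs_small: "Funs \<Sigma> \<lesssim> K"
    and Rels_small: "Rels \<Sigma> \<lesssim> K" and Ops_small: "Ops \<Omega> \<lesssim> K"
    and horn_theory: "partial_horn_theory \<Sigma> T"
    and algebraic_theory: "relative_algebraic_theory \<Sigma> \<Omega> E"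
begin

abbreviation "\<Sigma>' \<equiv> sig_plus \<Sigma> \<Omega>"
abbreviation "T' \<equiv> plus_theory T \<Omega> E"
abbreviation "ahoms A B \<equiv> homs \<Sigma>' (as_struct A) (as_struct B)"
abbreviation C :: "(('s, 'f, 'r, 'w, 'u) algebra, 's \<Rightarrow> 'u \<Rightarrow> 'u) category" where
  "C \<equiv> Alg V \<Sigma> T \<Omega> E"

lemma relative_sig: "relative_signature \<Sigma> \<Omega>"
  using algebraic_theory by (simp add: relative_algebraic_theory_def)

lemma wf_sig': "wf_sig \<Sigma>'"
  using horn_theory by (intro wf_sig_plus relative_sig) (simp add: partial_horn_theory_def)

lemma infinite_K: "infinite K"
  by (rule small_universe_infinite[OF V])

lemma Funs'_small: "Funs \<Sigma>' \<lesssim> K"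
proof -
  have "Funs \<Sigma>' = Inl ` Funs \<Sigma> \<union> Inr ` Ops \<Omega>" by auto
  then show ?thesis
    using infinite_Un_lepoll[OF infinite_K image_lepoll_trans[OF Funs_small] image_lepoll_trans[OF Ops_small]]
    by simp
qed

lemma Ob_iff: "A \<in> Ob C \<longleftrightarrow> partial_model \<Sigma>' T' (as_struct A) \<and> (\<forall>s. car (und A) s \<in> V)"
  by (rule Alg_Ob_iff[OF horn_theory relative_sig])

lemma Ob_struct: "A \<in> Ob C \<Longrightarrow> partial_structure \<Sigma>' (as_struct A)"
  by (simp add: Ob_iff partial_model_def)

lemma Ob_und: "A \<in> Ob C \<Longrightarrow> partial_structure \<Sigma> (und A)"
  using Ob_struct by (simp add: partial_structure_as_struct)

text \<open>The axioms in \<open>T'\<close>, including the two that fix the domain of each operation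
  of \<Omega>, are Horn sequents and so pass from the \<open>X i\<close> to
  \<open>N\<close>.\<close>

lemma jointly_closed_Ob:
  assumes "jointly_closed \<Sigma>' N I (\<lambda>i. as_struct (X i)) q" "\<And>i. i \<in> I \<Longrightarrow> X i \<in> Ob C"
    and "\<And>s. car N s \<in> V"
  shows "alg_of N \<in> Ob C"
  using jointly_closed_model[OF assms(1), of T'] plus_theory_wf[OF horn_theory algebraic_theory] assms(2,3)
  by (simp add: Ob_iff)

text \<open>Carriers contained in \<open>K\<close> are small, so the generated algebra is an object
  of \<open>C\<close> even when the product of the \<open>X i\<close> is too large to be
  one.\<close>

lemma generated_subalgebra:
  assumes X: "\<And>i. i \<in> I \<Longrightarrow> X i \<in> Ob C" and \<rho>: "\<And>i. i \<in> I \<Longrightarrow> \<rho> i \<in> vals (as_struct (X i)) xs"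
    and xs: "wf_ctx \<Sigma>' xs"
  obtains N q \<rho>' where "jointly_closed \<Sigma>' N I (\<lambda>i. as_struct (X i)) q" "alg_of N \<in> Ob C"
    "generated \<Sigma>' xs N \<rho>'" "\<And>i. i \<in> I \<Longrightarrow> vmap (q i) \<rho>' = \<rho> i"
proof -
  obtain N q \<rho>' where N: "jointly_closed \<Sigma>' N I (\<lambda>i. as_struct (X i)) q" "\<And>s. car N s \<subseteq> K"
      "generated \<Sigma>' xs N \<rho>'" "\<And>i. i \<in> I \<Longrightarrow> vmap (q i) \<rho>' = \<rho> i"
    using generated_substructure[where I = I and X = "\<lambda>i. as_struct (X i)" and \<rho> = \<rho>,
        OF Ob_struct[OF X] \<rho> infinite_K Funs'_small wf_sig' xs] by blast
  have "car N s \<in> V" for s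
    by (rule small_universe_lepoll[OF V small_universe_mem[OF V] subset_imp_lepoll[OF N(2)]])
  then show thesis using that N(1,3,4) jointly_closed_Ob[OF N(1) X] by blast
qed

lemma Ob_Un_iff: "A \<in> Ob (Alg V \<Sigma> T \<Omega> (E \<union> E')) \<longleftrightarrow> A \<in> Ob C \<and> (\<forall>\<sigma>\<in>E'. valid_in (as_struct A) \<sigma>)"
  unfolding Alg_def by auto

lemma relative_judgmentE:
  assumes "relative_judgment \<Sigma> \<Omega> \<sigma>"
  obtains xs \<phi> \<psi> where "\<sigma> = (xs, lift_horn \<phi>, \<psi>)" "distinct xs" "wf_ctx \<Sigma>' xs"
    "wf_horn \<Sigma> xs \<phi>" "wf_horn \<Sigma>' xs (lift_horn \<phi>)" "wf_horn \<Sigma>' xs \<psi>"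
  using assms by (cases \<sigma>) (auto simp: wf_ctx_def lift_horn_def[symmetric])

section \<open>Categorical products of algebras\<close>

context
  fixes I :: "'i set" and X :: "'i \<Rightarrow> ('s, 'f, 'r, 'w, 'u) algebra" and P p
  assumes X: "\<And>i. i \<in> I \<Longrightarrow> X i \<in> Ob C" and P: "is_product C I X P p"
begin

lemma product_Ob: "P \<in> Ob C"
  using P by (simp add: is_product_def)

lemma product_proj: "i \<in> I \<Longrightarrow> p i \<in> ahoms P (X i)"
  using P by (simp add: is_product_def Alg_simps)

lemma product_universal:
  "Q \<in> Ob C \<Longrightarrow> (\<And>i. i \<in> I \<Longrightarrow> q i \<in> ahoms Q (X i)) \<Longrightarrow>
    \<exists>!u. u \<in> ahoms Q P \<and> (\<forall>i\<in>I. comp_hom (as_struct Q) (p i) u = q i)"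
  using P unfolding is_product_def Alg_simps by blast

lemma product_factor:
  assumes N: "jointly_closed \<Sigma>' N I (\<lambda>i. as_struct (X i)) q" and NOb: "alg_of N \<in> Ob C"
  obtains u where "u \<in> homs \<Sigma>' N (as_struct P)"
    "\<And>i s x. i \<in> I \<Longrightarrow> x \<in> car N s \<Longrightarrow> p i s (u s x) = q i s x"
proof -
  have q: "restr_hom N (q i) \<in> ahoms (alg_of N) (X i)" if "i \<in> I" for i
    using restr_hom_homs[OF jointly_closed_struct[OF N] jointly_closed_hhom[OF N that]] by simp
  obtain u where u: "u \<in> homs \<Sigma>' N (as_struct P)"
    "\<And>i. i \<in> I \<Longrightarrow> comp_hom N (p i) u = restr_hom N (q i)"
    using ex1_implies_ex[OF product_universal[OF NOb q]] unfolding as_struct_alg_of by blast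
  show thesis
  proof (rule that[OF u(1)])
    show "p i s (u s x) = q i s x" if "i \<in> I" "x \<in> car N s" for i s x
      using fun_cong[OF fun_cong[OF u(2)[OF that(1)]], of s x] that(2) by simp
  qed
qed

text \<open>
  The set-theoretic product of a small family need not belong to \<open>V\<close>, so a categorical product
  cannot be compared with it. The projections are instead tested on small algebras: here on
  their joint kernel pair, below on a subalgebra of the set-theoretic product generated by finitely
  many elements.
\<close>

lemma product_jointly_injective:
  assumes xy: "x \<in> car (und P) s" "y \<in> car (und P) s" and eq: "\<And>i. i \<in> I \<Longrightarrow> p i s x = p i s y"
  shows "x = y"
proof -
  let ?P = "as_struct P"
  \<comment> \<open>\<open>R\<close> is the joint kernel pair of the projections, with a pair
    written as a function on \<open>bool\<close>. Being inside a binary power of \<open>P\<close>,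
    it is small.\<close>
  define R where "R s = {a \<in> UNIV \<rightarrow>\<^sub>E car (und P) s. \<forall>i\<in>I. p i s (a True) = p i s (a False)}" for s
  have UNIV: "(UNIV :: bool set) \<lesssim> K" using infinite_K by (intro finite_lepoll_infinite) simp_all
  obtain e where e: "\<And>s. inj_on (e s) (R s)" "\<And>s. e s ` R s \<in> V"
    by (rule small_universe_PiE_inj[OF V UNIV, of "\<lambda>s b. car (und P) s" R])
      (use product_Ob in \<open>auto simp: R_def Ob_iff\<close>)
  obtain N q where N: "jointly_closed \<Sigma>' N UNIV (\<lambda>_ :: bool. ?P) q" "\<And>s. car N s = e s ` R s"
    "\<And>s a b. a \<in> R s \<Longrightarrow> q b s (e s a) = a b"
  proof (rule initial_structure[of R UNIV "\<lambda>_. ?P" \<Sigma>' e])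
    show "R s \<subseteq> UNIV \<rightarrow>\<^sub>E car ?P s" for s by (auto simp: R_def)
    show "R s = {}" if "s \<notin> Sorts \<Sigma>'" for s
      using partial_structure_car[OF Ob_struct[OF product_Ob], of _ s] that by (auto simp: R_def PiE_iff)
    show "inj_on (e s) (R s)" for s by (rule e(1))
  next
    fix f as
    assume f: "f \<in> Funs \<Sigma>'" and as: "list_all2 (\<lambda>a s. a \<in> R s) as (fdom \<Sigma>' f)"
      and def: "\<And>b. b \<in> UNIV \<Longrightarrow> opn ?P f (map (\<lambda>a. a b) as) \<noteq> None"
    define c where "c b = the (opn ?P f (map (\<lambda>a. a b) as))" for b
    have c: "opn ?P f (map (\<lambda>a. a b) as) = Some (c b)" for b using def[of b] by (auto simp: c_def)
    have "p i (fcod \<Sigma>' f) (c True) = p i (fcod \<Sigma>' f) (c False)" if i: "i \<in> I" for i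
    proof -
      have "map2 (p i) (fdom \<Sigma>' f) (map (\<lambda>a. a True) as) = map2 (p i) (fdom \<Sigma>' f) (map (\<lambda>a. a False) as)"
        using as i by (induction rule: list_all2_induct) (auto simp: R_def)
      then show ?thesis
        using hhom_opn[OF homs_hhom[OF product_proj[OF i]] f c[of True]]
          hhom_opn[OF homs_hhom[OF product_proj[OF i]] f c[of False]] by simp
    qed
    moreover have "c b \<in> car (und P) (fcod \<Sigma>' f)" for b
      using partial_structure_opn[OF Ob_struct[OF product_Ob] c[of b]] by simp
    ultimately show "(\<lambda>b\<in>UNIV. the (opn ?P f (map (\<lambda>a. a b) as))) \<in> R (fcod \<Sigma>' f)"
      unfolding c_def[symmetric] by (simp add: R_def)
  qed blast
  have "car N s \<in> V" for s
    unfolding N(2) by (rule e(2))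
  then have Q: "alg_of N \<in> Ob C"
    using jointly_closed_Ob[of N UNIV "\<lambda>_. P" q] N(1) product_Ob by blast
  have st: "partial_structure \<Sigma>' N" by (rule jointly_closed_struct[OF N(1)])
  have q: "restr_hom N (q b) \<in> homs \<Sigma>' N ?P" for b
    by (rule restr_hom_homs[OF st jointly_closed_hhom[OF N(1)]]) simp
  let ?r = "\<lambda>i. comp_hom N (p i) (restr_hom N (q True))"
  have r: "?r i \<in> homs \<Sigma>' N (as_struct (X i))" if "i \<in> I" for i
    by (rule comp_hom_homs[OF st q product_proj[OF that]])
  have r': "comp_hom N (p i) (restr_hom N (q False)) = ?r i" if i: "i \<in> I" for i
  proof (rule homs_ext[OF comp_hom_homs[OF st q product_proj[OF i]] r[OF i]])
    fix s x assume "x \<in> car N s"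
    then show "comp_hom N (p i) (restr_hom N (q False)) s x = ?r i s x"
      using N(3) i unfolding N(2) by (auto simp: R_def N(2))
  qed
  \<comment> \<open>The two projections of the kernel pair have the same composites with every
    \<open>p i\<close>; uniqueness in the universal property of \<open>P\<close> makes them equal.
    Evaluating them at the code of the pair \<open>(x, y)\<close> gives the claim.\<close>
  have "restr_hom N (q True) = restr_hom N (q False)"
    using product_universal[OF Q, of ?r] q r r' by (metis as_struct_alg_of)
  moreover define a where "a = (\<lambda>b. if b then x else y)"
  then have a: "a \<in> R s" using xy eq by (auto simp: R_def)
  then have "e s a \<in> car N s" by (simp add: N(2))
  ultimately have "q True s (e s a) = q False s (e s a)" by (metis restr_hom_apply)
  then show ?thesis using N(3)[OF a] by (simp add: a_def)
qed

text \<open>The algebra \<open>N\<close> generated by the family of tuples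
  \<open>vmap (p i) \<rho>\<close> is jointly closed over the factors, so \<psi> holds at its
  generators. The universal property maps \<open>N\<close> to \<open>P\<close>, joint injectivity
  shows that the generators go to \<rho>, and \<psi> is pushed forward along this map.\<close>

lemma product_holds:
  assumes xs: "wf_ctx \<Sigma>' xs" and \<rho>: "\<rho> \<in> vals (as_struct P) xs" and \<psi>: "wf_horn \<Sigma>' xs \<psi>"
    and holds: "\<And>i. i \<in> I \<Longrightarrow> holds (as_struct (X i)) (vmap (p i) \<rho>) \<psi>"
  shows "holds (as_struct P) \<rho> \<psi>"
proof -
  note proj = homs_hhom[OF product_proj]
  have p\<rho>: "vmap (p i) \<rho> \<in> vals (as_struct (X i)) xs" if "i \<in> I" for i
    by (rule vmap_vals[OF \<rho> hhom_car[OF proj[OF that]]])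
  obtain N q \<rho>' where N: "jointly_closed \<Sigma>' N I (\<lambda>i. as_struct (X i)) q" "alg_of N \<in> Ob C"
      "generated \<Sigma>' xs N \<rho>'" "\<And>i. i \<in> I \<Longrightarrow> vmap (q i) \<rho>' = vmap (p i) \<rho>"
    using generated_subalgebra[where \<rho> = "\<lambda>i. vmap (p i) \<rho>", OF X p\<rho> xs] by blast
  have \<rho>': "\<rho>' \<in> vals N xs" using N(3) by (simp add: generated_def)
  obtain u where u: "u \<in> homs \<Sigma>' N (as_struct P)"
    "\<And>i s x. i \<in> I \<Longrightarrow> x \<in> car N s \<Longrightarrow> p i s (u s x) = q i s x"
    using product_factor[OF N(1,2)] by blast
  have "vmap u \<rho>' = \<rho>"
  proof
    fix x show "vmap u \<rho>' x = \<rho> x"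
    proof (cases "x \<in> set xs")
      case True
      then obtain a b where a: "\<rho>' x = Some a" "a \<in> car N (fst x)"
        and b: "\<rho> x = Some b" "b \<in> car (as_struct P) (fst x)"
        using valsD[OF \<rho>' True] valsD[OF \<rho> True] by blast
      have "u (fst x) a = b"
      proof (rule product_jointly_injective)
        show "u (fst x) a \<in> car (und P) (fst x)" using hhom_car[OF homs_hhom[OF u(1)] a(2)] by simp
        show "b \<in> car (und P) (fst x)" using b by simp
        fix i assume i: "i \<in> I"
        have "p i (fst x) (u (fst x) a) = q i (fst x) a"
          by (rule u(2)[OF i a(2)])
        also have "\<dots> = p i (fst x) b"
          using fun_cong[OF N(4)[OF i], of x] a b by (simp add: vmap_def)
        finally show "p i (fst x) (u (fst x) a) = p i (fst x) b" .
      qed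
      then show ?thesis using a b by (simp add: vmap_def)
    next
      case False
      then have "\<rho>' x = None" "\<rho> x = None" using \<rho>' \<rho> unfolding vals_def by blast+
      then show ?thesis by (simp add: vmap_def)
    qed
  qed
  moreover have "holds N \<rho>' \<psi>"
    by (rule jointly_closed_holds[OF N(1) \<rho>' \<psi>]) (simp add: N(4) holds)
  ultimately show ?thesis using hhom_holds[OF homs_hhom[OF u(1)] \<rho>' \<psi>] by simp
qed

lemma product_valid:
  assumes \<sigma>: "relative_judgment \<Sigma> \<Omega> \<sigma>" and valid: "\<And>i. i \<in> I \<Longrightarrow> valid_in (as_struct (X i)) \<sigma>"
  shows "valid_in (as_struct P) \<sigma>"
proof -
  obtain xs \<phi> \<psi> where s: "\<sigma> = (xs, \<phi>, \<psi>)" "distinct xs" "wf_ctx \<Sigma>' xs" "wf_horn \<Sigma>' xs \<phi>" "wf_horn \<Sigma>' xs \<psi>"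
    using \<sigma> by (rule relative_judgmentE) blast
  show ?thesis unfolding s(1) valid_in_iff_vals[OF s(2)]
  proof (intro ballI impI, rule product_holds[OF s(3) _ s(5)], assumption)
    fix \<rho> i assume \<rho>: "\<rho> \<in> vals (as_struct P) xs" "holds (as_struct P) \<rho> \<phi>" and i: "i \<in> I"
    note proj = homs_hhom[OF product_proj[OF i]]
    have "vmap (p i) \<rho> \<in> vals (as_struct (X i)) xs" by (rule vmap_vals[OF \<rho>(1) hhom_car[OF proj]])
    then show "holds (as_struct (X i)) (vmap (p i) \<rho>) \<psi>"
      using valid[OF i] hhom_holds[OF proj \<rho>(1) s(4) \<rho>(2)] unfolding s(1) valid_in_iff_vals[OF s(2)] by blast
  qed
qed

end

text \<open>The definition of closedness mentions only \<Sigma>, but the domain of an operation of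
  \<Omega> is given by a Horn formula over \<Sigma>, which a \<Sigma>-closed monomorphism reflects.
  Hence the operations of \<Omega> are reflected as well.\<close>

lemma closed_mono_as_struct:
  assumes A: "A \<in> Ob C" and B: "B \<in> Ob C" and m: "m \<in> ahoms A B"
    and cm: "closed_mono \<Sigma> (und A) (und B) m"
  shows "jointly_closed \<Sigma>' (as_struct A) {()} (\<lambda>_. as_struct B) (\<lambda>_. m)"
proof -
  note jc = closed_mono_jointly_closed[OF Ob_und[OF A] cm]
  have dom: "dom (aop D w) = interp (und D) (fst (arity \<Omega> w)) (snd (arity \<Omega> w))" if "D \<in> Ob C" "w \<in> Ops \<Omega>" for D w
    using that by (simp add: Alg_def omega_algebra_def)
  have opn: "opn (as_struct A) f as \<noteq> None"
    if f: "f \<in> Funs \<Sigma>'" and as: "as \<in> tuples (as_struct A) (fdom \<Sigma>' f)"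
      and def: "opn (as_struct B) f (map2 m (fdom \<Sigma>' f) as) \<noteq> None" for f as
  proof (cases f)
    case (Inl g)
    then show ?thesis using jointly_closed_opn[OF jc, of g as] f as def by auto
  next
    case (Inr w)
    let ?xs = "fst (arity \<Omega> w)" and ?\<phi> = "snd (arity \<Omega> w)"
    have w: "w \<in> Ops \<Omega>" using f Inr by auto
    then have \<phi>: "wf_horn \<Sigma> ?xs ?\<phi>" using relative_sig by (simp add: relative_signature_def)
    have as': "as \<in> tuples (und A) (map fst ?xs)" using as Inr by simp
    then have len: "length as = length ?xs" by (auto simp: mem_tuples dest: list_all2_lengthD)
    have "aop B w (map2 m (map fst ?xs) as) \<noteq> None" using def Inr by simp
    then have "map2 m (map fst ?xs) as \<in> interp (und B) ?xs ?\<phi>" using dom[OF B w] by blast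
    then have "holds (und B) (vmap m (map_of (zip ?xs as))) ?\<phi>"
      unfolding interp_def mem_Collect_eq map_of_zip_vmap[OF len] by blast
    then have "holds (und A) (map_of (zip ?xs as)) ?\<phi>"
      using jointly_closed_holds[OF jc map_of_zip_vals[OF as'] \<phi>] by blast
    then have "as \<in> interp (und A) ?xs ?\<phi>" using as' by (simp add: interp_def)
    then show ?thesis using dom[OF A w] Inr by auto
  qed
  show ?thesis
    unfolding jointly_closed_def
    using Ob_struct[OF A] homs_hhom[OF m] jointly_closed_inj[OF jc] jointly_closed_rel[OF jc] opn by auto
qed

lemma closed_mono_valid:
  assumes "A \<in> Ob C" "B \<in> Ob C" "m \<in> ahoms A B" "closed_mono \<Sigma> (und A) (und B) m"
    and \<sigma>: "relative_judgment \<Sigma> \<Omega> \<sigma>" and "valid_in (as_struct B) \<sigma>"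
  shows "valid_in (as_struct A) \<sigma>"
proof (rule jointly_closed_valid[OF closed_mono_as_struct[OF assms(1-4)]])
  show "wf_sequent \<Sigma>' \<sigma>" using \<sigma> by (cases \<sigma>) simp
qed (rule assms(6))

lemma retraction_valid:
  assumes A: "A \<in> Ob C" and B: "B \<in> Ob C" and p: "p \<in> ahoms A B"
    and s: "s \<in> homs \<Sigma> (und B) (und A)" and ps: "comp_hom (und B) p s = id_hom (und B)"
    and \<sigma>: "relative_judgment \<Sigma> \<Omega> \<sigma>" and valid: "valid_in (as_struct A) \<sigma>"
  shows "valid_in (as_struct B) \<sigma>"
proof -
  obtain xs \<phi> \<psi> where j: "\<sigma> = (xs, lift_horn \<phi>, \<psi>)" "distinct xs" "wf_horn \<Sigma> xs \<phi>" "wf_horn \<Sigma>' xs \<psi>"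
    using \<sigma> by (rule relative_judgmentE) blast
  show ?thesis unfolding j(1) valid_in_iff_vals[OF j(2)]
  proof (intro ballI impI)
    fix \<rho> assume \<rho>: "\<rho> \<in> vals (as_struct B) xs" "holds (as_struct B) \<rho> (lift_horn \<phi>)"
    have \<rho>': "\<rho> \<in> vals (und B) xs" using \<rho>(1) by (simp add: vals_def)
    have s\<rho>: "vmap s \<rho> \<in> vals (as_struct A) xs"
      by (rule vmap_vals[OF \<rho>(1)]) (use hhom_car[OF homs_hhom[OF s]] in auto)
    have "holds (as_struct A) (vmap s \<rho>) (lift_horn \<phi>)"
      using hhom_holds[OF homs_hhom[OF s] \<rho>' j(3)] \<rho>(2) by (simp add: holds_lift)
    then have "holds (as_struct A) (vmap s \<rho>) \<psi>"
      using valid s\<rho> unfolding j(1) valid_in_iff_vals[OF j(2)] by blast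
    then have "holds (as_struct B) (vmap p (vmap s \<rho>)) \<psi>"
      by (rule hhom_holds[OF homs_hhom[OF p] s\<rho> j(4)])
    moreover have "vmap p (vmap s \<rho>) = vmap (\<lambda>s x. x) \<rho>"
      unfolding vmap_vmap
    proof (rule vmap_cong[OF \<rho>'])
      show "p t (s t x) = x" if "x \<in> car (und B) t" for t x
        using fun_cong[OF fun_cong[OF ps], of t x] that by simp
    qed
    ultimately show "holds (as_struct B) \<rho> \<psi>" by (simp add: vmap_ident)
  qed
qed

end

section \<open>Filtered colimits of partial structures\<close>

locale filtered_diagram =
  fixes \<Sigma> :: "('s, 'f, 'r) hsig" and J :: "('j, 'k) category"
    and M :: "'j \<Rightarrow> ('s, 'f, 'r, 'a) pstruct" and h :: "'j \<Rightarrow> 'j \<Rightarrow> 'k \<Rightarrow> 's \<Rightarrow> 'a \<Rightarrow> 'a"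
  assumes cat: "is_category J" and filt: "filtered J"
    and struct: "i \<in> Ob J \<Longrightarrow> partial_structure \<Sigma> (M i)"
    and hom: "i \<in> Ob J \<Longrightarrow> j \<in> Ob J \<Longrightarrow> f \<in> Hom J i j \<Longrightarrow> hhom \<Sigma> (M i) (M j) (h i j f)"
    and h_Comp: "i \<in> Ob J \<Longrightarrow> j \<in> Ob J \<Longrightarrow> k \<in> Ob J \<Longrightarrow> f \<in> Hom J i j \<Longrightarrow> g \<in> Hom J j k \<Longrightarrow>
      x \<in> car (M i) s \<Longrightarrow> h i k (Comp J i j k g f) s x = h j k g s (h i j f s x)"
begin

lemma Id_Hom: "i \<in> Ob J \<Longrightarrow> Id J i \<in> Hom J i i"
  using cat unfolding is_category_def by blast

lemma Comp_Hom:
  "i \<in> Ob J \<Longrightarrow> j \<in> Ob J \<Longrightarrow> k \<in> Ob J \<Longrightarrow> f \<in> Hom J i j \<Longrightarrow> g \<in> Hom J j k \<Longrightarrow>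
    Comp J i j k g f \<in> Hom J i k"
  using cat unfolding is_category_def by blast

lemma upper_bound:
  assumes "i \<in> Ob J" "j \<in> Ob J"
  obtains k f g where "k \<in> Ob J" "f \<in> Hom J i k" "g \<in> Hom J j k"
  using filt assms unfolding filtered_def by (metis all_not_in_conv)

text \<open>An upper bound of \<open>j\<close> and \<open>k\<close> gives a square that need not
  commute; its two composites are parallel arrows, which a further arrow equalizes.\<close>

lemma complete_span:
  assumes i: "i \<in> Ob J" and j: "j \<in> Ob J" and k: "k \<in> Ob J" and f: "f \<in> Hom J i j" and g: "g \<in> Hom J i k"
  obtains l p q where "l \<in> Ob J" "p \<in> Hom J j l" "q \<in> Hom J k l" "Comp J i j l p f = Comp J i k l q g"
proof -
  obtain m a b where m: "m \<in> Ob J" and a: "a \<in> Hom J j m" and b: "b \<in> Hom J k m"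
    using upper_bound[OF j k] .
  have par: "Comp J i j m a f \<in> Hom J i m" "Comp J i k m b g \<in> Hom J i m"
    using Comp_Hom i j k m a b f g by blast+
  then obtain l t where l: "l \<in> Ob J" and t: "t \<in> Hom J m l"
    and eq: "Comp J i m l t (Comp J i j m a f) = Comp J i m l t (Comp J i k m b g)"
    using filt i m unfolding filtered_def by meson
  have "Comp J i m l t (Comp J i j m a f) = Comp J i j l (Comp J j m l t a) f"
    "Comp J i m l t (Comp J i k m b g) = Comp J i k l (Comp J k m l t b) g"
    using cat i j k l m a b f g t unfolding is_category_def by blast+
  then show thesis
    using that[OF l Comp_Hom[OF j m l a t] Comp_Hom[OF k m l b t]] eq by simp
qed

lemma h_car: "i \<in> Ob J \<Longrightarrow> j \<in> Ob J \<Longrightarrow> f \<in> Hom J i j \<Longrightarrow> x \<in> car (M i) s \<Longrightarrow> h i j f s x \<in> car (M j) s"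
  using hhom_car[OF hom] .

lemma map2_h_tuples:
  "i \<in> Ob J \<Longrightarrow> j \<in> Ob J \<Longrightarrow> f \<in> Hom J i j \<Longrightarrow> xs \<in> tuples (M i) ss \<Longrightarrow> map2 (h i j f) ss xs \<in> tuples (M j) ss"
  by (erule map2_tuples) (rule h_car)

lemma map2_h_Comp:
  assumes "i \<in> Ob J" "j \<in> Ob J" "k \<in> Ob J" "f \<in> Hom J i j" "g \<in> Hom J j k" and xs: "xs \<in> tuples (M i) ss"
  shows "map2 (h i k (Comp J i j k g f)) ss xs = map2 (h j k g) ss (map2 (h i j f) ss xs)"
  unfolding map2_map2_tuples[OF xs] by (rule map2_cong_tuples[OF xs]) (rule h_Comp[OF assms(1-5)])

lemma vmap_h_Comp:
  assumes "i \<in> Ob J" "j \<in> Ob J" "k \<in> Ob J" "f \<in> Hom J i j" "g \<in> Hom J j k" and \<rho>: "\<rho> \<in> vals (M i) xs"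
  shows "vmap (h i k (Comp J i j k g f)) \<rho> = vmap (h j k g) (vmap (h i j f) \<rho>)"
  unfolding vmap_vmap by (rule vmap_cong[OF \<rho>]) (rule h_Comp[OF assms(1-5)])

lemma vmap_h_vals:
  "i \<in> Ob J \<Longrightarrow> j \<in> Ob J \<Longrightarrow> f \<in> Hom J i j \<Longrightarrow> \<rho> \<in> vals (M i) xs \<Longrightarrow> vmap (h i j f) \<rho> \<in> vals (M j) xs"
  by (erule vmap_vals) (rule h_car)

text \<open>The usual equivalence relation on a disjoint union of stages: two elements are
  identified when they have the same image at some common later stage.\<close>

definition merge :: "'s \<Rightarrow> 'j \<Rightarrow> 'a \<Rightarrow> 'j \<Rightarrow> 'a \<Rightarrow> bool" where
  "merge s i x j y \<longleftrightarrow> (\<exists>k\<in>Ob J. \<exists>f\<in>Hom J i k. \<exists>g\<in>Hom J j k. h i k f s x = h j k g s y)"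

lemma merge_refl: "i \<in> Ob J \<Longrightarrow> merge s i x i x"
  using cat unfolding merge_def is_category_def by blast

lemma merge_sym: "merge s i x j y \<Longrightarrow> merge s j y i x"
  unfolding merge_def by metis

text \<open>The two witnesses form a span out of the middle stage \<open>j\<close>; completing it
  carries both agreements to one stage.\<close>

lemma merge_trans:
  assumes i: "i \<in> Ob J" and j: "j \<in> Ob J" and k: "k \<in> Ob J"
    and x: "x \<in> car (M i) s" and y: "y \<in> car (M j) s" and z: "z \<in> car (M k) s"
    and ij: "merge s i x j y" and jk: "merge s j y k z"
  shows "merge s i x k z"
proof -
  obtain m f g where m: "m \<in> Ob J" "f \<in> Hom J i m" "g \<in> Hom J j m" "h i m f s x = h j m g s y"
    using ij unfolding merge_def by blast
  obtain n f' g' where n: "n \<in> Ob J" "f' \<in> Hom J j n" "g' \<in> Hom J k n" "h j n f' s y = h k n g' s z"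
    using jk unfolding merge_def by blast
  obtain l p q where l: "l \<in> Ob J" "p \<in> Hom J m l" "q \<in> Hom J n l" "Comp J j m l p g = Comp J j n l q f'"
    using complete_span[OF j m(1) n(1) m(3) n(2)] .
  have "h i l (Comp J i m l p f) s x = h j l (Comp J j m l p g) s y"
    using h_Comp[OF i m(1) l(1) m(2) l(2) x] h_Comp[OF j m(1) l(1) m(3) l(2) y] m(4) by simp
  also have "\<dots> = h k l (Comp J k n l q g') s z"
    using h_Comp[OF j n(1) l(1) n(2) l(3) y] h_Comp[OF k n(1) l(1) n(3) l(3) z] n(4) l(4) by simp
  finally show ?thesis
    unfolding merge_def using l(1) Comp_Hom[OF i m(1) l(1) m(2) l(2)] Comp_Hom[OF k n(1) l(1) n(3) l(3)] by blast
qed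

text \<open>The arrows witnessing \<open>merge\<close> may be different parallel arrows; equalizing
  them yields a single arrow that identifies the two elements.\<close>

lemma merge_same:
  assumes i: "i \<in> Ob J" and xy: "x \<in> car (M i) s" "y \<in> car (M i) s" and "merge s i x i y"
  obtains k f where "k \<in> Ob J" "f \<in> Hom J i k" "h i k f s x = h i k f s y"
proof -
  obtain m f g where m: "m \<in> Ob J" "f \<in> Hom J i m" "g \<in> Hom J i m" "h i m f s x = h i m g s y"
    using \<open>merge s i x i y\<close> unfolding merge_def by blast
  then obtain l t where l: "l \<in> Ob J" "t \<in> Hom J m l" "Comp J i m l t f = Comp J i m l t g"
    using filt i unfolding filtered_def by meson
  have "h i l (Comp J i m l t f) s x = h i l (Comp J i m l t f) s y"
    using h_Comp[OF i m(1) l(1) m(2) l(2) xy(1)] h_Comp[OF i m(1) l(1) m(3) l(2) xy(2)] m(4) l(3) by simp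
  then show thesis using that l Comp_Hom[OF i m(1) l(1) m(2) l(2)] by blast
qed

text \<open>Classes of merged elements are an image of the disjoint union of the carriers, so any
  set that bounds the disjoint union can hold codes for them.\<close>

lemma merge_quotient:
  fixes Y :: "'s \<Rightarrow> 'b set"
  assumes Y: "\<And>s. Sigma (Ob J) (\<lambda>i. car (M i) s) \<lesssim> Y s"
  obtains c where "\<And>s i x. i \<in> Ob J \<Longrightarrow> x \<in> car (M i) s \<Longrightarrow> c i s x \<in> Y s"
    "\<And>s i x j y. i \<in> Ob J \<Longrightarrow> j \<in> Ob J \<Longrightarrow> x \<in> car (M i) s \<Longrightarrow> y \<in> car (M j) s \<Longrightarrow>
      c i s x = c j s y \<longleftrightarrow> merge s i x j y"
proof -
  define Z where "Z s = Sigma (Ob J) (\<lambda>i. car (M i) s)" for s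
  define cls where "cls s z = {z' \<in> Z s. merge s (fst z) (snd z) (fst z') (snd z')}" for s z
  have "cls s ` Z s \<lesssim> Y s" for s
    using Y unfolding Z_def by (rule image_lepoll_trans)
  then obtain e where e: "\<And>s. inj_on (e s) (cls s ` Z s)" "\<And>s. e s ` cls s ` Z s \<subseteq> Y s"
    unfolding lepoll_def by metis
  have cls: "cls s (i, x) = cls s (j, y) \<longleftrightarrow> merge s i x j y"
    if "i \<in> Ob J" "j \<in> Ob J" "x \<in> car (M i) s" "y \<in> car (M j) s" for s i x j y
  proof
    assume "cls s (i, x) = cls s (j, y)"
    moreover have "(j, y) \<in> cls s (j, y)" using that merge_refl by (simp add: cls_def Z_def)
    ultimately have "(j, y) \<in> cls s (i, x)" by simp
    then show "merge s i x j y" by (simp add: cls_def)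
  next
    assume m: "merge s i x j y"
    show "cls s (i, x) = cls s (j, y)"
      unfolding cls_def
    proof (rule Collect_cong, rule conj_cong[OF refl])
      fix z assume "z \<in> Z s"
      then have z: "fst z \<in> Ob J" "snd z \<in> car (M (fst z)) s" by (auto simp: Z_def)
      show "merge s (fst (i, x)) (snd (i, x)) (fst z) (snd z) =
          merge s (fst (j, y)) (snd (j, y)) (fst z) (snd z)"
        using merge_trans[OF that(1,2) z(1) that(3,4) z(2) m]
          merge_trans[OF that(2,1) z(1) that(4,3) z(2) merge_sym[OF m]] by auto
    qed
  qed
  show thesis
  proof (rule that[of "\<lambda>i s x. e s (cls s (i, x))"])
    show "e s (cls s (i, x)) \<in> Y s" if "i \<in> Ob J" "x \<in> car (M i) s" for s i x
      using e(2)[of s] that by (auto simp: Z_def)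
    show "e s (cls s (i, x)) = e s (cls s (j, y)) \<longleftrightarrow> merge s i x j y"
      if "i \<in> Ob J" "j \<in> Ob J" "x \<in> car (M i) s" "y \<in> car (M j) s" for s i x j y
      using inj_on_eq_iff[OF e(1)[of s], of "cls s (i, x)" "cls s (j, y)"] cls[OF that] that
      by (auto simp: Z_def)
  qed
qed

end

text \<open>The maps \<open>c i\<close> stand for a chosen coding of the quotient. The construction
  uses only which elements receive the same code, so the choice of codes, and hence smallness, is
  settled separately.\<close>

locale filtered_colimit = filtered_diagram \<Sigma> J M h
  for \<Sigma> :: "('s, 'f, 'r) hsig" and J :: "('j, 'k) category"
    and M :: "'j \<Rightarrow> ('s, 'f, 'r, 'a) pstruct" and h :: "'j \<Rightarrow> 'j \<Rightarrow> 'k \<Rightarrow> 's \<Rightarrow> 'a \<Rightarrow> 'a" +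
  fixes c :: "'j \<Rightarrow> 's \<Rightarrow> 'a \<Rightarrow> 'b"
  assumes c_eq_iff: "i \<in> Ob J \<Longrightarrow> j \<in> Ob J \<Longrightarrow> x \<in> car (M i) s \<Longrightarrow> y \<in> car (M j) s \<Longrightarrow>
      c i s x = c j s y \<longleftrightarrow> merge s i x j y"
begin

lemma c_h:
  assumes i: "i \<in> Ob J" and j: "j \<in> Ob J" and f: "f \<in> Hom J i j" and x: "x \<in> car (M i) s"
  shows "c j s (h i j f s x) = c i s x"
proof -
  \<comment> \<open>Stage \<open>j\<close> itself witnesses the merge: the identity on one side and
    \<open>f\<close> on the other, compared through functoriality of \<open>h\<close> and the
    identity law in \<open>J\<close>.\<close>
  have "Id J j \<in> Hom J j j" "Comp J i j j (Id J j) f = f"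
    using cat i j f unfolding is_category_def by blast+
  then have "merge s j (h i j f s x) i x"
    using h_Comp[OF i j j f _ x, of "Id J j"] j f unfolding merge_def by metis
  then show ?thesis using c_eq_iff[OF j i h_car[OF i j f x] x] by blast
qed

lemma map2_c_h:
  assumes i: "i \<in> Ob J" and j: "j \<in> Ob J" and f: "f \<in> Hom J i j" and xs: "xs \<in> tuples (M i) ss"
  shows "map2 (c j) ss (map2 (h i j f) ss xs) = map2 (c i) ss xs"
  unfolding map2_map2_tuples[OF xs] by (rule map2_cong_tuples[OF xs]) (rule c_h[OF i j f])

lemma vmap_c_h:
  assumes i: "i \<in> Ob J" and j: "j \<in> Ob J" and f: "f \<in> Hom J i j" and \<rho>: "\<rho> \<in> vals (M i) xs"
  shows "vmap (c j) (vmap (h i j f) \<rho>) = vmap (c i) \<rho>"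
  unfolding vmap_vmap by (rule vmap_cong[OF \<rho>]) (rule c_h[OF i j f])

text \<open>Each of the finitely many coordinates becomes equal along some arrow out of
  \<open>i\<close>; spans are completed one coordinate at a time to obtain a common arrow. This is
  where finitary arities matter.\<close>

lemma map2_c_eq_same:
  assumes i: "i \<in> Ob J"
  shows "xs \<in> tuples (M i) ss \<Longrightarrow> ys \<in> tuples (M i) ss \<Longrightarrow> map2 (c i) ss xs = map2 (c i) ss ys \<Longrightarrow>
    \<exists>k\<in>Ob J. \<exists>f\<in>Hom J i k. map2 (h i k f) ss xs = map2 (h i k f) ss ys"
proof (induction ss arbitrary: xs ys)
  case Nil
  have "Id J i \<in> Hom J i i" by (rule Id_Hom[OF i])
  then show ?case using i by (intro bexI[of _ i] bexI[of _ "Id J i"]) auto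
next
  case (Cons s ss)
  obtain x xs' where x: "xs = x # xs'" "x \<in> car (M i) s" "xs' \<in> tuples (M i) ss"
    using Cons.prems(1) by (auto simp: mem_tuples list_all2_Cons2)
  obtain y ys' where y: "ys = y # ys'" "y \<in> car (M i) s" "ys' \<in> tuples (M i) ss"
    using Cons.prems(2) by (auto simp: mem_tuples list_all2_Cons2)
  have eq: "c i s x = c i s y" "map2 (c i) ss xs' = map2 (c i) ss ys'" using Cons.prems(3) x(1) y(1) by auto
  obtain k f where k: "k \<in> Ob J" "f \<in> Hom J i k" "map2 (h i k f) ss xs' = map2 (h i k f) ss ys'"
    using Cons.IH[OF x(3) y(3) eq(2)] by blast
  have "merge s i x i y" using c_eq_iff[OF i i x(2) y(2)] eq(1) by blast
  then obtain j g where j: "j \<in> Ob J" "g \<in> Hom J i j" "h i j g s x = h i j g s y"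
    using merge_same[OF i x(2) y(2)] by blast
  obtain l p q where l: "l \<in> Ob J" "p \<in> Hom J k l" "q \<in> Hom J j l" "Comp J i k l p f = Comp J i j l q g"
    using complete_span[OF i k(1) j(1) k(2) j(2)] .
  let ?r = "Comp J i k l p f"
  have "map2 (h i l ?r) ss xs' = map2 (h i l ?r) ss ys'"
    using map2_h_Comp[OF i k(1) l(1) k(2) l(2) x(3)] map2_h_Comp[OF i k(1) l(1) k(2) l(2) y(3)] k(3) by argo
  moreover have "h i l ?r s x = h i l ?r s y"
    using h_Comp[OF i j(1) l(1) j(2) l(3) x(2)] h_Comp[OF i j(1) l(1) j(2) l(3) y(2)] j(3) l(4) by simp
  ultimately show ?case using l(1) Comp_Hom[OF i k(1) l(1) k(2) l(2)] x(1) y(1) by auto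
qed

lemma map2_c_eq:
  assumes i: "i \<in> Ob J" and j: "j \<in> Ob J" and xs: "xs \<in> tuples (M i) ss" and ys: "ys \<in> tuples (M j) ss"
    and eq: "map2 (c i) ss xs = map2 (c j) ss ys"
  obtains k f g where "k \<in> Ob J" "f \<in> Hom J i k" "g \<in> Hom J j k" "map2 (h i k f) ss xs = map2 (h j k g) ss ys"
proof -
  obtain m f g where m: "m \<in> Ob J" and f: "f \<in> Hom J i m" and g: "g \<in> Hom J j m"
    using upper_bound[OF i j] .
  have "map2 (c m) ss (map2 (h i m f) ss xs) = map2 (c m) ss (map2 (h j m g) ss ys)"
    using map2_c_h[OF i m f xs] map2_c_h[OF j m g ys] eq by argo
  then obtain k a where k: "k \<in> Ob J" "a \<in> Hom J m k"
    "map2 (h m k a) ss (map2 (h i m f) ss xs) = map2 (h m k a) ss (map2 (h j m g) ss ys)"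
    using map2_c_eq_same[OF m map2_h_tuples[OF i m f xs] map2_h_tuples[OF j m g ys]] by blast
  have "map2 (h i k (Comp J i m k a f)) ss xs = map2 (h j k (Comp J j m k a g)) ss ys"
    using map2_h_Comp[OF i m k(1) f k(2) xs] map2_h_Comp[OF j m k(1) g k(2) ys] k(3) by argo
  then show thesis using that k(1) Comp_Hom[OF i m k(1) f k(2)] Comp_Hom[OF j m k(1) g k(2)] by blast
qed

definition graph :: "'f \<Rightarrow> 'b list \<Rightarrow> 'b \<Rightarrow> bool" where
  "graph f as b \<longleftrightarrow> (\<exists>i\<in>Ob J. \<exists>xs y. opn (M i) f xs = Some y \<and>
     as = map2 (c i) (fdom \<Sigma> f) xs \<and> b = c i (fcod \<Sigma> f) y)"

text \<open>An operation is defined as soon as some stage defines it at representatives. The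
  description operator is justified by \<open>graph_functional\<close>: two stages can be compared
  at a later one, where homomorphisms force the results to agree.\<close>

definition L :: "('s, 'f, 'r, 'b) pstruct" where
  "L = \<lparr> car = (\<lambda>s. \<Union>i\<in>Ob J. c i s ` car (M i) s),
     opn = (\<lambda>f as. if \<exists>b. graph f as b then Some (THE b. graph f as b) else None),
     rel = (\<lambda>R. {map2 (c i) (rdom \<Sigma> R) xs | i xs. i \<in> Ob J \<and> xs \<in> rel (M i) R}) \<rparr>"

lemma opnD:
  "i \<in> Ob J \<Longrightarrow> opn (M i) f xs = Some y \<Longrightarrow> f \<in> Funs \<Sigma> \<and> xs \<in> tuples (M i) (fdom \<Sigma> f) \<and> y \<in> car (M i) (fcod \<Sigma> f)"
  using partial_structure_opn[OF struct] .

lemma graph_functional: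
  assumes "graph f as b" "graph f as b'"
  shows "b = b'"
proof -
  obtain i xs y where 1: "i \<in> Ob J" "opn (M i) f xs = Some y" "as = map2 (c i) (fdom \<Sigma> f) xs" "b = c i (fcod \<Sigma> f) y"
    using assms(1) unfolding graph_def by blast
  obtain j xs' y' where 2: "j \<in> Ob J" "opn (M j) f xs' = Some y'" "as = map2 (c j) (fdom \<Sigma> f) xs'" "b' = c j (fcod \<Sigma> f) y'"
    using assms(2) unfolding graph_def by blast
  note D1 = opnD[OF 1(1,2)] and D2 = opnD[OF 2(1,2)]
  obtain k p q where k: "k \<in> Ob J" "p \<in> Hom J i k" "q \<in> Hom J j k"
    "map2 (h i k p) (fdom \<Sigma> f) xs = map2 (h j k q) (fdom \<Sigma> f) xs'"
    using map2_c_eq[OF 1(1) 2(1), of xs "fdom \<Sigma> f" xs'] D1 D2 1(3) 2(3) by metis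
  have "opn (M k) f (map2 (h i k p) (fdom \<Sigma> f) xs) = Some (h i k p (fcod \<Sigma> f) y)"
    using hhom_opn[OF hom[OF 1(1) k(1,2)]] D1 1(2) by blast
  moreover have "opn (M k) f (map2 (h j k q) (fdom \<Sigma> f) xs') = Some (h j k q (fcod \<Sigma> f) y')"
    using hhom_opn[OF hom[OF 2(1) k(1,3)]] D2 2(2) by blast
  ultimately have "h i k p (fcod \<Sigma> f) y = h j k q (fcod \<Sigma> f) y'" using k(4) by simp
  then show ?thesis
    using c_h[OF 1(1) k(1,2), of y "fcod \<Sigma> f"] c_h[OF 2(1) k(1,3), of y' "fcod \<Sigma> f"] D1 D2 1(4) 2(4) by simp
qed

lemma car_L: "car L s = (\<Union>i\<in>Ob J. c i s ` car (M i) s)"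
  by (simp add: L_def)

lemma opn_L: "opn L f as = Some b \<longleftrightarrow> graph f as b"
proof -
  have "(THE b. graph f as b) = b" if "graph f as b" for b
    using that graph_functional[OF _ that] by (rule the_equality)
  then show ?thesis unfolding L_def by auto
qed

lemma rel_L: "as \<in> rel L R \<longleftrightarrow> (\<exists>i\<in>Ob J. \<exists>xs\<in>rel (M i) R. as = map2 (c i) (rdom \<Sigma> R) xs)"
  by (auto simp: L_def)

lemma c_car: "i \<in> Ob J \<Longrightarrow> x \<in> car (M i) s \<Longrightarrow> c i s x \<in> car L s"
  by (auto simp: car_L)

lemma map2_c_tuples: "i \<in> Ob J \<Longrightarrow> xs \<in> tuples (M i) ss \<Longrightarrow> map2 (c i) ss xs \<in> tuples L ss"
  by (erule map2_tuples) (rule c_car)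

lemma struct_L: "partial_structure \<Sigma> L"
  unfolding partial_structure_def
proof (intro conjI ballI allI impI subsetI)
  fix f as assume "as \<in> dom (opn L f)"
  then obtain b where "opn L f as = Some b" by blast
  then obtain i xs y where "i \<in> Ob J" "opn (M i) f xs = Some y" "as = map2 (c i) (fdom \<Sigma> f) xs"
    unfolding opn_L graph_def by blast
  then show "as \<in> tuples L (fdom \<Sigma> f)" using opnD map2_c_tuples by metis
next
  fix f b assume "b \<in> ran (opn L f)"
  then show "b \<in> car L (fcod \<Sigma> f)"
    unfolding ran_def opn_L graph_def using opnD c_car by blast
next
  fix R as assume "as \<in> rel L R"
  then show "as \<in> tuples L (rdom \<Sigma> R)"
    unfolding rel_L using partial_structure_rel[OF struct] map2_c_tuples by metis
next
  show "car L s = {}" if "s \<notin> Sorts \<Sigma>" for s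
    using that partial_structure_car[OF struct] unfolding car_L by blast
  show "rel L R = {}" if "R \<notin> Rels \<Sigma>" for R
    using that partial_structure_rel[OF struct] rel_L[of _ R] by blast
  show "opn L f = Map.empty" if "f \<notin> Funs \<Sigma>" for f
  proof
    show "opn L f as = None" for as
      using that opnD opn_L[of f as] unfolding graph_def by (metis not_Some_eq)
  qed
qed

lemma hom_c:
  assumes i: "i \<in> Ob J"
  shows "hhom \<Sigma> (M i) L (c i)"
  unfolding hhom_def opn_L rel_L graph_def using i c_car by blast

lemma tuples_L:
  "as \<in> tuples L ss \<Longrightarrow> \<exists>i\<in>Ob J. \<exists>xs\<in>tuples (M i) ss. as = map2 (c i) ss xs"
proof (induction ss arbitrary: as)
  case Nil
  \<comment> \<open>The empty tuple also has to come from some stage, which is the nonemptiness part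
    of filteredness.\<close>
  obtain i where "i \<in> Ob J" using filt by (auto simp: filtered_def)
  then show ?case using Nil by (auto simp: mem_tuples)
next
  case (Cons s ss)
  obtain a as' where a: "as = a # as'" "a \<in> car L s" "as' \<in> tuples L ss"
    using Cons.prems by (auto simp: mem_tuples list_all2_Cons2)
  obtain i xs where i: "i \<in> Ob J" "xs \<in> tuples (M i) ss" "as' = map2 (c i) ss xs" using Cons.IH[OF a(3)] by blast
  obtain j x where j: "j \<in> Ob J" "x \<in> car (M j) s" "a = c j s x" using a(2) unfolding car_L by blast
  obtain k f g where k: "k \<in> Ob J" and f: "f \<in> Hom J i k" and g: "g \<in> Hom J j k"
    using upper_bound[OF i(1) j(1)] .
  have "h j k g s x # map2 (h i k f) ss xs \<in> tuples (M k) (s # ss)"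
    using map2_h_tuples[OF i(1) k f i(2)] h_car[OF j(1) k g j(2)] by (simp add: mem_tuples)
  moreover have "as = map2 (c k) (s # ss) (h j k g s x # map2 (h i k f) ss xs)"
    using a(1) i(3) j(3) map2_c_h[OF i(1) k f i(2)] c_h[OF j(1) k g j(2)] by simp
  ultimately show ?case using k by blast
qed

text \<open>Definedness in \<open>L\<close> is witnessed at some stage by other representatives of
  the same tuple; at a later stage these become equal to the given ones.\<close>

lemma opn_reflect:
  assumes i: "i \<in> Ob J" and xs: "xs \<in> tuples (M i) (fdom \<Sigma> f)"
    and opn: "opn L f (map2 (c i) (fdom \<Sigma> f) xs) = Some b"
  obtains k g y where "k \<in> Ob J" "g \<in> Hom J i k"
    "opn (M k) f (map2 (h i k g) (fdom \<Sigma> f) xs) = Some y" "c k (fcod \<Sigma> f) y = b"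
proof -
  obtain j ys y where j: "j \<in> Ob J" "opn (M j) f ys = Some y"
    "map2 (c i) (fdom \<Sigma> f) xs = map2 (c j) (fdom \<Sigma> f) ys" "b = c j (fcod \<Sigma> f) y"
    using opn unfolding opn_L graph_def by blast
  note D = opnD[OF j(1,2)]
  obtain k p q where k: "k \<in> Ob J" "p \<in> Hom J i k" "q \<in> Hom J j k"
    "map2 (h i k p) (fdom \<Sigma> f) xs = map2 (h j k q) (fdom \<Sigma> f) ys"
    using map2_c_eq[OF i j(1) xs _ j(3)] D by blast
  have "opn (M k) f (map2 (h j k q) (fdom \<Sigma> f) ys) = Some (h j k q (fcod \<Sigma> f) y)"
    using hhom_opn[OF hom[OF j(1) k(1,3)]] D j(2) by blast
  then show thesis using that[OF k(1,2)] k(4) c_h[OF j(1) k(1,3)] D j(4) by metis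
qed

lemma rel_reflect:
  assumes i: "i \<in> Ob J" and xs: "xs \<in> tuples (M i) (rdom \<Sigma> R)"
    and rel: "map2 (c i) (rdom \<Sigma> R) xs \<in> rel L R"
  obtains k g where "k \<in> Ob J" "g \<in> Hom J i k" "map2 (h i k g) (rdom \<Sigma> R) xs \<in> rel (M k) R"
proof -
  obtain j ys where j: "j \<in> Ob J" "ys \<in> rel (M j) R" "map2 (c i) (rdom \<Sigma> R) xs = map2 (c j) (rdom \<Sigma> R) ys"
    using rel unfolding rel_L by blast
  note D = partial_structure_rel[OF struct[OF j(1)] j(2)]
  obtain k p q where k: "k \<in> Ob J" "p \<in> Hom J i k" "q \<in> Hom J j k"
    "map2 (h i k p) (rdom \<Sigma> R) xs = map2 (h j k q) (rdom \<Sigma> R) ys"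
    using map2_c_eq[OF i j(1) xs _ j(3)] D by blast
  have "map2 (h j k q) (rdom \<Sigma> R) ys \<in> rel (M k) R"
    using hhom_rel[OF hom[OF j(1) k(1,3)]] D j(2) by blast
  then show thesis using that[OF k(1,2)] k(4) by simp
qed

lemma tm_val_push:
  assumes i: "i \<in> Ob J" and k: "k \<in> Ob J" "f \<in> Hom J i k" and l: "l \<in> Ob J" "p \<in> Hom J k l"
    and \<rho>: "\<rho> \<in> vals (M i) xs" and t: "has_sort \<Sigma> xs t s" and y: "tm_val (M k) (vmap (h i k f) \<rho>) t = Some y"
  shows "tm_val (M l) (vmap (h i l (Comp J i k l p f)) \<rho>) t = Some (h k l p s y)"
    "y \<in> car (M k) s" "c l s (h k l p s y) = c k s y"
proof -
  note \<rho>' = vmap_h_vals[OF i k \<rho>]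
  show "tm_val (M l) (vmap (h i l (Comp J i k l p f)) \<rho>) t = Some (h k l p s y)"
    unfolding vmap_h_Comp[OF i k(1) l(1) k(2) l(2) \<rho>] by (rule hhom_tm_val[OF hom[OF k(1) l] \<rho>' t y])
  show "y \<in> car (M k) s" by (rule tm_val_car[OF struct[OF k(1)] \<rho>' t y])
  then show "c l s (h k l p s y) = c k s y" by (rule c_h[OF k(1) l])
qed

lemma tm_vals_push:
  assumes i: "i \<in> Ob J" and k: "k \<in> Ob J" "f \<in> Hom J i k" and l: "l \<in> Ob J" "p \<in> Hom J k l"
    and \<rho>: "\<rho> \<in> vals (M i) xs" and ts: "list_all2 (has_sort \<Sigma> xs) ts ss"
    and ys: "tm_vals (M k) (vmap (h i k f) \<rho>) ts ys"
  shows "tm_vals (M l) (vmap (h i l (Comp J i k l p f)) \<rho>) ts (map2 (h k l p) ss ys)"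
  unfolding vmap_h_Comp[OF i k(1) l(1) k(2) l(2) \<rho>]
  by (rule hhom_tm_vals[OF hom[OF k(1) l] vmap_h_vals[OF i k \<rho>] ts ys])

text \<open>Reflection of one term, packaged as a predicate of the term and its sort so that it can
  stand beside \<open>has_sort\<close> in the \<open>list_all2\<close> hypothesis that rule
  induction provides for arguments.\<close>

definition reflects :: "'j \<Rightarrow> ('s var \<rightharpoonup> 'a) \<Rightarrow> ('s, 'f) tm \<Rightarrow> 's \<Rightarrow> bool" where
  "reflects i \<rho> t s \<longleftrightarrow> (\<forall>b. tm_val L (vmap (c i) \<rho>) t = Some b \<longrightarrow>
     (\<exists>k\<in>Ob J. \<exists>f\<in>Hom J i k. \<exists>y. tm_val (M k) (vmap (h i k f) \<rho>) t = Some y \<and> c k s y = b))"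

text \<open>Different arguments become defined at different stages. Completing the span out of
  \<open>i\<close> to a commuting square ensures that both families of values are computed along the
  same arrow from \<open>i\<close>.\<close>

lemma tm_vals_reflect:
  assumes i: "i \<in> Ob J" and \<rho>: "\<rho> \<in> vals (M i) xs"
  shows "list_all2 (\<lambda>t s. has_sort \<Sigma> xs t s \<and> reflects i \<rho> t s) ts ss \<Longrightarrow>
    tm_vals L (vmap (c i) \<rho>) ts bs \<Longrightarrow>
    \<exists>k\<in>Ob J. \<exists>f\<in>Hom J i k. \<exists>ys. tm_vals (M k) (vmap (h i k f) \<rho>) ts ys \<and>
      ys \<in> tuples (M k) ss \<and> map2 (c k) ss ys = bs"
proof (induction arbitrary: bs rule: list_all2_induct)
  case Nil
  have "Id J i \<in> Hom J i i" by (rule Id_Hom[OF i])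
  then show ?case using i Nil by (intro bexI[of _ i] bexI[of _ "Id J i"]) (auto simp: mem_tuples)
next
  case (Cons t ts s ss)
  obtain b bs' where bs: "bs = b # bs'" "tm_val L (vmap (c i) \<rho>) t = Some b"
    "tm_vals L (vmap (c i) \<rho>) ts bs'"
    using Cons.prems by (auto simp: list_all2_Cons1)
  obtain k f ys where k: "k \<in> Ob J" "f \<in> Hom J i k" 
    "tm_vals (M k) (vmap (h i k f) \<rho>) ts ys" "ys \<in> tuples (M k) ss" "map2 (c k) ss ys = bs'"
    using Cons.IH[OF bs(3)] by blast
  have t: "has_sort \<Sigma> xs t s" "reflects i \<rho> t s" using Cons.hyps(1) by auto
  obtain j g y where j: "j \<in> Ob J" "g \<in> Hom J i j" "tm_val (M j) (vmap (h i j g) \<rho>) t = Some y" "c j s y = b"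
    using t(2) bs(2) unfolding reflects_def by blast
  obtain l p q where l: "l \<in> Ob J" "p \<in> Hom J k l" "q \<in> Hom J j l" "Comp J i k l p f = Comp J i j l q g"
    using complete_span[OF i k(1) j(1) k(2) j(2)] .
  let ?r = "Comp J i k l p f"
  note push = tm_val_push[OF i j(1,2) l(1,3) \<rho> t(1) j(3)]
  have ts: "list_all2 (has_sort \<Sigma> xs) ts ss"
    using Cons.hyps(2) by (rule list_all2_mono) simp
  have "tm_vals (M l) (vmap (h i l ?r) \<rho>) ts (map2 (h k l p) ss ys)"
    by (rule tm_vals_push[OF i k(1,2) l(1,2) \<rho> ts k(3)])
  then have "tm_vals (M l) (vmap (h i l ?r) \<rho>) (t # ts)
      (h j l q s y # map2 (h k l p) ss ys)"
    using push(1) l(4) by simp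
  moreover have "h j l q s y # map2 (h k l p) ss ys \<in> tuples (M l) (s # ss)"
    using map2_h_tuples[OF k(1) l(1,2) k(4)] h_car[OF j(1) l(1,3) push(2)] by (simp add: mem_tuples)
  moreover have "map2 (c l) (s # ss) (h j l q s y # map2 (h k l p) ss ys) = bs"
    using map2_c_h[OF k(1) l(1,2) k(4)] push(3) bs(1) j(4) k(5) by simp
  ultimately show ?case using l(1) Comp_Hom[OF i k(1) l(1) k(2) l(2)] by blast
qed

lemma tm_val_reflect:
  assumes i: "i \<in> Ob J" and \<rho>: "\<rho> \<in> vals (M i) xs"
  shows "has_sort \<Sigma> xs t s \<Longrightarrow> reflects i \<rho> t s"
proof (induction rule: has_sort.induct)
  case (1 x)
  have "Id J i \<in> Hom J i i" by (rule Id_Hom[OF i])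
  moreover obtain a where a: "\<rho> x = Some a" "a \<in> car (M i) (fst x)" using valsD[OF \<rho> 1] by blast
  ultimately show ?case
    using i c_h[OF i i _ a(2)] unfolding reflects_def
    by (intro allI impI bexI[of _ i] bexI[of _ "Id J i"]) (auto simp: vmap_def)
next
  case (2 f ts)
  show ?case unfolding reflects_def
  proof (intro allI impI)
    fix b assume "tm_val L (vmap (c i) \<rho>) (Fn f ts) = Some b"
    then obtain bs where bs: "tm_vals L (vmap (c i) \<rho>) ts bs" "opn L f bs = Some b"
      unfolding tm_val_Fn_eq_Some by blast
    have ts: "list_all2 (has_sort \<Sigma> xs) ts (fdom \<Sigma> f)"
      using 2(2) by (rule list_all2_mono) simp
    obtain k g ys where k: "k \<in> Ob J" "g \<in> Hom J i k" "tm_vals (M k) (vmap (h i k g) \<rho>) ts ys"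
      "ys \<in> tuples (M k) (fdom \<Sigma> f)" "map2 (c k) (fdom \<Sigma> f) ys = bs"
      using tm_vals_reflect[OF i \<rho> 2(2) bs(1)] by blast
    obtain l p y where l: "l \<in> Ob J" "p \<in> Hom J k l" "opn (M l) f (map2 (h k l p) (fdom \<Sigma> f) ys) = Some y"
      "c l (fcod \<Sigma> f) y = b"
      using opn_reflect[OF k(1,4)] bs(2) unfolding k(5) by blast
    have "tm_vals (M l) (vmap (h i l (Comp J i k l p g)) \<rho>) ts (map2 (h k l p) (fdom \<Sigma> f) ys)"
      by (rule tm_vals_push[OF i k(1,2) l(1,2) \<rho> ts k(3)])
    then have "tm_val (M l) (vmap (h i l (Comp J i k l p g)) \<rho>) (Fn f ts) = Some y"
      using l(3) unfolding tm_val_Fn_eq_Some by blast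
    then show "\<exists>k\<in>Ob J. \<exists>g\<in>Hom J i k. \<exists>y. tm_val (M k) (vmap (h i k g) \<rho>) (Fn f ts) = Some y \<and> c k (fcod \<Sigma> f) y = b"
      using l(1,4) Comp_Hom[OF i k(1) l(1) k(2) l(2)] by blast
  qed
qed

lemma holds_push:
  assumes i: "i \<in> Ob J" and k: "k \<in> Ob J" "f \<in> Hom J i k" and l: "l \<in> Ob J" "p \<in> Hom J k l"
    and \<rho>: "\<rho> \<in> vals (M i) xs" and "wf_horn \<Sigma> xs \<phi>" "holds (M k) (vmap (h i k f) \<rho>) \<phi>"
  shows "holds (M l) (vmap (h i l (Comp J i k l p f)) \<rho>) \<phi>"
  unfolding vmap_h_Comp[OF i k(1) l(1) k(2) l(2) \<rho>]
  by (rule hhom_holds[OF hom[OF k(1) l] vmap_h_vals[OF i k \<rho>] assms(7,8)])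

lemma holds_reflect:
  assumes i: "i \<in> Ob J" and \<rho>: "\<rho> \<in> vals (M i) xs"
  shows "wf_horn \<Sigma> xs \<phi> \<Longrightarrow> holds L (vmap (c i) \<rho>) \<phi> \<Longrightarrow>
    \<exists>k\<in>Ob J. \<exists>f\<in>Hom J i k. holds (M k) (vmap (h i k f) \<rho>) \<phi>"
proof (induction \<phi>)
  case (HRel R ts)
  then have ts: "list_all2 (has_sort \<Sigma> xs) ts (rdom \<Sigma> R)" by simp
  then have ts': "list_all2 (\<lambda>t s. has_sort \<Sigma> xs t s \<and> reflects i \<rho> t s) ts (rdom \<Sigma> R)"
    by (rule list_all2_mono) (simp add: tm_val_reflect[OF i \<rho>])
  obtain bs where bs: "tm_vals L (vmap (c i) \<rho>) ts bs" "bs \<in> rel L R"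
    using HRel(2) unfolding holds_HRel_iff by blast
  obtain k g ys where k: "k \<in> Ob J" "g \<in> Hom J i k" "tm_vals (M k) (vmap (h i k g) \<rho>) ts ys"
    "ys \<in> tuples (M k) (rdom \<Sigma> R)" "map2 (c k) (rdom \<Sigma> R) ys = bs"
    using tm_vals_reflect[OF i \<rho> ts' bs(1)] by blast
  obtain l p where l: "l \<in> Ob J" "p \<in> Hom J k l" "map2 (h k l p) (rdom \<Sigma> R) ys \<in> rel (M l) R"
    using rel_reflect[OF k(1,4)] bs(2) unfolding k(5) by blast
  have "tm_vals (M l) (vmap (h i l (Comp J i k l p g)) \<rho>) ts (map2 (h k l p) (rdom \<Sigma> R) ys)"
    by (rule tm_vals_push[OF i k(1,2) l(1,2) \<rho> ts k(3)])
  then have "holds (M l) (vmap (h i l (Comp J i k l p g)) \<rho>) (HRel R ts)"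
    using l(3) unfolding holds_HRel_iff by blast
  then show ?case using l(1) Comp_Hom[OF i k(1) l(1) k(2) l(2)] by blast
next
  case (HEq t u)
  then obtain s where s: "has_sort \<Sigma> xs t s" "has_sort \<Sigma> xs u s" by auto
  obtain b where b: "tm_val L (vmap (c i) \<rho>) t = Some b" "tm_val L (vmap (c i) \<rho>) u = Some b"
    using HEq(2) by auto
  obtain k f y where k: "k \<in> Ob J" "f \<in> Hom J i k" "tm_val (M k) (vmap (h i k f) \<rho>) t = Some y" "c k s y = b"
    using tm_val_reflect[OF i \<rho> s(1)] b(1) unfolding reflects_def by blast
  obtain j g z where j: "j \<in> Ob J" "g \<in> Hom J i j" "tm_val (M j) (vmap (h i j g) \<rho>) u = Some z" "c j s z = b"
    using tm_val_reflect[OF i \<rho> s(2)] b(2) unfolding reflects_def by blast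
  obtain l p q where l: "l \<in> Ob J" "p \<in> Hom J k l" "q \<in> Hom J j l" "Comp J i k l p f = Comp J i j l q g"
    using complete_span[OF i k(1) j(1) k(2) j(2)] .
  let ?r = "Comp J i k l p f"
  have r: "?r \<in> Hom J i l" by (rule Comp_Hom[OF i k(1) l(1) k(2) l(2)])
  note kpush = tm_val_push[OF i k(1,2) l(1,2) \<rho> s(1) k(3)]
    and jpush = tm_val_push[OF i j(1,2) l(1,3) \<rho> s(2) j(3)]
  have yz: "h k l p s y \<in> car (M l) s" "h j l q s z \<in> car (M l) s"
    using h_car[OF k(1) l(1,2) kpush(2)] h_car[OF j(1) l(1,3) jpush(2)] by blast+
  \<comment> \<open>The terms have equal values in the colimit, but at stage \<open>l\<close> their
    values are only merged; one more arrow makes them equal.\<close>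
  have "merge s l (h k l p s y) l (h j l q s z)"
    using c_eq_iff[OF l(1) l(1) yz] kpush(3) jpush(3) k(4) j(4) by simp
  then obtain m a where m: "m \<in> Ob J" "a \<in> Hom J l m" "h l m a s (h k l p s y) = h l m a s (h j l q s z)"
    using merge_same[OF l(1) yz] by blast
  have "holds (M m) (vmap (h i m (Comp J i l m a ?r)) \<rho>) (HEq t u)"
    using tm_val_push(1)[OF i l(1) r m(1,2) \<rho> s(1) kpush(1)]
      tm_val_push(1)[OF i l(1) r m(1,2) \<rho> s(2), of "h j l q s z"] jpush(1) l(4) m(3) by simp
  then show ?case using m(1) Comp_Hom[OF i l(1) m(1) r m(2)] by blast
next
  case HTrue
  have "Id J i \<in> Hom J i i" by (rule Id_Hom[OF i])
  then show ?case using i by auto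
next
  case (HAnd \<phi> \<psi>)
  then obtain k f j g where k: "k \<in> Ob J" "f \<in> Hom J i k" "holds (M k) (vmap (h i k f) \<rho>) \<phi>"
    and j: "j \<in> Ob J" "g \<in> Hom J i j" "holds (M j) (vmap (h i j g) \<rho>) \<psi>" by auto
  have wf: "wf_horn \<Sigma> xs \<phi>" "wf_horn \<Sigma> xs \<psi>" using HAnd.prems(1) by auto
  obtain l p q where l: "l \<in> Ob J" "p \<in> Hom J k l" "q \<in> Hom J j l" "Comp J i k l p f = Comp J i j l q g"
    using complete_span[OF i k(1) j(1) k(2) j(2)] .
  have "holds (M l) (vmap (h i l (Comp J i k l p f)) \<rho>) (HAnd \<phi> \<psi>)"
    using holds_push[OF i k(1,2) l(1,2) \<rho> wf(1) k(3)] holds_push[OF i j(1,2) l(1,3) \<rho> wf(2) j(3)] l(4) by simp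
  then show ?case using l(1) Comp_Hom[OF i k(1) l(1) k(2) l(2)] by blast
qed

text \<open>A context is finite, so a valuation in \<open>L\<close> comes from one stage. The
  premise holds at a later stage, where the sequent applies, and the conclusion is pushed back to
  \<open>L\<close>.\<close>

lemma valid_L:
  assumes wf: "wf_sequent \<Sigma> \<sigma>" and valid: "\<And>i. i \<in> Ob J \<Longrightarrow> valid_in (M i) \<sigma>"
  shows "valid_in L \<sigma>"
proof -
  obtain xs \<phi> \<psi> where \<sigma>: "\<sigma> = (xs, \<phi>, \<psi>)" by (cases \<sigma>)
  then have d: "distinct xs" and w: "wf_horn \<Sigma> xs \<phi>" "wf_horn \<Sigma> xs \<psi>"
    using wf by (auto simp: wf_ctx_def)
  show ?thesis unfolding \<sigma> valid_in_iff_vals[OF d]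
  proof (intro ballI impI)
    fix \<rho> assume \<rho>: "\<rho> \<in> vals L xs" "holds L \<rho> \<phi>"
    obtain i ns where i: "i \<in> Ob J" and ns: "ns \<in> tuples (M i) (map fst xs)"
      "map (the \<circ> \<rho>) xs = map2 (c i) (map fst xs) ns"
      using tuples_L[OF vals_tuple(1)[OF d \<rho>(1)]] by blast
    define \<rho>' where "\<rho>' = map_of (zip xs ns)"
    have len: "length ns = length xs" using ns(1) by (auto simp: mem_tuples dest: list_all2_lengthD)
    have \<rho>': "\<rho>' \<in> vals (M i) xs" unfolding \<rho>'_def by (rule map_of_zip_vals[OF ns(1)])
    have eq: "\<rho> = vmap (c i) \<rho>'"
      using vals_tuple(2)[OF d \<rho>(1)] map_of_zip_vmap[OF len, of "c i"] ns(2) unfolding \<rho>'_def by argo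
    obtain k f where k: "k \<in> Ob J" "f \<in> Hom J i k" "holds (M k) (vmap (h i k f) \<rho>') \<phi>"
      using holds_reflect[OF i \<rho>' w(1)] \<rho>(2) unfolding eq by blast
    then have "holds (M k) (vmap (h i k f) \<rho>') \<psi>"
      using valid[OF k(1)] vmap_h_vals[OF i k(1,2) \<rho>'] unfolding \<sigma> valid_in_iff_vals[OF d] by blast
    then have "holds L (vmap (c k) (vmap (h i k f) \<rho>')) \<psi>"
      by (rule hhom_holds[OF hom_c[OF k(1)] vmap_h_vals[OF i k(1,2) \<rho>'] w(2)])
    then show "holds L \<rho> \<psi>" unfolding vmap_c_h[OF i k(1,2) \<rho>'] eq .
  qed
qed

lemma universal:
  assumes d: "\<And>i. i \<in> Ob J \<Longrightarrow> hhom \<Sigma> (M i) N (d i)"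
    and cocone: "\<And>i j f s x. i \<in> Ob J \<Longrightarrow> j \<in> Ob J \<Longrightarrow> f \<in> Hom J i j \<Longrightarrow> x \<in> car (M i) s \<Longrightarrow>
      d j s (h i j f s x) = d i s x"
  obtains u where "hhom \<Sigma> L N u" "\<And>i s x. i \<in> Ob J \<Longrightarrow> x \<in> car (M i) s \<Longrightarrow> u s (c i s x) = d i s x"
proof -
  have "\<exists>b. \<forall>i\<in>Ob J. \<forall>x\<in>car (M i) s. a = c i s x \<longrightarrow> b = d i s x" for s a
  proof (cases "\<exists>i\<in>Ob J. \<exists>x\<in>car (M i) s. a = c i s x")
    case True
    then obtain i x where i: "i \<in> Ob J" "x \<in> car (M i) s" "a = c i s x" by blast
    have "d i s x = d j s y" if j: "j \<in> Ob J" "y \<in> car (M j) s" "a = c j s y" for j y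
    proof -
      have "merge s i x j y" using c_eq_iff[OF i(1) j(1) i(2) j(2)] i(3) j(3) by blast
      then obtain k f g where k: "k \<in> Ob J" "f \<in> Hom J i k" "g \<in> Hom J j k" "h i k f s x = h j k g s y"
        unfolding merge_def by blast
      then show ?thesis using cocone[OF i(1) k(1,2) i(2)] cocone[OF j(1) k(1,3) j(2)] by simp
    qed
    then show ?thesis by blast
  qed blast
  then obtain u where u: "\<And>s i x. i \<in> Ob J \<Longrightarrow> x \<in> car (M i) s \<Longrightarrow> u s (c i s x) = d i s x" by metis
  have map2: "map2 u ss (map2 (c i) ss xs) = map2 (d i) ss xs" if "i \<in> Ob J" "xs \<in> tuples (M i) ss" for i xs ss
    unfolding map2_map2_tuples[OF that(2)] by (rule map2_cong_tuples[OF that(2)]) (rule u[OF that(1)])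
  have "hhom \<Sigma> L N u"
    unfolding hhom_def
  proof (intro conjI ballI allI impI)
    show "u s a \<in> car N s" if "a \<in> car L s" for s a
      using that hhom_car[OF d] u unfolding car_L by auto
    show "opn N f (map2 u (fdom \<Sigma> f) as) = Some (u (fcod \<Sigma> f) b)" if f: "f \<in> Funs \<Sigma>" and "opn L f as = Some b" for f as b
    proof -
      obtain i xs y where i: "i \<in> Ob J" "opn (M i) f xs = Some y" "as = map2 (c i) (fdom \<Sigma> f) xs" "b = c i (fcod \<Sigma> f) y"
        using \<open>opn L f as = Some b\<close> unfolding opn_L graph_def by blast
      note D = opnD[OF i(1,2)]
      have "map2 u (fdom \<Sigma> f) as = map2 (d i) (fdom \<Sigma> f) xs" unfolding i(3) using map2[OF i(1)] D by blast
      then show ?thesis using hhom_opn[OF d[OF i(1)] f i(2)] u[OF i(1)] D i(4) by simp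
    qed
    show "map2 u (rdom \<Sigma> R) as \<in> rel N R" if R: "R \<in> Rels \<Sigma>" and "as \<in> rel L R" for R as
    proof -
      obtain i xs where i: "i \<in> Ob J" "xs \<in> rel (M i) R" "as = map2 (c i) (rdom \<Sigma> R) xs"
        using \<open>as \<in> rel L R\<close> unfolding rel_L by blast
      have "map2 u (rdom \<Sigma> R) as = map2 (d i) (rdom \<Sigma> R) xs"
        unfolding i(3) using map2[OF i(1)] partial_structure_rel[OF struct[OF i(1)] i(2)] by blast
      then show ?thesis using hhom_rel[OF d[OF i(1)] R i(2)] by simp
    qed
  qed
  then show thesis using that u by blast
qed

end

section \<open>Uniqueness of colimits up to isomorphism\<close>

lemma colimit_universal:
  "is_colimit J C D L c \<Longrightarrow> is_cocone J C D X d \<Longrightarrow>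
    \<exists>!u. u \<in> Hom C L X \<and> (\<forall>i\<in>Ob J. Comp C (fob D i) L X u (c i) = d i)"
  by (simp add: is_colimit_def)

text \<open>The composite and the identity both factor the colimit cocone through itself, so the
  uniqueness clause equates them.\<close>

lemma colimit_endomorphism:
  assumes C: "is_category C" and D: "\<And>i. i \<in> Ob J \<Longrightarrow> fob D i \<in> Ob C"
    and L: "is_colimit J C D L c" and L': "is_cocone J C D L' c'"
    and u: "u \<in> Hom C L L'" "\<And>i. i \<in> Ob J \<Longrightarrow> Comp C (fob D i) L L' u (c i) = c' i"
    and v: "v \<in> Hom C L' L" "\<And>i. i \<in> Ob J \<Longrightarrow> Comp C (fob D i) L' L v (c' i) = c i"
  shows "Comp C L L' L v u = Id C L"
proof -
  have cocone: "is_cocone J C D L c" using L by (simp add: is_colimit_def)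
  then have ob: "L \<in> Ob C" "L' \<in> Ob C" and c: "\<And>i. i \<in> Ob J \<Longrightarrow> c i \<in> Hom C (fob D i) L"
    using L' unfolding is_cocone_def by blast+
  have "Comp C L L' L v u \<in> Hom C L L" "Id C L \<in> Hom C L L"
    using C ob u(1) v(1) unfolding is_category_def by blast+
  moreover have "Comp C (fob D i) L L (Comp C L L' L v u) (c i) = c i" "Comp C (fob D i) L L (Id C L) (c i) = c i"
    if i: "i \<in> Ob J" for i
  proof -
    have "Comp C (fob D i) L' L v (Comp C (fob D i) L L' u (c i)) = Comp C (fob D i) L L (Comp C L L' L v u) (c i)"
      using C ob D[OF i] c[OF i] u(1) v(1) unfolding is_category_def by blast
    then show "Comp C (fob D i) L L (Comp C L L' L v u) (c i) = c i" using u(2)[OF i] v(2)[OF i] by simp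
    show "Comp C (fob D i) L L (Id C L) (c i) = c i"
      using C ob D[OF i] c[OF i] unfolding is_category_def by blast
  qed
  ultimately show ?thesis using colimit_universal[OF L cocone] by blast
qed

lemma colimit_isomorphic:
  assumes C: "is_category C" and D: "\<And>i. i \<in> Ob J \<Longrightarrow> fob D i \<in> Ob C"
    and L: "is_colimit J C D L c" and L': "is_colimit J C D L' c'"
  shows "isomorphic C L L'"
proof -
  have cocone: "is_cocone J C D L c" "is_cocone J C D L' c'"
    using L L' by (simp_all add: is_colimit_def)
  obtain u where u: "u \<in> Hom C L L'" "\<And>i. i \<in> Ob J \<Longrightarrow> Comp C (fob D i) L L' u (c i) = c' i"
    using colimit_universal[OF L cocone(2)] by blast
  obtain v where v: "v \<in> Hom C L' L" "\<And>i. i \<in> Ob J \<Longrightarrow> Comp C (fob D i) L' L v (c' i) = c i"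
    using colimit_universal[OF L' cocone(1)] by blast
  show ?thesis
    unfolding isomorphic_def
    using colimit_endomorphism[OF C D L cocone(2) u v] colimit_endomorphism[OF C D L' cocone(1) v u] u(1) v(1)
    by blast
qed

section \<open>The category of algebras, its filtered colimits, and the step from definability to
  closure\<close>

context relative_theory
begin

lemma category_C: "is_category C"
  unfolding is_category_def Alg_simps
proof (intro conjI ballI)
  fix A B f assume A: "A \<in> Ob C" and B: "B \<in> Ob C" and f: "f \<in> ahoms A B"
  note stA = Ob_struct[OF A] and stB = Ob_struct[OF B]
  show "comp_hom (as_struct A) f (id_hom (as_struct A)) = f"
    by (rule homs_ext[OF comp_hom_homs[OF stA id_hom_homs[OF stA] f] f]) simp
  show "comp_hom (as_struct A) (id_hom (as_struct B)) f = f"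
    by (rule homs_ext[OF comp_hom_homs[OF stA f id_hom_homs[OF stB]] f])
      (use hhom_car[OF homs_hhom[OF f]] in simp)
next
  fix A B D F f g h
  assume A: "A \<in> Ob C" and B: "B \<in> Ob C" and D: "D \<in> Ob C" and F: "F \<in> Ob C"
    and f: "f \<in> ahoms A B" and g: "g \<in> ahoms B D"
    and h: "h \<in> ahoms D F"
  note st = Ob_struct[OF A] Ob_struct[OF B]
  show "comp_hom (as_struct A) h (comp_hom (as_struct A) g f) =
      comp_hom (as_struct A) (comp_hom (as_struct B) h g) f"
    by (rule homs_ext[OF comp_hom_homs[OF st(1) comp_hom_homs[OF st(1) f g] h]
          comp_hom_homs[OF st(1) f comp_hom_homs[OF st(2) g h]]])
      (use hhom_car[OF homs_hhom[OF f]] in simp)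
qed (use id_hom_homs comp_hom_homs Ob_struct in blast)+

text \<open>The colimit is computed on carriers. It remains an algebra because Horn sequents pass to
  it, and it is small because the disjoint union of small carriers over a small index set injects
  into an infinite small set. Validity is recorded with it since an abstract colimit does not reveal
  its elements.\<close>

lemma filtered_colimit_exists:
  fixes J :: "('u, 'u) category"
  assumes J: "small_category V J" "filtered J" and D: "is_functor J C D"
  obtains L c where "is_colimit J C D L c"
    "\<And>\<sigma>. wf_sequent \<Sigma>' \<sigma> \<Longrightarrow> (\<And>i. i \<in> Ob J \<Longrightarrow> valid_in (as_struct (fob D i)) \<sigma>) \<Longrightarrow> valid_in (as_struct L) \<sigma>"
proof -
  define M where "M i = as_struct (fob D i)" for i
  have DOb: "fob D i \<in> Ob C" if "i \<in> Ob J" for i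
    using D that unfolding is_functor_def by blast
  have cat: "is_category J" using J(1) by (simp add: small_category_def)
  have Dhom: "farr D i j f \<in> homs \<Sigma>' (M i) (M j)" if "i \<in> Ob J" "j \<in> Ob J" "f \<in> Hom J i j" for i j f
    using D that unfolding is_functor_def Alg_simps M_def by blast
  interpret filtered_diagram \<Sigma>' J M "farr D"
  proof
    show "partial_structure \<Sigma>' (M i)" if "i \<in> Ob J" for i
      using Ob_struct[OF DOb[OF that]] by (simp add: M_def)
    show "hhom \<Sigma>' (M i) (M j) (farr D i j f)" if "i \<in> Ob J" "j \<in> Ob J" "f \<in> Hom J i j" for i j f
      by (rule homs_hhom[OF Dhom[OF that]])
    show "farr D i k (Comp J i j k g f) s x = farr D j k g s (farr D i j f s x)"
      if "i \<in> Ob J" "j \<in> Ob J" "k \<in> Ob J" "f \<in> Hom J i j" "g \<in> Hom J j k" "x \<in> car (M i) s" for i j k f g s x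
    proof -
      have "farr D i k (Comp J i j k g f) = comp_hom (M i) (farr D j k g) (farr D i j f)"
        using D that(1-5) unfolding is_functor_def Alg_simps M_def by blast
      then show ?thesis using that(6) by simp
    qed
  qed (use cat J in auto)
  have "\<exists>Y\<in>V. Sigma (Ob J) (\<lambda>i. car (M i) s) \<lesssim> Y" for s
  proof -
    have ObJ: "Ob J \<in> V" using J(1) by (simp add: small_category_def)
    have "(\<Union>i\<in>Ob J. car (M i) s) \<in> V"
      by (rule small_universe_UN[OF V ObJ]) (use DOb in \<open>simp add: M_def Ob_iff\<close>)
    then obtain Y where Y: "Y \<in> V" "infinite Y" "Ob J \<union> (\<Union>i\<in>Ob J. car (M i) s) \<subseteq> Y"
      using small_universe_infinite_superset[OF V small_universe_Un[OF V ObJ]] by metis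
    have "Sigma (Ob J) (\<lambda>i. car (M i) s) \<subseteq> Y \<times> Y" using Y(3) by blast
    then have "Sigma (Ob J) (\<lambda>i. car (M i) s) \<lesssim> Y"
      by (rule subset_lepoll_trans) (use Y(2) in \<open>blast intro: infinite_Times_lepoll\<close>)
    then show ?thesis using Y(1) by blast
  qed
  then obtain Y where Y: "\<And>s. Y s \<in> V" "\<And>s. Sigma (Ob J) (\<lambda>i. car (M i) s) \<lesssim> Y s" by metis
  obtain c where c: "\<And>s i x. i \<in> Ob J \<Longrightarrow> x \<in> car (M i) s \<Longrightarrow> c i s x \<in> Y s"
    "\<And>s i x j y. i \<in> Ob J \<Longrightarrow> j \<in> Ob J \<Longrightarrow> x \<in> car (M i) s \<Longrightarrow> y \<in> car (M j) s \<Longrightarrow>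
      c i s x = c j s y \<longleftrightarrow> merge s i x j y"
    using merge_quotient[OF Y(2)] by metis
  interpret filtered_colimit \<Sigma>' J M "farr D" c
    by unfold_locales (rule c(2))
  have model: "partial_model \<Sigma>' T' (M i)" if "i \<in> Ob J" for i
    using DOb[OF that] by (simp add: Ob_iff M_def)
  have "valid_in L \<sigma>" if "\<sigma> \<in> T'" for \<sigma>
    by (rule valid_L[OF plus_theory_wf[OF horn_theory algebraic_theory that]])
      (use model that in \<open>simp add: partial_model_def\<close>)
  then have "partial_model \<Sigma>' T' L"
    using struct_L by (simp add: partial_model_def)
  moreover have "car L s \<in> V" for s
    by (rule small_universe_lepoll[OF V Y(1) subset_imp_lepoll]) (use c(1) in \<open>auto simp: car_L\<close>)
  ultimately have LOb: "alg_of L \<in> Ob C" by (simp add: Ob_iff)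
  define c' where "c' i = restr_hom (M i) (c i)" for i
  have c': "c' i \<in> homs \<Sigma>' (M i) L" if "i \<in> Ob J" for i
    unfolding c'_def by (rule restr_hom_homs[OF struct[OF that] hom_c[OF that]])
  have "is_colimit J C D (alg_of L) c'"
    unfolding is_colimit_def is_cocone_def Alg_simps as_struct_alg_of M_def[symmetric]
  proof (intro conjI ballI allI impI)
    fix i j f assume i: "i \<in> Ob J" and j: "j \<in> Ob J" and f: "f \<in> Hom J i j"
    show "comp_hom (M i) (c' j) (farr D i j f) = c' i"
    proof (rule homs_ext[OF comp_hom_homs[OF struct[OF i] Dhom[OF i j f] c'[OF j]] c'[OF i]])
      show "comp_hom (M i) (c' j) (farr D i j f) s x = c' i s x" if "x \<in> car (M i) s" for s x
        using that h_car[OF i j f that] c_h[OF i j f that] by (simp add: c'_def)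
    qed
  next
    fix X d
    assume d: "X \<in> Ob C \<and> (\<forall>i\<in>Ob J. d i \<in> homs \<Sigma>' (M i) (as_struct X)) \<and>
        (\<forall>i\<in>Ob J. \<forall>j\<in>Ob J. \<forall>f\<in>Hom J i j. comp_hom (M i) (d j) (farr D i j f) = d i)"
    have dc: "d j s (farr D i j f s x) = d i s x"
      if "i \<in> Ob J" "j \<in> Ob J" "f \<in> Hom J i j" "x \<in> car (M i) s" for i j f s x
      using d that(1-3) comp_hom_apply[OF that(4), of "d j" "farr D i j f"] by metis
    have dh: "hhom \<Sigma>' (M i) (as_struct X) (d i)" if "i \<in> Ob J" for i
      using d that homs_hhom by blast
    obtain u where u: "hhom \<Sigma>' L (as_struct X) u" "\<And>i s x. i \<in> Ob J \<Longrightarrow> x \<in> car (M i) s \<Longrightarrow> u s (c i s x) = d i s x"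
      by (rule universal[of "as_struct X" d, OF dh]) (assumption, erule (3) dc, blast)
    show "\<exists>!u. u \<in> homs \<Sigma>' L (as_struct X) \<and> (\<forall>i\<in>Ob J. comp_hom (M i) u (c' i) = d i)"
    proof (rule ex1I[of _ "restr_hom L u"], intro conjI ballI)
      show "restr_hom L u \<in> homs \<Sigma>' L (as_struct X)" by (rule restr_hom_homs[OF struct_L u(1)])
      fix i assume i: "i \<in> Ob J"
      have di: "d i \<in> homs \<Sigma>' (M i) (as_struct X)" using d i by blast
      show "comp_hom (M i) (restr_hom L u) (c' i) = d i"
        by (rule homs_ext[OF comp_hom_homs[OF struct[OF i] c'[OF i] restr_hom_homs[OF struct_L u(1)]] di])
          (use c_car i u(2) in \<open>simp add: c'_def\<close>)
    next
      fix v assume v: "v \<in> homs \<Sigma>' L (as_struct X) \<and> (\<forall>i\<in>Ob J. comp_hom (M i) v (c' i) = d i)"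
      show "v = restr_hom L u"
      proof (rule homs_ext[OF _ restr_hom_homs[OF struct_L u(1)]])
        show "v \<in> homs \<Sigma>' L (as_struct X)" using v by blast
        fix s a assume a: "a \<in> car L s"
        then obtain i x where i: "i \<in> Ob J" "x \<in> car (M i) s" "a = c i s x" unfolding car_L by blast
        then have "v s a = comp_hom (M i) v (c' i) s x" by (simp add: c'_def)
        also have "\<dots> = d i s x" using v i(1) by simp
        also have "\<dots> = restr_hom L u s a" using u(2) i a by simp
        finally show "v s a = restr_hom L u s a" .
      qed
    qed
  qed (use LOb c' in auto)
  then show thesis
  proof (rule that)
    show "valid_in (as_struct (alg_of L)) \<sigma>"
      if "wf_sequent \<Sigma>' \<sigma>" "\<And>i. i \<in> Ob J \<Longrightarrow> valid_in (as_struct (fob D i)) \<sigma>" for \<sigma>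
      using valid_L[OF that(1)] that(2) by (simp add: M_def)
  qed
qed

lemma definable_imp_closed:
  assumes E': "\<And>\<sigma>. \<sigma> \<in> E' \<Longrightarrow> relative_judgment \<Sigma> \<Omega> \<sigma>" and \<E>: "\<E> = Ob (Alg V \<Sigma> T \<Omega> (E \<union> E'))"
  shows "closed_under_products V C \<E>" "closed_under_closed_subobjects \<Sigma> C \<E>"
    "closed_under_U_retracts C (PMod V \<Sigma> T) forgetful \<E>" "closed_under_filtered_colimits V C \<E>"
proof -
  have mem: "A \<in> \<E> \<longleftrightarrow> A \<in> Ob C \<and> (\<forall>\<sigma>\<in>E'. valid_in (as_struct A) \<sigma>)" for A
    unfolding \<E> by (rule Ob_Un_iff)
  show "closed_under_products V C \<E>"
    unfolding closed_under_products_def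
  proof (intro ballI allI impI, elim conjE)
    fix I :: "'u set" and X P p
    assume X: "\<forall>i\<in>I. X i \<in> \<E>" and P: "is_product C I X P p"
    have XOb: "X i \<in> Ob C" if "i \<in> I" for i using X that mem by blast
    have "valid_in (as_struct P) \<sigma>" if "\<sigma> \<in> E'" for \<sigma>
      by (rule product_valid[OF XOb P E'[OF that]]) (use X that mem in blast)+
    then show "P \<in> \<E>" using product_Ob[OF XOb P] mem by blast
  qed
  show "closed_under_closed_subobjects \<Sigma> C \<E>"
    unfolding closed_under_closed_subobjects_def
  proof (intro ballI impI)
    fix B A m assume B: "B \<in> \<E>" and A: "A \<in> Ob C" and m: "m \<in> Hom C A B"
      and cm: "closed_mono \<Sigma> (fob forgetful A) (fob forgetful B) (farr forgetful A B m)"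
    have m': "m \<in> ahoms A B" using m by (simp add: Alg_simps)
    have cm': "closed_mono \<Sigma> (und A) (und B) m" using cm by (simp add: forgetful_def)
    have BOb: "B \<in> Ob C" using B mem by blast
    have "valid_in (as_struct A) \<sigma>" if "\<sigma> \<in> E'" for \<sigma>
      by (rule closed_mono_valid[OF A BOb m' cm' E'[OF that]]) (use B that mem in blast)
    then show "A \<in> \<E>" using A mem by blast
  qed
  show "closed_under_U_retracts C (PMod V \<Sigma> T) forgetful \<E>"
    unfolding closed_under_U_retracts_def
  proof (intro ballI allI impI)
    fix A B p assume A: "A \<in> \<E>" and B: "B \<in> Ob C" and p: "is_U_retraction C (PMod V \<Sigma> T) forgetful A B p"
    then obtain s where s: "p \<in> ahoms A B" "s \<in> homs \<Sigma> (und B) (und A)"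
      "comp_hom (und B) p s = id_hom (und B)"
      by (auto simp: is_U_retraction_def Alg_simps PMod_def forgetful_def)
    have AOb: "A \<in> Ob C" using A mem by blast
    have "valid_in (as_struct B) \<sigma>" if "\<sigma> \<in> E'" for \<sigma>
      by (rule retraction_valid[OF AOb B s E'[OF that]]) (use A that mem in blast)
    then show "B \<in> \<E>" using B mem by blast
  qed
  show "closed_under_filtered_colimits V C \<E>"
    unfolding closed_under_filtered_colimits_def
  proof (intro allI impI, elim conjE)
    fix J :: "('u, 'u) category" and D L c
    assume J: "small_category V J" "filtered J" and D: "is_functor J C D"
      and D\<E>: "\<forall>i\<in>Ob J. fob D i \<in> \<E>" and L: "is_colimit J C D L c"
    have DOb: "fob D i \<in> Ob C" if "i \<in> Ob J" for i using D\<E> that mem by blast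
    \<comment> \<open>The given colimit \<open>L\<close> is compared with the constructed one, where
      validity is known. The resulting isomorphism is in particular a U-retraction, so
      \<open>retraction_valid\<close> carries the judgments over.\<close>
    obtain L' c' where L': "is_colimit J C D L' c'"
      "\<And>\<sigma>. wf_sequent \<Sigma>' \<sigma> \<Longrightarrow> (\<And>i. i \<in> Ob J \<Longrightarrow> valid_in (as_struct (fob D i)) \<sigma>) \<Longrightarrow> valid_in (as_struct L') \<sigma>"
      using filtered_colimit_exists[OF J D] by blast
    have Ob: "L \<in> Ob C" "L' \<in> Ob C" using L L'(1) by (auto simp: is_colimit_def is_cocone_def)
    obtain f g where fg: "f \<in> homs \<Sigma>' (as_struct L') (as_struct L)" "g \<in> homs \<Sigma>' (as_struct L) (as_struct L')"
      "comp_hom (as_struct L) f g = id_hom (as_struct L)"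
      using colimit_isomorphic[OF category_C DOb L'(1) L] unfolding isomorphic_def Alg_simps by blast
    have g: "g \<in> homs \<Sigma> (und L) (und L')"
      using hhom_und[OF homs_hhom[OF fg(2)]] fg(2) by (simp add: homs_iff)
    have fg': "comp_hom (und L) f g = id_hom (und L)"
      using fg(3) by (simp add: comp_hom_def id_hom_def)
    have "valid_in (as_struct L) \<sigma>" if \<sigma>: "\<sigma> \<in> E'" for \<sigma>
    proof (rule retraction_valid[OF Ob(2,1) fg(1) g fg' E'[OF \<sigma>]])
      have "wf_sequent \<Sigma>' \<sigma>" using E'[OF \<sigma>] by (cases \<sigma>) simp
      then show "valid_in (as_struct L') \<sigma>" by (rule L'(2)) (use D\<E> \<sigma> mem in blast)
    qed
    then show "L \<in> \<E>" using Ob mem by blast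
  qed
qed

end

section \<open>Finite parts of the diagram of a structure\<close>

text \<open>The positive diagram of a \<Sigma>-structure. \<open>Element\<close> atoms assert
  nothing but bring an element into the diagram, so that elements met by no operation or relation
  are named too.\<close>

datatype ('s, 'f, 'r, 'a) atom = Element 's 'a | Equation 'f "'a list" 'a | Relation 'r "'a list"

primrec elems :: "('s, 'f, 'r) hsig \<Rightarrow> ('s, 'f, 'r, 'a) atom \<Rightarrow> ('s \<times> 'a) set" where
  "elems \<Sigma> (Element s a) = {(s, a)}"
| "elems \<Sigma> (Equation f as b) = insert (fcod \<Sigma> f, b) (set (zip (fdom \<Sigma> f) as))"
| "elems \<Sigma> (Relation R as) = set (zip (rdom \<Sigma> R) as)"

primrec sat :: "('s, 'f, 'r) hsig \<Rightarrow> ('s, 'f, 'r, 'b) pstruct \<Rightarrow> ('s \<Rightarrow> 'a \<Rightarrow> 'b) \<Rightarrow> ('s, 'f, 'r, 'a) atom \<Rightarrow> bool" where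
  "sat \<Sigma> M \<nu> (Element s a) \<longleftrightarrow> True"
| "sat \<Sigma> M \<nu> (Equation f as b) \<longleftrightarrow> opn M f (map2 \<nu> (fdom \<Sigma> f) as) = Some (\<nu> (fcod \<Sigma> f) b)"
| "sat \<Sigma> M \<nu> (Relation R as) \<longleftrightarrow> map2 \<nu> (rdom \<Sigma> R) as \<in> rel M R"

definition diagram :: "('s, 'f, 'r, 'a) pstruct \<Rightarrow> ('s, 'f, 'r, 'a) atom set" where
  "diagram M = {Element s a | s a. a \<in> car M s} \<union> {Equation f as b | f as b. opn M f as = Some b} \<union>
     {Relation R as | R as. as \<in> rel M R}"

lemma finite_elems: "finite (elems \<Sigma> x)"
  by (cases x) auto

lemma tuples_zip: "as \<in> tuples M ss \<Longrightarrow> (s, a) \<in> set (zip ss as) \<Longrightarrow> a \<in> car M s"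
  unfolding mem_tuples by (induction rule: list_all2_induct) auto

lemma elems_diagram:
  assumes "partial_structure \<Sigma> M" "x \<in> diagram M" "(s, a) \<in> elems \<Sigma> x"
  shows "a \<in> car M s"
  using assms(2,3) partial_structure_opn[OF assms(1)] partial_structure_rel[OF assms(1)] tuples_zip
  unfolding diagram_def by fastforce

lemma sat_diagram:
  assumes M: "partial_structure \<Sigma> M" and "x \<in> diagram M"
  shows "sat \<Sigma> M (\<lambda>s a. a) x"
proof -
  have "map2 (\<lambda>s a. a) (fdom \<Sigma> f) as = as" if "opn M f as = Some b" for f as b
    using map2_ident_tuples partial_structure_opn[OF M that] by blast
  moreover have "map2 (\<lambda>s a. a) (rdom \<Sigma> R) as = as" if "as \<in> rel M R" for R as
    using map2_ident_tuples partial_structure_rel[OF M that] by blast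
  ultimately show ?thesis using assms(2) unfolding diagram_def by auto
qed

text \<open>Agreement is asked only at the listed entries, because the names given at a finite stage
  are controlled only at the elements occurring in it.\<close>

lemma map2_map2_zip:
  "(\<And>s a. (s, a) \<in> set (zip ss as) \<Longrightarrow> f s (g s a) = k s a) \<Longrightarrow> map2 f ss (map2 g ss as) = map2 k ss as"
proof (induction ss arbitrary: as)
  case (Cons s ss)
  then show ?case by (cases as) auto
qed simp

text \<open>Naming the elements by variables turns a finite part of the diagram into a Horn formula.\<close>

lemma diagram_formula:
  fixes M :: "('s, 'f, 'r, 'a) pstruct"
  assumes M: "partial_structure \<Sigma> M" and p: "finite p" "p \<subseteq> diagram M"
  defines "W \<equiv> \<Union> (elems \<Sigma> ` p)"
  shows "\<exists>xs \<phi> nm. wf_ctx \<Sigma> xs \<and> wf_horn \<Sigma> xs \<phi> \<and> set xs = nm ` W \<and> inj_on nm W \<and>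
    (\<forall>w. fst (nm w) = fst w) \<and>
    (\<forall>(N :: ('s, 'f, 'r, 'b) pstruct) \<rho> \<nu>. (\<forall>(s, a)\<in>W. \<rho> (nm (s, a)) = Some (\<nu> s a)) \<longrightarrow>
       (holds N \<rho> \<phi> \<longleftrightarrow> (\<forall>x\<in>p. sat \<Sigma> N \<nu> x)))"
proof -
  have WM: "a \<in> car M s" if "(s, a) \<in> W" for s a
    using that elems_diagram[OF M] p(2) unfolding W_def by blast
  have "finite W" unfolding W_def using p(1) finite_elems by blast
  then obtain n :: "'s \<times> 'a \<Rightarrow> nat" where n: "inj_on n W"
    using ex_bij_betw_finite_nat bij_betw_imp_inj_on by metis
  \<comment> \<open>The numbering supplies an injection on the finite set \<open>W\<close>, and
    keeping the first component gives each element a variable of its own sort.\<close>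
  define nm where "nm w = (fst w, n w)" for w
  have inj: "inj_on nm W" using n by (auto simp: nm_def inj_on_def)
  obtain xs where xs: "set xs = nm ` W" "distinct xs"
    using finite_distinct_list[of "nm ` W"] \<open>finite W\<close> by blast
  have "fst w \<in> Sorts \<Sigma>" if "w \<in> W" for w
    using WM[of "fst w" "snd w"] partial_structure_car[OF M] that by (metis prod.collapse)
  then have ctx: "wf_ctx \<Sigma> xs"
    using xs by (auto simp: wf_ctx_def nm_def)
  define v where "v s a = (Var (nm (s, a)) :: ('s, 'f) tm)" for s a
  have v: "has_sort \<Sigma> xs (v s a) s" if "(s, a) \<in> W" for s a
  proof -
    have "nm (s, a) \<in> set xs" unfolding xs(1) using that by (rule imageI)
    from has_sort.intros(1)[OF this] show ?thesis by (simp add: v_def nm_def)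
  qed
  define fm where "fm x = (case x of Element s a \<Rightarrow> HTrue
    | Equation f as b \<Rightarrow> HEq (Fn f (map2 v (fdom \<Sigma> f) as)) (v (fcod \<Sigma> f) b)
    | Relation R as \<Rightarrow> HRel R (map2 v (rdom \<Sigma> R) as))" for x :: "('s, 'f, 'r, 'a) atom"
  have vs: "list_all2 (has_sort \<Sigma> xs) (map2 v ss as) ss"
    if "as \<in> tuples M ss" "set (zip ss as) \<subseteq> W" for ss as
    using that unfolding mem_tuples by (induction rule: list_all2_induct) (auto simp: v)
  have wf: "wf_horn \<Sigma> xs (fm x)" if x: "x \<in> p" for x
  proof -
    have xW: "elems \<Sigma> x \<subseteq> W" and xM: "x \<in> diagram M" using x p(2) by (auto simp: W_def)
    show ?thesis
    proof (cases x)
      case (Element s a)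
      then show ?thesis by (simp add: fm_def)
    next
      case (Equation f as b)
      then have "opn M f as = Some b" using xM by (auto simp: diagram_def)
      then have *: "f \<in> Funs \<Sigma>" "as \<in> tuples M (fdom \<Sigma> f)" using partial_structure_opn[OF M] by blast+
      have "has_sort \<Sigma> xs (Fn f (map2 v (fdom \<Sigma> f) as)) (fcod \<Sigma> f)"
        by (rule has_sort.intros(2)[OF *(1) vs[OF *(2)]]) (use xW Equation in simp)
      moreover have "has_sort \<Sigma> xs (v (fcod \<Sigma> f) b) (fcod \<Sigma> f)"
        by (rule v) (use xW Equation in simp)
      ultimately show ?thesis by (auto simp: fm_def Equation)
    next
      case (Relation R as)
      then have "as \<in> rel M R" using xM by (auto simp: diagram_def)
      then have "R \<in> Rels \<Sigma>" "as \<in> tuples M (rdom \<Sigma> R)" using partial_structure_rel[OF M] by blast+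
      then show ?thesis using vs xW Relation by (simp add: fm_def)
    qed
  qed
  obtain ps where ps: "set ps = p" using finite_list[OF p(1)] by blast
  define \<phi> where "\<phi> = foldr HAnd (map fm ps) HTrue"
  have "wf_horn \<Sigma> xs (foldr HAnd (map fm qs) HTrue)" if "set qs \<subseteq> p" for qs
    using that wf by (induction qs) auto
  then have "wf_horn \<Sigma> xs \<phi>" using ps by (simp add: \<phi>_def)
  moreover have "holds N \<rho> \<phi> \<longleftrightarrow> (\<forall>x\<in>p. sat \<Sigma> N \<nu> x)"
    if \<rho>: "\<forall>(s, a)\<in>W. \<rho> (nm (s, a)) = Some (\<nu> s a)" for N :: "('s, 'f, 'r, 'b) pstruct" and \<rho> \<nu>
  proof -
    have val: "tm_val N \<rho> (v s a) = Some (\<nu> s a)" if "(s, a) \<in> W" for s a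
      using \<rho> that by (auto simp: v_def)
    have vals: "tm_vals N \<rho> (map2 v ss as) (map2 \<nu> ss as)"
      if "set (zip ss as) \<subseteq> W" for ss as
      using that val by (auto simp: list.rel_map intro!: list.rel_refl_strong)
    have "holds N \<rho> (fm x) \<longleftrightarrow> sat \<Sigma> N \<nu> x" if x: "x \<in> p" for x
    proof -
      have xW: "elems \<Sigma> x \<subseteq> W" using x by (auto simp: W_def)
      show ?thesis
      proof (cases x)
        case (Element s a)
        then show ?thesis by (simp add: fm_def)
      next
        case (Equation f as b)
        have "tm_vals N \<rho> (map2 v (fdom \<Sigma> f) as) (map2 \<nu> (fdom \<Sigma> f) as)"
          by (rule vals) (use xW Equation in simp)
        then have "those (map (tm_val N \<rho>) (map2 v (fdom \<Sigma> f) as)) = Some (map2 \<nu> (fdom \<Sigma> f) as)"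
          unfolding those_eq_Some_iff .
        then have "tm_val N \<rho> (Fn f (map2 v (fdom \<Sigma> f) as)) = opn N f (map2 \<nu> (fdom \<Sigma> f) as)"
          by (simp only: tm_val.simps(2) bind.simps)
        moreover have "tm_val N \<rho> (v (fcod \<Sigma> f) b) = Some (\<nu> (fcod \<Sigma> f) b)"
          by (rule val) (use xW Equation in simp)
        ultimately show ?thesis by (simp add: fm_def Equation)
      next
        case (Relation R as)
        have "tm_vals N \<rho> (map2 v (rdom \<Sigma> R) as) (map2 \<nu> (rdom \<Sigma> R) as)"
          by (rule vals) (use xW Relation in simp)
        then have "holds N \<rho> (HRel R (map2 v (rdom \<Sigma> R) as)) \<longleftrightarrow> map2 \<nu> (rdom \<Sigma> R) as \<in> rel N R"
          unfolding holds_HRel_iff using list_all2_Some_functional by metis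
        then show ?thesis by (simp add: fm_def Relation)
      qed
    qed
    moreover have "holds N \<rho> (foldr HAnd (map fm qs) HTrue) \<longleftrightarrow> (\<forall>x\<in>set qs. holds N \<rho> (fm x))" for qs
      by (induction qs) auto
    ultimately show ?thesis using ps by (simp add: \<phi>_def)
  qed
  moreover have "fst (nm w) = fst w" for w by (simp add: nm_def)
  ultimately show ?thesis using ctx xs(1) inj by blast
qed

section \<open>Generic algebras\<close>

context relative_theory
begin

text \<open>Here the closure of \<open>V\<close> under products indexed by \<open>K\<close> enters:
  the vectors can be coded by a small set, and the set-theoretic product is a categorical
  one.\<close>

lemma product_exists:
  fixes I :: "'i set"
  assumes I: "I \<lesssim> K" and X: "\<And>i. i \<in> I \<Longrightarrow> X i \<in> Ob C"
  obtains P p where "is_product C I X P p"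
proof -
  define X' where "X' i = as_struct (X i)" for i
  \<comment> \<open>For empty \<open>I\<close> the set of vectors is a singleton at every
    \<open>s\<close>; outside the sorts of \<Sigma> the carrier has to be empty.\<close>
  define R where "R s = (if s \<in> Sorts \<Sigma> then \<Pi>\<^sub>E i\<in>I. car (X' i) s else {})" for s
  obtain e where e: "\<And>s. inj_on (e s) (R s)" "\<And>s. e s ` R s \<in> V"
    by (rule small_universe_PiE_inj[OF V I, of "\<lambda>s i. car (X' i) s" R])
      (use X in \<open>auto simp: R_def X'_def Ob_iff\<close>)
  have stX: "partial_structure \<Sigma>' (X' i)" if "i \<in> I" for i
    using Ob_struct[OF X[OF that]] by (simp add: X'_def)
  obtain N q where N: "jointly_closed \<Sigma>' N I X' q" "\<And>s. car N s = e s ` R s"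
    "\<And>s a i. a \<in> R s \<Longrightarrow> i \<in> I \<Longrightarrow> q i s (e s a) = a i"
  proof (rule initial_structure[of R I X' \<Sigma>' e])
    show "R s \<subseteq> (\<Pi>\<^sub>E i\<in>I. car (X' i) s)" for s by (auto simp: R_def)
    show "R s = {}" if "s \<notin> Sorts \<Sigma>'" for s using that by (simp add: R_def)
    show "inj_on (e s) (R s)" for s by (rule e(1))
  next
    fix f as
    assume f: "f \<in> Funs \<Sigma>'" and def: "\<And>i. i \<in> I \<Longrightarrow> opn (X' i) f (map (\<lambda>a. a i) as) \<noteq> None"
    have "fcod \<Sigma>' f \<in> Sorts \<Sigma>" using wf_sig' f by (simp add: wf_sig_def)
    moreover have "the (opn (X' i) f (map (\<lambda>a. a i) as)) \<in> car (X' i) (fcod \<Sigma>' f)" if "i \<in> I" for i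
      using def[OF that] partial_structure_opn[OF stX[OF that]] by fastforce
    ultimately show "(\<lambda>i\<in>I. the (opn (X' i) f (map (\<lambda>a. a i) as))) \<in> R (fcod \<Sigma>' f)"
      by (simp add: R_def)
  qed blast
  have "car N s \<in> V" for s
    unfolding N(2) by (rule e(2))
  then have NOb: "alg_of N \<in> Ob C"
    using jointly_closed_Ob[of N I X q] N(1) X unfolding X'_def by blast
  have st: "partial_structure \<Sigma>' N" by (rule jointly_closed_struct[OF N(1)])
  have q: "restr_hom N (q i) \<in> homs \<Sigma>' N (X' i)" if "i \<in> I" for i
    by (rule restr_hom_homs[OF st jointly_closed_hhom[OF N(1) that]])
  have "is_product C I X (alg_of N) (\<lambda>i. restr_hom N (q i))"
    unfolding is_product_def Alg_simps as_struct_alg_of X'_def[symmetric]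
  proof (intro conjI ballI allI impI)
    fix Q r assume Q: "Q \<in> Ob C" and r: "\<forall>i\<in>I. r i \<in> homs \<Sigma>' (as_struct Q) (X' i)"
    let ?Q = "as_struct Q"
    have stQ: "partial_structure \<Sigma>' ?Q" by (rule Ob_struct[OF Q])
    have rh: "hhom \<Sigma>' ?Q (X' i) (r i)" if "i \<in> I" for i using r that homs_hhom by blast
    define u where "u s x = e s (\<lambda>i\<in>I. r i s x)" for s x
    have uR: "(\<lambda>i\<in>I. r i s x) \<in> R s" if "x \<in> car ?Q s" for s x
      using hhom_car[OF rh that] partial_structure_car[OF stQ that] by (simp add: R_def)
    have uN: "u s x \<in> car N s" if "x \<in> car ?Q s" for s x
      using uR[OF that] by (simp add: u_def N(2))
    have qu: "q i s (u s x) = r i s x" if "i \<in> I" "x \<in> car ?Q s" for i s x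
      using N(3)[OF uR[OF that(2)] that(1)] that(1) by (simp add: u_def)
    have u: "restr_hom ?Q u \<in> homs \<Sigma>' ?Q N"
      by (rule restr_hom_homs[OF stQ jointly_closed_lift[OF N(1) stQ rh uN qu]])
    show "\<exists>!u. u \<in> homs \<Sigma>' ?Q N \<and> (\<forall>i\<in>I. comp_hom ?Q (restr_hom N (q i)) u = r i)"
    proof (rule ex1I[of _ "restr_hom ?Q u"], intro conjI ballI)
      show "restr_hom ?Q u \<in> homs \<Sigma>' ?Q N" by (rule u)
      fix i assume i: "i \<in> I"
      show "comp_hom ?Q (restr_hom N (q i)) (restr_hom ?Q u) = r i"
        by (rule homs_ext[OF comp_hom_homs[OF stQ u q[OF i]] bspec[OF r i]]) (simp add: uN qu[OF i])
    next
      fix w assume w: "w \<in> homs \<Sigma>' ?Q N \<and> (\<forall>i\<in>I. comp_hom ?Q (restr_hom N (q i)) w = r i)"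
      show "w = restr_hom ?Q u"
      proof (rule homs_ext[OF conjunct1[OF w] u])
        fix s x assume x: "x \<in> car ?Q s"
        have wN: "w s x \<in> car N s" using hhom_car[OF homs_hhom[OF conjunct1[OF w]] x] .
        have "w s x = u s x"
        proof (rule jointly_closed_inj[OF N(1) wN uN[OF x]])
          fix i assume i: "i \<in> I"
          then have "comp_hom ?Q (restr_hom N (q i)) w s x = r i s x" using w by simp
          then show "q i s (w s x) = q i s (u s x)" using x wN qu[OF i x] by simp
        qed
        then show "w s x = restr_hom ?Q u s x" using x by simp
      qed
    qed
  qed (use NOb q in auto)
  then show thesis by (rule that)
qed

text \<open>For an \<open>Element\<close> atom, which \<open>sat\<close> always accepts, the carrier
  condition is the whole content.\<close>

definition realizes ::
  "('s, 'f, 'r, 'u) atom set \<Rightarrow> ('s, 'f, 'r, 'w, 'u) algebra \<Rightarrow> ('s \<Rightarrow> 'u \<Rightarrow> 'u) \<Rightarrow> bool" where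
  "realizes p B \<mu> \<longleftrightarrow> (\<forall>x\<in>p. sat \<Sigma> (und B) \<mu> x) \<and>
     (\<forall>(s, a)\<in>\<Union> (elems \<Sigma> ` p). \<mu> s a \<in> car (und B) s)"

text \<open>A representing object: relative to the algebras in \<D>, homomorphisms out of
  \<open>R\<close> are the realizations of \<open>p\<close>, considered on the elements that
  \<open>p\<close> mentions.\<close>

definition generic where
  "generic \<D> p R \<nu> \<longleftrightarrow> realizes p R \<nu> \<and> (\<forall>B\<in>\<D>. \<forall>\<mu>. realizes p B \<mu> \<longrightarrow>
     (\<exists>!h. h \<in> ahoms R B \<and> (\<forall>(s, a)\<in>\<Union> (elems \<Sigma> ` p). h s (\<nu> s a) = \<mu> s a)))"

section \<open>The generic algebra of a Horn formula\<close>

context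
  fixes \<E> :: "('s, 'f, 'r, 'w, 'u) algebra set"
  assumes \<E>: "\<E> \<subseteq> Ob C" and products: "closed_under_products V C \<E>"
    and subobjects: "closed_under_closed_subobjects \<Sigma> C \<E>"
begin

definition entails :: "'s var list \<Rightarrow> ('s, 'f + 'w, 'r) horn \<Rightarrow> ('s, 'f + 'w, 'r) horn \<Rightarrow> bool" where
  "entails xs \<phi> \<psi> \<longleftrightarrow> (\<forall>B\<in>\<E>. \<forall>\<rho>\<in>vals (as_struct B) xs. holds (as_struct B) \<rho> \<phi> \<longrightarrow> holds (as_struct B) \<rho> \<psi>)"

text \<open>
  One counterexample for each atomic formula not entailed by \<open>\<phi>\<close> suffices, so the product below has
  at most \<open>K\<close> factors and exists in \<open>V\<close>.
\<close>

lemma generic_algebra: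
  assumes xs: "wf_ctx \<Sigma>' xs" and \<phi>: "wf_horn \<Sigma>' xs \<phi>"
  obtains R \<rho> where "R \<in> \<E>" "generated \<Sigma>' xs (as_struct R) \<rho>" "holds (as_struct R) \<rho> \<phi>"
    "\<And>\<psi>. wf_horn \<Sigma>' xs \<psi> \<Longrightarrow> holds (as_struct R) \<rho> \<psi> \<Longrightarrow> entails xs \<phi> \<psi>"
proof -
  define Tm where "Tm = {t. \<exists>s. has_sort \<Sigma>' xs t s}"
  \<comment> \<open>The equations include \<open>HEq t t\<close>, so the counterexamples also
    separate the terms that \<phi> does not force to be defined.\<close>
  define At where "At = (\<lambda>(t, u). HEq t u) ` (Tm \<times> Tm) \<union> (\<lambda>(Q, ts). HRel Q ts) ` (Rels \<Sigma> \<times> lists Tm)"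
  define \<Psi> where "\<Psi> = {\<psi> \<in> At. \<not> entails xs \<phi> \<psi>}"
  have Tm: "Tm \<lesssim> K" unfolding Tm_def by (rule terms_lepoll[OF infinite_K Funs'_small])
  have "At \<lesssim> K" unfolding At_def
    by (intro infinite_Un_lepoll image_lepoll_trans infinite_Times_lepoll infinite_lists_lepoll
        infinite_K Tm Rels_small)
  then have "\<Psi> \<lesssim> K" by (rule subset_lepoll_trans[rotated]) (auto simp: \<Psi>_def)
  then obtain e where e: "inj_on e \<Psi>" "e ` \<Psi> \<subseteq> K" unfolding lepoll_def by blast
  have "\<exists>B \<sigma>. B \<in> \<E> \<and> \<sigma> \<in> vals (as_struct B) xs \<and> holds (as_struct B) \<sigma> \<phi> \<and> \<not> holds (as_struct B) \<sigma> \<psi>"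
    if "\<psi> \<in> \<Psi>" for \<psi> using that unfolding \<Psi>_def entails_def by blast
  then obtain B \<sigma> where B: "\<And>\<psi>. \<psi> \<in> \<Psi> \<Longrightarrow> B \<psi> \<in> \<E> \<and> \<sigma> \<psi> \<in> vals (as_struct (B \<psi>)) xs \<and>
      holds (as_struct (B \<psi>)) (\<sigma> \<psi>) \<phi> \<and> \<not> holds (as_struct (B \<psi>)) (\<sigma> \<psi>) \<psi>"
    by metis
  \<comment> \<open>Closure under products is stated for index sets in \<open>V\<close>, so the
    formulas serving as indices are replaced by their codes in \<open>K\<close>.\<close>
  define I where "I = e ` \<Psi>"
  define X where "X i = B (inv_into \<Psi> e i)" for i
  define w where "w i = \<sigma> (inv_into \<Psi> e i)" for i
  have inv: "inv_into \<Psi> e i \<in> \<Psi>" if "i \<in> I" for i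
    using that unfolding I_def by (rule inv_into_into)
  have X\<E>: "X i \<in> \<E>" and w: "w i \<in> vals (as_struct (X i)) xs" and w\<phi>: "holds (as_struct (X i)) (w i) \<phi>"
    if "i \<in> I" for i
    using B[OF inv[OF that]] by (auto simp: X_def w_def)
  have XOb: "X i \<in> Ob C" if "i \<in> I" for i using X\<E>[OF that] \<E> by blast
  have IK: "I \<lesssim> K" using e(2) unfolding I_def by (rule subset_imp_lepoll)
  obtain P p where P: "is_product C I X P p" using product_exists[where X = X, OF IK XOb] by blast
  have IV: "I \<in> V" by (rule small_universe_lepoll[OF V small_universe_mem[OF V] IK])
  have P\<E>: "P \<in> \<E>" using products P IV X\<E> unfolding closed_under_products_def by blast
  obtain N q \<rho> where N: "jointly_closed \<Sigma>' N I (\<lambda>i. as_struct (X i)) q" "alg_of N \<in> Ob C"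
      "generated \<Sigma>' xs N \<rho>" "\<And>i. i \<in> I \<Longrightarrow> vmap (q i) \<rho> = w i"
    using generated_subalgebra[where \<rho> = w, OF XOb w xs] by blast
  note NOb = N(2)
  have \<rho>: "\<rho> \<in> vals N xs" using N(3) by (simp add: generated_def)
  obtain m where m: "m \<in> homs \<Sigma>' N (as_struct P)"
    and pm: "\<And>i s x. i \<in> I \<Longrightarrow> x \<in> car N s \<Longrightarrow> p i s (m s x) = q i s x"
    using product_factor[OF XOb P N(1,2)] by blast
  have map2: "map2 (p i) ss (map2 m ss as) = map2 (q i) ss as" if "i \<in> I" "as \<in> tuples N ss" for i ss as
    unfolding map2_map2_tuples[OF that(2)] by (rule map2_cong_tuples[OF that(2)]) (rule pm[OF that(1)])
  have proj: "hhom \<Sigma>' (as_struct P) (as_struct (X i)) (p i)" if "i \<in> I" for i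
    by (rule homs_hhom[OF product_proj[OF XOb P that]])
  have car: "car (und (alg_of N)) s = car N s" for s by simp
  have tup: "tuples (und (alg_of N)) ss = tuples N ss" for ss by (simp add: tuples_def)
  \<comment> \<open>Whatever is defined or true in \<open>P\<close> at the image of a tuple is so in
    every factor, because \<open>p i\<close> after \<open>m\<close> is \<open>q i\<close>; joint
    closedness of \<open>N\<close> brings it back.\<close>
  have "closed_mono \<Sigma> (und (alg_of N)) (und P) m"
    unfolding closed_mono_def
  proof (intro conjI ballI impI)
    show "m \<in> homs \<Sigma> (und (alg_of N)) (und P)"
      using hhom_und[of \<Sigma> \<Omega> "alg_of N" P m] m by (simp add: homs_iff)
    show "inj_on (m s) (car (und (alg_of N)) s)" for s
      unfolding car by (rule inj_onI, rule jointly_closed_inj[OF N(1)]) (assumption, assumption, metis pm)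
  next
    fix f as assume f: "f \<in> Funs \<Sigma>" and as: "as \<in> tuples (und (alg_of N)) (fdom \<Sigma> f)"
      and "opn (und P) f (map2 m (fdom \<Sigma> f) as) \<noteq> None"
    then obtain b where b: "opn (as_struct P) (Inl f) (map2 m (fdom \<Sigma>' (Inl f)) as) = Some b" by auto
    have as': "as \<in> tuples N (fdom \<Sigma>' (Inl f))" using as unfolding tup by simp
    have f': "Inl f \<in> Funs \<Sigma>'" using f by auto
    have "opn N (Inl f) as \<noteq> None"
    proof (rule jointly_closed_opn[OF N(1) f' as'])
      fix i assume i: "i \<in> I"
      show "opn (as_struct (X i)) (Inl f) (map2 (q i) (fdom \<Sigma>' (Inl f)) as) \<noteq> None"
        using hhom_opn[OF proj[OF i] f' b] unfolding map2[OF i as'] by blast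
    qed
    then show "opn (und (alg_of N)) f as \<noteq> None" by (simp add: alg_of_def)
  next
    fix Q as assume Q: "Q \<in> Rels \<Sigma>" and as: "as \<in> tuples (und (alg_of N)) (rdom \<Sigma> Q)"
      and "map2 m (rdom \<Sigma> Q) as \<in> rel (und P) Q"
    then have b: "map2 m (rdom \<Sigma>' Q) as \<in> rel (as_struct P) Q" by simp
    have as': "as \<in> tuples N (rdom \<Sigma>' Q)" using as unfolding tup by simp
    have Q': "Q \<in> Rels \<Sigma>'" using Q by simp
    have "as \<in> rel N Q"
    proof (rule jointly_closed_rel[OF N(1) Q' as'])
      fix i assume i: "i \<in> I"
      show "map2 (q i) (rdom \<Sigma>' Q) as \<in> rel (as_struct (X i)) Q"
        using hhom_rel[OF proj[OF i] Q' b] unfolding map2[OF i as'] by blast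
    qed
    then show "as \<in> rel (und (alg_of N)) Q" by (simp add: alg_of_def)
  qed
  moreover have "m \<in> Hom C (alg_of N) P" using m by (simp add: Alg_simps)
  ultimately have N\<E>: "alg_of N \<in> \<E>"
    using subobjects P\<E> NOb unfolding closed_under_closed_subobjects_def forgetful_def by simp blast
  have "holds N \<rho> \<phi>" by (rule jointly_closed_holds[OF N(1) \<rho> \<phi>]) (simp add: N(4) w\<phi>)
  moreover have "entails xs \<phi> \<psi>" if "wf_horn \<Sigma>' xs \<psi>" "holds N \<rho> \<psi>" for \<psi>
  proof -
    \<comment> \<open>If \<phi> did not entail the atom, its counterexample would be one of the
      factors, and the projection of \<open>N\<close> to that factor would make the atom true
      there.\<close>
    have at: "entails xs \<phi> \<psi>" if \<psi>: "\<psi> \<in> At" "wf_horn \<Sigma>' xs \<psi>" "holds N \<rho> \<psi>" for \<psi>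
    proof (rule ccontr)
      assume "\<not> entails xs \<phi> \<psi>"
      then have \<Psi>: "\<psi> \<in> \<Psi>" using \<psi>(1) by (simp add: \<Psi>_def)
      then have I: "e \<psi> \<in> I" and eq: "inv_into \<Psi> e (e \<psi>) = \<psi>" using e(1) by (simp_all add: I_def)
      have "holds (as_struct (X (e \<psi>))) (w (e \<psi>)) \<psi>"
        using hhom_holds[OF jointly_closed_hhom[OF N(1) I] \<rho> \<psi>(2,3)] N(4)[OF I] by simp
      then show False using B[OF \<Psi>] by (simp add: X_def w_def eq)
    qed
    show ?thesis using that
    proof (induction \<psi>)
      case (HRel Q ts)
      then have "Q \<in> Rels \<Sigma>" and "list_all2 (has_sort \<Sigma>' xs) ts (rdom \<Sigma> Q)" by simp_all
      then have "(Q, ts) \<in> Rels \<Sigma> \<times> lists Tm"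
        by (auto simp: Tm_def dest: list_all2_in_setD)
      then have "HRel Q ts \<in> At" unfolding At_def by force
      then show ?case using at HRel by blast
    next
      case (HEq t u)
      then have "(t, u) \<in> Tm \<times> Tm" by (auto simp: Tm_def)
      then have "HEq t u \<in> At" unfolding At_def by force
      then show ?case using at HEq by blast
    qed (auto simp: entails_def)
  qed
  ultimately show thesis using that[of "alg_of N" \<rho>] N\<E> N(3) by simp
qed

text \<open>The formula describing \<open>p\<close> is a premise over \<Sigma>, so whatever its
  generic algebra satisfies gives a judgment valid in \<E>. By assumption \<open>A\<close> satisfies
  it too, which is why the universal property extends to \<open>A\<close>.\<close>

lemma generic_algebra_diagram:
  assumes A: "A \<in> Ob C"
    and judgments: "\<And>\<sigma>. relative_judgment \<Sigma> \<Omega> \<sigma> \<Longrightarrow> (\<And>B. B \<in> \<E> \<Longrightarrow> valid_in (as_struct B) \<sigma>) \<Longrightarrow>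
      valid_in (as_struct A) \<sigma>"
    and p: "finite p" "p \<subseteq> diagram (und A)"
  shows "\<exists>R\<in>\<E>. \<exists>\<nu>. generic (insert A \<E>) p R \<nu>"
proof -
  define W where "W = \<Union> (elems \<Sigma> ` p)"
  obtain xs \<phi> nm where ctx: "wf_ctx \<Sigma> xs" and \<phi>: "wf_horn \<Sigma> xs \<phi>" and xs: "set xs = nm ` W"
    and nm: "inj_on nm W" "\<forall>w. fst (nm w) = fst w"
    and holds: "\<forall>(N :: ('s, 'f, 'r, 'u) pstruct) \<rho> \<nu>. (\<forall>(s, a)\<in>W. \<rho> (nm (s, a)) = Some (\<nu> s a)) \<longrightarrow>
       (holds N \<rho> \<phi> \<longleftrightarrow> (\<forall>x\<in>p. sat \<Sigma> N \<nu> x))"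
    using diagram_formula[OF Ob_und[OF A] p, folded W_def] by (elim exE conjE) (rule that; assumption)
  have ctx': "wf_ctx \<Sigma>' xs" and d: "distinct xs" using ctx by (simp_all add: wf_ctx_def)
  obtain R \<rho> where R: "R \<in> \<E>" "generated \<Sigma>' xs (as_struct R) \<rho>" "holds (as_struct R) \<rho> (lift_horn \<phi>)"
    "\<And>\<psi>. wf_horn \<Sigma>' xs \<psi> \<Longrightarrow> holds (as_struct R) \<rho> \<psi> \<Longrightarrow> entails xs (lift_horn \<phi>) \<psi>"
    using generic_algebra[OF ctx' wf_horn_lift[OF \<phi>]] by blast
  have \<rho>: "\<rho> \<in> vals (as_struct R) xs" using R(2) by (simp add: generated_def)
  have stR: "partial_structure \<Sigma>' (as_struct R)" using R(1) \<E> Ob_struct by blast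
  define \<nu> where "\<nu> s a = the (\<rho> (nm (s, a)))" for s a
  have \<rho>\<nu>: "\<rho> (nm (s, a)) = Some (\<nu> s a)" "\<nu> s a \<in> car (und R) s" if "(s, a) \<in> W" for s a
    using valsD[OF \<rho>, of "nm (s, a)"] xs that spec[OF nm(2), of "(s, a)"] by (auto simp: \<nu>_def)
  have sat\<nu>: "\<forall>x\<in>p. sat \<Sigma> (und R) \<nu> x" using holds \<rho>\<nu>(1) R(3) unfolding holds_lift by blast
  have univ: "\<exists>!h. h \<in> ahoms R B \<and> (\<forall>(s, a)\<in>W. h s (\<nu> s a) = \<mu> s a)"
    if B: "B \<in> insert A \<E>" and r: "realizes p B \<mu>" for B \<mu>
  proof -
    have sat: "\<forall>x\<in>p. sat \<Sigma> (und B) \<mu> x" and \<mu>: "\<forall>(s, a)\<in>W. \<mu> s a \<in> car (und B) s"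
      using r by (simp_all add: realizes_def W_def)
    have BOb: "B \<in> Ob C" using B A \<E> by blast
    define \<sigma> where "\<sigma> x = (if x \<in> set xs then Some (\<mu> (fst x) (snd (inv_into W nm x))) else None)" for x
    have \<sigma>\<mu>: "\<sigma> (nm (s, a)) = Some (\<mu> s a)" if "(s, a) \<in> W" for s a
      using that xs inv_into_f_f[OF nm(1) that] spec[OF nm(2), of "(s, a)"] by (simp add: \<sigma>_def)
    have \<sigma>: "\<sigma> \<in> vals (as_struct B) xs"
      unfolding vals_def
    proof (intro CollectI conjI allI impI)
      show "dom \<sigma> = set xs" by (auto simp: \<sigma>_def split: if_splits)
      fix x a assume x: "\<sigma> x = Some a"
      then have "x \<in> set xs" by (simp add: \<sigma>_def split: if_splits)
      then obtain s b where "(s, b) \<in> W" "x = nm (s, b)" using xs by auto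
      then show "a \<in> car (as_struct B) (fst x)" using x \<sigma>\<mu> \<mu> spec[OF nm(2), of "(s, b)"] by auto
    qed
    have "holds (und B) \<sigma> \<phi>" using holds \<sigma>\<mu> sat by blast
    then have B\<phi>: "holds (as_struct B) \<sigma> (lift_horn \<phi>)" by (simp add: holds_lift)
    \<comment> \<open>For \<open>B\<close> in \<E> entailment applies directly. Otherwise
      \<open>B\<close> is \<open>A\<close>, and the entailment is read as a judgment, whose premise
      is a lifted formula over \<Sigma>.\<close>
    have B\<psi>: "holds (as_struct B) \<sigma> \<psi>" if \<psi>: "wf_horn \<Sigma>' xs \<psi>" "entails xs (lift_horn \<phi>) \<psi>" for \<psi>
    proof (cases "B \<in> \<E>")
      case True
      then show ?thesis using \<psi>(2) \<sigma> B\<phi> unfolding entails_def by blast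
    next
      case False
      have "relative_judgment \<Sigma> \<Omega> (xs, lift_horn \<phi>, \<psi>)"
        using ctx' wf_horn_lift[OF \<phi>] \<psi>(1) \<phi> by (auto simp: lift_horn_def)
      moreover have "valid_in (as_struct D) (xs, lift_horn \<phi>, \<psi>)" if "D \<in> \<E>" for D
        using \<psi>(2) that unfolding valid_in_iff_vals[OF d] entails_def by blast
      ultimately have "valid_in (as_struct A) (xs, lift_horn \<phi>, \<psi>)" by (rule judgments)
      then show ?thesis using \<sigma> B\<phi> B False unfolding valid_in_iff_vals[OF d] by blast
    qed
    obtain h where h: "h \<in> ahoms R B" "vmap h \<rho> = \<sigma>"
      using generated_hom_exists[OF R(2) stR \<sigma> Ob_struct[OF BOb]] B\<psi> R(4) by blast
    have eq: "vmap k \<rho> = \<sigma> \<longleftrightarrow> (\<forall>(s, a)\<in>W. k s (\<nu> s a) = \<mu> s a)" for k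
    proof -
      have *: "vmap k \<rho> (nm (s, a)) = Some (k s (\<nu> s a))" if "(s, a) \<in> W" for s a
        using \<rho>\<nu>(1)[OF that] spec[OF nm(2), of "(s, a)"] by (simp add: vmap_def)
      have "vmap k \<rho> = \<sigma>" if k: "\<forall>(s, a)\<in>W. k s (\<nu> s a) = \<mu> s a"
      proof
        fix x show "vmap k \<rho> x = \<sigma> x"
        proof (cases "x \<in> set xs")
          case True
          then obtain s a where "(s, a) \<in> W" "x = nm (s, a)" using xs by auto
          then show ?thesis using * \<sigma>\<mu> k by fastforce
        next
          case False
          then have "\<rho> x = None" using \<rho> unfolding vals_def by blast
          then show ?thesis using False by (simp add: vmap_def \<sigma>_def)
        qed
      qed
      then show ?thesis using * \<sigma>\<mu> by fastforce
    qed
    show ?thesis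
    proof (rule ex1I[of _ h])
      show "h \<in> ahoms R B \<and> (\<forall>(s, a)\<in>W. h s (\<nu> s a) = \<mu> s a)"
        using h(1) iffD1[OF eq h(2)] by (rule conjI)
      show "k = h" if "k \<in> ahoms R B \<and> (\<forall>(s, a)\<in>W. k s (\<nu> s a) = \<mu> s a)" for k
        by (rule generated_hom_unique[OF R(2) conjunct1[OF that] h(1)])
          (simp only: h(2) iffD2[OF eq conjunct2[OF that]])
    qed
  qed
  have "\<forall>(s, a)\<in>W. \<nu> s a \<in> car (und R) s" using \<rho>\<nu>(2) by blast
  then have "realizes p R \<nu>" unfolding realizes_def W_def using sat\<nu> by (rule conjI[rotated])
  then have "generic (insert A \<E>) p R \<nu>"
    unfolding generic_def W_def[symmetric] by (intro conjI ballI allI impI) (assumption, rule univ)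
  then show ?thesis using R(1) by blast
qed

end

text \<open>An atom amounts to a sort or symbol together with finitely many elements of
  \<open>U\<close>, the union of all carriers. \<open>U\<close> is small because there are at most
  \<open>K\<close> sorts, and an infinite small set containing \<open>U\<close> and \<open>K\<close>
  absorbs the lists and finite subsets.\<close>

lemma diagram_small:
  assumes A: "A \<in> Ob C"
  obtains Y :: "'u set" where "Y \<in> V" "{p. finite p \<and> p \<subseteq> diagram (und A)} \<lesssim> Y"
proof -
  define U where "U = (\<Union>s\<in>Sorts \<Sigma>. car (und A) s)"
  have "U \<in> V" unfolding U_def
    by (rule small_universe_UN_lepoll[OF V Sorts_small]) (use A in \<open>simp add: Ob_iff\<close>)
  then obtain Y where Y: "Y \<in> V" "infinite Y" "U \<subseteq> Y" "K \<subseteq> Y"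
    by (rule small_universe_infinite_superset[OF V])
  have KY: "Z \<lesssim> Y" if "Z \<lesssim> K" for Z :: "'z set" using that subset_imp_lepoll[OF Y(4)] by (rule lepoll_trans)
  note st = Ob_und[OF A]
  have car: "a \<in> U" "s \<in> Sorts \<Sigma>" if "a \<in> car (und A) s" for a s
    using that partial_structure_car[OF st that] by (auto simp: U_def)
  have tup: "as \<in> lists U" if "as \<in> tuples (und A) ss" for as ss
    using that unfolding mem_tuples by (induction rule: list_all2_induct) (auto simp: car)
  have "diagram (und A) \<subseteq> (\<lambda>(s, a). Element s a) ` (Sorts \<Sigma> \<times> U) \<union>
      (\<lambda>(f, as, b). Equation f as b) ` (Funs \<Sigma> \<times> lists U \<times> U) \<union> (\<lambda>(R, as). Relation R as) ` (Rels \<Sigma> \<times> lists U)"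
  proof
    fix x assume "x \<in> diagram (und A)"
    then consider (1) s a where "x = Element s a" "a \<in> car (und A) s"
      | (2) f as b where "x = Equation f as b" "opn (und A) f as = Some b"
      | (3) R as where "x = Relation R as" "as \<in> rel (und A) R"
      unfolding diagram_def by blast
    then show "x \<in> (\<lambda>(s, a). Element s a) ` (Sorts \<Sigma> \<times> U) \<union>
      (\<lambda>(f, as, b). Equation f as b) ` (Funs \<Sigma> \<times> lists U \<times> U) \<union> (\<lambda>(R, as). Relation R as) ` (Rels \<Sigma> \<times> lists U)"
    proof cases
      case 1
      then have "(s, a) \<in> Sorts \<Sigma> \<times> U" using car by blast
      show ?thesis unfolding 1(1) by (rule UnI1, rule UnI1, rule image_eqI[OF _ \<open>(s, a) \<in> _\<close>]) simp
    next
      case 2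
      then have "(f, as, b) \<in> Funs \<Sigma> \<times> lists U \<times> U"
        using partial_structure_opn[OF st 2(2)] tup car(1) by blast
      show ?thesis unfolding 2(1) by (rule UnI1, rule UnI2, rule image_eqI[OF _ \<open>(f, as, b) \<in> _\<close>]) simp
    next
      case 3
      then have "(R, as) \<in> Rels \<Sigma> \<times> lists U" using partial_structure_rel[OF st 3(2)] tup by blast
      show ?thesis unfolding 3(1) by (rule UnI2, rule image_eqI[OF _ \<open>(R, as) \<in> _\<close>]) simp
    qed
  qed
  then have "diagram (und A) \<lesssim> Y"
    by (rule subset_lepoll_trans)
      (intro infinite_Un_lepoll image_lepoll_trans infinite_Times_lepoll infinite_lists_lepoll Y(2)
        KY[OF Sorts_small] KY[OF Funs_small] KY[OF Rels_small] subset_imp_lepoll[OF Y(3)])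
  then show thesis using that Y(1) infinite_finite_subsets_lepoll[OF Y(2)] by blast
qed

end

section \<open>From closure to definability\<close>

context relative_theory
begin

text \<open>
  \<open>A\<close> is a \<open>U\<close>-retract of the filtered colimit of the generic algebras over the finite parts of its
  diagram: the generators of the generic algebras assemble to the section.
\<close>

lemma closed_imp_mem:
  assumes \<E>: "\<E> \<subseteq> Ob C" and products: "closed_under_products V C \<E>"
    and subobjects: "closed_under_closed_subobjects \<Sigma> C \<E>"
    and retracts: "closed_under_U_retracts C (PMod V \<Sigma> T) forgetful \<E>"
    and colimits: "closed_under_filtered_colimits V C \<E>"
    and A: "A \<in> Ob C"
    and judgments: "\<And>\<sigma>. relative_judgment \<Sigma> \<Omega> \<sigma> \<Longrightarrow> (\<And>B. B \<in> \<E> \<Longrightarrow> valid_in (as_struct B) \<sigma>) \<Longrightarrow>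
      valid_in (as_struct A) \<sigma>"
  shows "A \<in> \<E>"
proof -
  note st = Ob_und[OF A]
  define F where "F = {p. finite p \<and> p \<subseteq> diagram (und A)}"
  define W where "W p = \<Union> (elems \<Sigma> ` p)" for p :: "('s, 'f, 'r, 'u) atom set"
  have "\<exists>R\<in>\<E>. \<exists>\<nu>. generic (insert A \<E>) p R \<nu>" if "p \<in> F" for p
    using generic_algebra_diagram[OF \<E> products subobjects A judgments, of p] that by (simp add: F_def)
  then obtain R \<nu> where R\<E>: "\<And>p. p \<in> F \<Longrightarrow> R p \<in> \<E>"
    and gen: "\<And>p. p \<in> F \<Longrightarrow> generic (insert A \<E>) p (R p) (\<nu> p)"
    by metis
  note gen = gen[unfolded generic_def W_def[symmetric]]
  have sat: "\<forall>x\<in>p. sat \<Sigma> (und (R p)) (\<nu> p) x"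
    and \<nu>: "\<forall>(s, a)\<in>W p. \<nu> p s a \<in> car (und (R p)) s" if "p \<in> F" for p
    using conjunct1[OF gen[OF that]] unfolding realizes_def W_def by blast+
  have univ: "\<exists>!h. h \<in> ahoms (R p) B \<and> (\<forall>(s, a)\<in>W p. h s (\<nu> p s a) = \<mu> s a)"
    if "p \<in> F" "B \<in> insert A \<E>" "realizes p B \<mu>" for p B \<mu>
    by (rule mp[OF spec[OF bspec[OF conjunct2[OF gen[OF that(1)]] that(2)]] that(3)])
  have ROb: "R p \<in> Ob C" if "p \<in> F" for p using R\<E>[OF that] \<E> by blast
  have WM: "a \<in> car (und A) s" if "p \<in> F" "(s, a) \<in> W p" for p s a
    using that elems_diagram[OF st] unfolding F_def W_def by blast
  have W_mono: "W p \<subseteq> W q" if "p \<subseteq> q" for p q using that unfolding W_def by blast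
  \<comment> \<open>Transition maps between the generic algebras and evaluation maps to
    \<open>A\<close> are both determined by sending names to names; each is an instance of the
    universal property, with target \<open>R q\<close> or \<open>A\<close>.\<close>
  define is_tr where "is_tr p q h \<longleftrightarrow> h \<in> ahoms (R p) (R q) \<and>
    (\<forall>(s, a)\<in>W p. h s (\<nu> p s a) = \<nu> q s a)" for p q h
  define is_ev where "is_ev p h \<longleftrightarrow> h \<in> ahoms (R p) A \<and>
    (\<forall>(s, a)\<in>W p. h s (\<nu> p s a) = a)" for p h
  have tr_ex: "\<exists>!h. is_tr p q h" if "p \<in> F" "q \<in> F" "p \<subseteq> q" for p q
    unfolding is_tr_def
  proof (rule univ[OF that(1)])
    show "R q \<in> insert A \<E>" using R\<E>[OF that(2)] by blast
    show "realizes p (R q) (\<nu> q)"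
      unfolding realizes_def W_def[symmetric] using sat[OF that(2)] \<nu>[OF that(2)] that(3) W_mono[OF that(3)] by blast
  qed
  have ev_ex: "\<exists>!h. is_ev p h" if p: "p \<in> F" for p
    unfolding is_ev_def
  proof (rule univ[OF p])
    have "\<forall>x\<in>p. sat \<Sigma> (und A) (\<lambda>s a. a) x" using sat_diagram[OF st] p unfolding F_def by blast
    then show "realizes p A (\<lambda>s a. a)" unfolding realizes_def W_def[symmetric] using WM[OF p] by blast
  qed simp
  define tr where "tr p q = (THE h. is_tr p q h)" for p q
  define ev where "ev p = (THE h. is_ev p h)" for p
  have tr: "is_tr p q (tr p q)" if "p \<in> F" "q \<in> F" "p \<subseteq> q" for p q
    unfolding tr_def by (rule theI'[OF tr_ex[OF that]])
  have ev: "is_ev p (ev p)" if "p \<in> F" for p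
    unfolding ev_def by (rule theI'[OF ev_ex[OF that]])
  have tr_hom: "tr p q \<in> ahoms (R p) (R q)"
    and tr_\<nu>: "\<And>s a. (s, a) \<in> W p \<Longrightarrow> tr p q s (\<nu> p s a) = \<nu> q s a" if "p \<in> F" "q \<in> F" "p \<subseteq> q" for p q
    using tr[OF that] unfolding is_tr_def by blast+
  have ev_hom: "ev p \<in> ahoms (R p) A"
    and ev_\<nu>: "\<And>s a. (s, a) \<in> W p \<Longrightarrow> ev p s (\<nu> p s a) = a" if "p \<in> F" for p
    using ev[OF that] unfolding is_ev_def by blast+
  have \<nu>_car: "\<nu> p s a \<in> car (as_struct (R p)) s" if "p \<in> F" "(s, a) \<in> W p" for p s a
    using \<nu>[OF that(1)] that(2) by auto
  \<comment> \<open>The identity and composition laws, and the compatibility of \<open>ev\<close>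
    with \<open>tr\<close> below, follow from uniqueness: the competing maps act in the same way on
    names.\<close>
  have tr_id: "tr p p = id_hom (as_struct (R p))" if p: "p \<in> F" for p
  proof -
    have "is_tr p p (id_hom (as_struct (R p)))"
      unfolding is_tr_def using id_hom_homs[OF Ob_struct[OF ROb[OF p]]] id_hom_apply[OF \<nu>_car[OF p]] by blast
    then show ?thesis using tr_ex[OF p p] tr[OF p p] by blast
  qed
  have tr_comp: "tr p r = comp_hom (as_struct (R p)) (tr q r) (tr p q)"
    if p: "p \<in> F" and q: "q \<in> F" and r: "r \<in> F" and pq: "p \<subseteq> q" and qr: "q \<subseteq> r" for p q r
  proof -
    have pr: "p \<subseteq> r" using pq qr by blast
    have "comp_hom (as_struct (R p)) (tr q r) (tr p q) s (\<nu> p s a) = \<nu> r s a" if "(s, a) \<in> W p" for s a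
      using \<nu>_car[OF p that] tr_\<nu>[OF p q pq that] tr_\<nu>[OF q r qr] W_mono[OF pq] that by auto
    then have "is_tr p r (comp_hom (as_struct (R p)) (tr q r) (tr p q))"
      unfolding is_tr_def using comp_hom_homs[OF Ob_struct[OF ROb[OF p]] tr_hom[OF p q pq] tr_hom[OF q r qr]] by blast
    then show ?thesis using tr_ex[OF p r pr] tr[OF p r pr] by blast
  qed
  have ev_comp: "comp_hom (as_struct (R p)) (ev q) (tr p q) = ev p"
    if p: "p \<in> F" and q: "q \<in> F" and pq: "p \<subseteq> q" for p q
  proof -
    have "comp_hom (as_struct (R p)) (ev q) (tr p q) s (\<nu> p s a) = a" if "(s, a) \<in> W p" for s a
      using \<nu>_car[OF p that] tr_\<nu>[OF p q pq that] ev_\<nu>[OF q] W_mono[OF pq] that by auto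
    then have "is_ev p (comp_hom (as_struct (R p)) (ev q) (tr p q))"
      unfolding is_ev_def using comp_hom_homs[OF Ob_struct[OF ROb[OF p]] tr_hom[OF p q pq] ev_hom[OF q]] by blast
    then show ?thesis using ev_ex[OF p] ev[OF p] by blast
  qed
  obtain Y where Y: "Y \<in> V" "F \<lesssim> Y" using diagram_small[OF A] unfolding F_def by blast
  \<comment> \<open>The objects of a small category are elements of the universe type, so the finite
    parts are coded by \<kappa>; \<open>d\<close> below decodes them.\<close>
  then obtain \<kappa> where \<kappa>: "inj_on \<kappa> F" "\<kappa> ` F \<subseteq> Y" unfolding lepoll_def by blast
  define d where "d i = inv_into F \<kappa> i" for i
  have d\<kappa>: "d (\<kappa> p) = p" if "p \<in> F" for p using \<kappa>(1) that by (simp add: d_def)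
  have dF: "d i \<in> F" if "i \<in> \<kappa> ` F" for i using that unfolding d_def by (rule inv_into_into)
  \<comment> \<open>An arbitrary element, serving as the only arrow whenever one part is contained
    in another: \<open>J\<close> is the poset of finite parts under inclusion, with unions as upper
    bounds.\<close>
  define pt :: 'u where "pt = undefined"
  define J :: "('u, 'u) category" where "J = \<lparr> Ob = \<kappa> ` F, Hom = (\<lambda>i j. if d i \<subseteq> d j then {pt} else {}),
    Id = (\<lambda>_. pt), Comp = (\<lambda>_ _ _ _ _. pt) \<rparr>"
  define D :: "('u, 'u, ('s, 'f, 'r, 'w, 'u) algebra, 's \<Rightarrow> 'u \<Rightarrow> 'u) cfunctor"
    where "D = \<lparr> fob = (\<lambda>i. R (d i)), farr = (\<lambda>i j _. tr (d i) (d j)) \<rparr>"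
  have J_simps: "Ob J = \<kappa> ` F" "Id J = (\<lambda>_. pt)" "Comp J = (\<lambda>_ _ _ _ _. pt)"
    and Hom_J: "\<And>i j f. f \<in> Hom J i j \<longleftrightarrow> d i \<subseteq> d j \<and> f = pt"
    and D_simps: "fob D = (\<lambda>i. R (d i))" "farr D = (\<lambda>i j _. tr (d i) (d j))"
    by (simp_all add: J_def D_def)
  have catJ: "is_category J"
    by (auto simp: is_category_def Hom_J J_simps)
  have small: "small_category V J"
    unfolding small_category_def
  proof (intro conjI ballI)
    show "Ob J \<in> V" unfolding J_simps by (rule small_universe_lepoll[OF V Y(1) subset_imp_lepoll[OF \<kappa>(2)]])
    show "Hom J i j \<in> V" for i j
      by (rule small_universe_lepoll[OF V small_universe_mem[OF V] finite_lepoll_infinite[OF infinite_K]])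
        (simp add: J_def)
  qed (rule catJ)
  have filtJ: "filtered J"
    unfolding filtered_def
  proof (intro conjI ballI)
    have "{} \<in> F" by (simp add: F_def)
    then show "Ob J \<noteq> {}" unfolding J_simps by blast
    fix i j assume ij: "i \<in> Ob J" "j \<in> Ob J"
    have *: "d i \<union> d j \<in> F" using dF ij unfolding J_simps F_def by blast
    have "pt \<in> Hom J i (\<kappa> (d i \<union> d j))" "pt \<in> Hom J j (\<kappa> (d i \<union> d j))"
      unfolding Hom_J d\<kappa>[OF *] by simp_all
    moreover have "\<kappa> (d i \<union> d j) \<in> Ob J" unfolding J_simps using * by (rule imageI)
    ultimately show "\<exists>k\<in>Ob J. Hom J i k \<noteq> {} \<and> Hom J j k \<noteq> {}" by blast
    have "pt \<in> Hom J j j" by (simp add: Hom_J)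
    then show "\<exists>k\<in>Ob J. \<exists>h\<in>Hom J j k. Comp J i j k h f = Comp J i j k h g" for f g
      using ij(2) unfolding J_simps(3) by blast
  qed
  have D_functor: "is_functor J C D"
    unfolding is_functor_def Alg_simps Hom_J J_simps D_simps
  proof (intro conjI ballI)
    show "R (d i) \<in> Ob C" if "i \<in> \<kappa> ` F" for i using ROb[OF dF[OF that]] .
    show "tr (d i) (d i) = id_hom (as_struct (R (d i)))" if "i \<in> \<kappa> ` F" for i using tr_id[OF dF[OF that]] .
  qed (auto simp: Hom_J tr_hom dF intro: tr_comp)
  obtain L c where L: "is_colimit J C D L c" using filtered_colimit_exists[OF small filtJ D_functor] by blast
  have "\<forall>i\<in>Ob J. fob D i \<in> \<E>" unfolding J_simps D_simps using R\<E> dF by blast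
  then have L\<E>: "L \<in> \<E>"
    using colimits small filtJ D_functor L unfolding closed_under_filtered_colimits_def by blast
  then have LOb: "L \<in> Ob C" using \<E> by blast
  have cocone: "is_cocone J C D L c" using L by (simp add: is_colimit_def)
  have c: "c (\<kappa> p) \<in> ahoms (R p) L" if "p \<in> F" for p
    using cocone that d\<kappa>[OF that] unfolding is_cocone_def Alg_simps J_simps D_simps by force
  have c_tr: "c (\<kappa> q) s (tr p q s x) = c (\<kappa> p) s x"
    if p: "p \<in> F" and q: "q \<in> F" and pq: "p \<subseteq> q" and x: "x \<in> car (as_struct (R p)) s" for p q s x
  proof -
    have "\<kappa> p \<in> Ob J" "\<kappa> q \<in> Ob J" "pt \<in> Hom J (\<kappa> p) (\<kappa> q)"
      using p q pq by (simp_all add: J_simps Hom_J d\<kappa>)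
    then have "Comp C (fob D (\<kappa> p)) (fob D (\<kappa> q)) L (c (\<kappa> q)) (farr D (\<kappa> p) (\<kappa> q) pt) = c (\<kappa> p)"
      using cocone unfolding is_cocone_def by blast
    then have "comp_hom (as_struct (R p)) (c (\<kappa> q)) (tr p q) = c (\<kappa> p)"
      by (simp add: Alg_simps D_simps d\<kappa> p q)
    then show ?thesis using comp_hom_apply[OF x, of "c (\<kappa> q)" "tr p q"] by simp
  qed
  \<comment> \<open>The evaluations form a cocone on \<open>A\<close>; the induced map
    \<open>u\<close> from the colimit is the intended retraction.\<close>
  have "is_cocone J C D A (\<lambda>i. ev (d i))"
    unfolding is_cocone_def Alg_simps J_simps D_simps
    using A ev_hom dF ev_comp by (auto simp: Hom_J d\<kappa>)
  from ex1_implies_ex[OF colimit_universal[OF L this]] obtain u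
    where u': "u \<in> Hom C L A \<and> (\<forall>i\<in>Ob J. Comp C (fob D i) L A u (c i) = ev (d i))" ..
  then have u: "u \<in> ahoms L A" by (simp add: Alg_simps)
  have uc: "comp_hom (as_struct (R (d i))) u (c i) = ev (d i)" if "i \<in> \<kappa> ` F" for i
    using bspec[OF conjunct2[OF u']] that unfolding Alg_simps J_simps D_simps by blast
  \<comment> \<open>The section sends an element to its name at the smallest stage mentioning it,
    viewed in the colimit.\<close>
  define sec where "sec s a = c (\<kappa> {Element s a}) s (\<nu> {Element s a} s a)" for s a
  have sec: "c (\<kappa> p) s (\<nu> p s a) = sec s a" if p: "p \<in> F" and sa: "(s, a) \<in> W p" for p s a
  proof -
    let ?e = "{Element s a}"
    have e: "?e \<in> F" using WM[OF p sa] by (auto simp: F_def diagram_def)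
    \<comment> \<open>Both stages lie below their union, and transition maps preserve names, so the
      two names of \<open>a\<close> become equal in the colimit.\<close>
    have q: "insert (Element s a) p \<in> F" using e p by (simp add: F_def)
    have sae: "(s, a) \<in> W ?e" by (simp add: W_def)
    let ?q = "insert (Element s a) p"
    have "c (\<kappa> p) s (\<nu> p s a) = c (\<kappa> ?q) s (\<nu> ?q s a)"
      using c_tr[OF p q subset_insertI \<nu>_car[OF p sa]] tr_\<nu>[OF p q subset_insertI sa] by simp
    also have "\<dots> = c (\<kappa> ?e) s (\<nu> ?e s a)"
      using c_tr[OF e q _ \<nu>_car[OF e sae]] tr_\<nu>[OF e q _ sae] by simp
    finally show ?thesis by (simp add: sec_def)
  qed
  have c_und: "hhom \<Sigma> (und (R p)) (und L) (c (\<kappa> p))" if "p \<in> F" for p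
    by (rule hhom_und[OF homs_hhom[OF c[OF that]]])
  have sec_hom: "hhom \<Sigma> (und A) (und L) sec"
    unfolding hhom_def
  proof (intro conjI ballI allI impI)
    fix s a assume a: "a \<in> car (und A) s"
    then have e: "{Element s a} \<in> F" by (auto simp: F_def diagram_def)
    show "sec s a \<in> car (und L) s"
      unfolding sec_def by (rule hhom_car[OF c_und[OF e]]) (use \<nu>_car[OF e, of s a] in \<open>simp add: W_def\<close>)
  next
    fix f as b assume f: "f \<in> Funs \<Sigma>" and ab: "opn (und A) f as = Some b"
    \<comment> \<open>At the stage consisting of this single atom the equation holds for the names
      by construction. Passing to the colimit and replacing the names there by \<open>sec\<close>
      gives preservation of \<open>f\<close>.\<close>
    let ?p = "{Equation f as b}"
    have p: "?p \<in> F" using ab by (auto simp: F_def diagram_def)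
    have "opn (und (R ?p)) f (map2 (\<nu> ?p) (fdom \<Sigma> f) as) = Some (\<nu> ?p (fcod \<Sigma> f) b)"
      using sat[OF p] by simp
    from hhom_opn[OF c_und[OF p] f this]
    have "opn (und L) f (map2 (c (\<kappa> ?p)) (fdom \<Sigma> f) (map2 (\<nu> ?p) (fdom \<Sigma> f) as)) =
      Some (c (\<kappa> ?p) (fcod \<Sigma> f) (\<nu> ?p (fcod \<Sigma> f) b))" .
    moreover have "map2 (c (\<kappa> ?p)) (fdom \<Sigma> f) (map2 (\<nu> ?p) (fdom \<Sigma> f) as) = map2 sec (fdom \<Sigma> f) as"
      by (rule map2_map2_zip, rule sec[OF p]) (simp add: W_def)
    moreover have "c (\<kappa> ?p) (fcod \<Sigma> f) (\<nu> ?p (fcod \<Sigma> f) b) = sec (fcod \<Sigma> f) b"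
      by (rule sec[OF p]) (simp add: W_def)
    ultimately show "opn (und L) f (map2 sec (fdom \<Sigma> f) as) = Some (sec (fcod \<Sigma> f) b)" by argo
  next
    fix Q as assume Q: "Q \<in> Rels \<Sigma>" and aq: "as \<in> rel (und A) Q"
    let ?p = "{Relation Q as}"
    have p: "?p \<in> F" using aq by (auto simp: F_def diagram_def)
    have "map2 (\<nu> ?p) (rdom \<Sigma> Q) as \<in> rel (und (R ?p)) Q"
      using sat[OF p] by simp
    from hhom_rel[OF c_und[OF p] Q this]
    have "map2 (c (\<kappa> ?p)) (rdom \<Sigma> Q) (map2 (\<nu> ?p) (rdom \<Sigma> Q) as) \<in> rel (und L) Q" .
    moreover have "map2 (c (\<kappa> ?p)) (rdom \<Sigma> Q) (map2 (\<nu> ?p) (rdom \<Sigma> Q) as) = map2 sec (rdom \<Sigma> Q) as"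
      by (rule map2_map2_zip, rule sec[OF p]) (simp add: W_def)
    ultimately show "map2 sec (rdom \<Sigma> Q) as \<in> rel (und L) Q" by argo
  qed
  have u_sec: "u s (sec s a) = a" if a: "a \<in> car (und A) s" for s a
  proof -
    let ?e = "{Element s a}"
    have e: "?e \<in> F" using a by (auto simp: F_def diagram_def)
    have sae: "(s, a) \<in> W ?e" by (simp add: W_def)
    have "comp_hom (as_struct (R ?e)) u (c (\<kappa> ?e)) = ev ?e"
      using uc[OF imageI[OF e]] by (simp add: d\<kappa> e)
    then have "u s (c (\<kappa> ?e) s (\<nu> ?e s a)) = ev ?e s (\<nu> ?e s a)"
      using comp_hom_apply[OF \<nu>_car[OF e sae], of u "c (\<kappa> ?e)"] by simp
    then show ?thesis using ev_\<nu>[OF e sae] by (simp add: sec_def)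
  qed
  have sec': "restr_hom (und A) sec \<in> homs \<Sigma> (und A) (und L)" by (rule restr_hom_homs[OF st sec_hom])
  have u_und: "u \<in> homs \<Sigma> (und L) (und A)"
    using hhom_und[OF homs_hhom[OF u]] u by (simp add: homs_iff)
  have "comp_hom (und A) u (restr_hom (und A) sec) = id_hom (und A)"
    by (rule homs_ext[OF comp_hom_homs[OF st sec' u_und] id_hom_homs[OF st]]) (simp add: u_sec)
  then have "is_U_retraction C (PMod V \<Sigma> T) forgetful L A u"
    using u sec' unfolding is_U_retraction_def Alg_simps by (auto simp: PMod_def forgetful_def)
  then show ?thesis using retracts L\<E> A unfolding closed_under_U_retracts_def by blast
qed

end

theorem theorem4p23:
  fixes K :: "'u set" and V :: "'u set set"
    and \<Sigma> :: "('s, 'f, 'r) hsig" and \<SS> :: "('s, 'f, 'r) sequent set"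
    and \<Omega> :: "('s, 'f, 'r, 'w) rsig" and E :: "('s, 'f + 'w, 'r) sequent set"
    and \<E> :: "('s, 'f, 'r, 'w, 'u) algebra set"
  assumes "small_universe K V"
    and "Sorts \<Sigma> \<lesssim> K" and "Funs \<Sigma> \<lesssim> K" and "Rels \<Sigma> \<lesssim> K" and "Ops \<Omega> \<lesssim> K"
    and "partial_horn_theory \<Sigma> \<SS>"
    and "relative_algebraic_theory \<Sigma> \<Omega> E"
    and "replete_full_subcategory (Alg V \<Sigma> \<SS> \<Omega> E) \<E>"
  shows "definable_by_judgments V \<Sigma> \<SS> \<Omega> E \<E> \<longleftrightarrow>
     closed_under_products V (Alg V \<Sigma> \<SS> \<Omega> E) \<E> \<and>
     closed_under_closed_subobjects \<Sigma> (Alg V \<Sigma> \<SS> \<Omega> E) \<E> \<and>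
     closed_under_U_retracts (Alg V \<Sigma> \<SS> \<Omega> E) (PMod V \<Sigma> \<SS>) forgetful \<E> \<and>
     closed_under_filtered_colimits V (Alg V \<Sigma> \<SS> \<Omega> E) \<E>"
  (is "?definable \<longleftrightarrow> ?closed")
proof -
  interpret relative_theory K V \<Sigma> \<SS> \<Omega> E
    using assms(1-7) by unfold_locales
  show ?thesis
  proof
    assume ?definable
    then obtain E' where "\<forall>\<sigma>\<in>E'. relative_judgment \<Sigma> \<Omega> \<sigma>" "\<E> = Ob (Alg V \<Sigma> \<SS> \<Omega> (E \<union> E'))"
      unfolding definable_by_judgments_def by blast
    then show ?closed using definable_imp_closed[of E' \<E>] by blast
  next
    assume closed: ?closed
    have \<E>: "\<E> \<subseteq> Ob C" using assms(8) by (simp add: replete_full_subcategory_def)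
    define E' where "E' = {\<sigma>. relative_judgment \<Sigma> \<Omega> \<sigma> \<and> (\<forall>B\<in>\<E>. valid_in (as_struct B) \<sigma>)}"
    have "\<E> = Ob (Alg V \<Sigma> \<SS> \<Omega> (E \<union> E'))"
    proof (intro set_eqI iffI)
      fix A assume "A \<in> \<E>"
      then show "A \<in> Ob (Alg V \<Sigma> \<SS> \<Omega> (E \<union> E'))" using \<E> unfolding Ob_Un_iff E'_def by blast
    next
      fix A assume "A \<in> Ob (Alg V \<Sigma> \<SS> \<Omega> (E \<union> E'))"
      then have A: "A \<in> Ob C" "\<forall>\<sigma>\<in>E'. valid_in (as_struct A) \<sigma>" unfolding Ob_Un_iff by blast+
      have valid: "valid_in (as_struct A) \<sigma>"
        if "relative_judgment \<Sigma> \<Omega> \<sigma>" "\<And>B. B \<in> \<E> \<Longrightarrow> valid_in (as_struct B) \<sigma>" for \<sigma>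
        using A(2) that unfolding E'_def by blast
      from closed show "A \<in> \<E>"
        by (elim conjE, intro closed_imp_mem[OF \<E> _ _ _ _ A(1)]) (assumption+, rule valid, assumption, blast)
    qed
    moreover have "\<forall>\<sigma>\<in>E'. relative_judgment \<Sigma> \<Omega> \<sigma>" by (simp add: E'_def)
    ultimately show ?definable unfolding definable_by_judgments_def by blast
  qed
qed

end
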